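(* Assume the following. (1) $C_{pen}\ge 8C_{trace}$, where $C_{trace}>0$ is a constant such that for every $\bar v\in\overline{\mathcal V}$, $v'\in\mathcal V'_{disc}$ and $\Omega_K\in\mathcal M$, each $w\in\{\bar v,v'\}$ satisfies $\|w\|^2_{0,\Gamma_K}\le \frac{C_{trace}}{h_K}\|w\|^2_{0,\Omega_K}$ and $\|\nabla w\cdot\boldsymbol n\|^2_{0,\Gamma_K}\le\frac{C_{trace}}{h_K}|w|^2_{1,\Omega_K}$. (2) On each element $\Omega_K$, $\kappa_{art}=C_{art}\left(\max\left\{\frac{\|\boldsymbol a\|_{0,\infty,\Omega_K}}{h_K},\frac{C_{inv}\kappa}{h_K^2}\right\}\right)^{-1}\|\boldsymbol a\|^2_{0,\infty,\Omega_K}$, where $C_{art}\ge0$ is a constant and $C_{inv}>0$ is a constant such that for every $\bar v\in\overline{\mathcal V}$, $v'\in\mathcal V'_{disc}$ and $\Omega_K\in\mathcal M$, each $w\in\{\bar v,v'\}$ satisfies $|w|^2_{1,\Omega_K}\le\frac{C_{inv}}{h_K^2}\|w\|^2_{0,\Omega_K}$ and $\|\Delta w\|^2_{0,\Omega_K}\le\frac{C_{inv}}{h_K^2}|w|^2_{1,\Omega_K}$. Then there is a constant $\beta>0$, independent of $\boldsymbol a$, $\kappa$ and the mesh size $h=\max_Kh_K$, such that $$\inf_{\mathbf 0\ne\mathbf U^h\in\boldsymbol{\mathcal V}^h}\ \sup_{\mathbf 0\ne\mathbf V^h\in\boldsymbol{\mathcal V}^h}\frac{\mathbf B(\mathbf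 U^h,\mathbf V^h)}{\|\mathbf U^h\|_S\,\|\mathbf V^h\|_S}\ \ge\ \beta ,$$ where for $\mathbf V^h=(\bar v,v')$ $$\|\mathbf V^h\|_S^2=\kappa|\bar v|^2_{1,\Omega}+\sum_{K=1}^{n_{el}}\left((\kappa+\kappa_{art})|v'|^2_{1,\Omega_K}+\frac{C_{pen}\kappa}{h_K}\|v'\|^2_{0,\Gamma_K}+\||a_n|^{1/2}v'\|^2_{0,\Gamma_K}\right)+\sum_{K=1}^{n_{el}}\|\tau_K^{1/2}\mathcal P'_K(\boldsymbol a\cdot\nabla(\bar v+v'))\|^2_{0,\Omega_K}.$$
   Context: Setting. $\Omega\subset\mathbb R^d$ ($d\in\{2,3\}$) is a bounded polygonal/polyhedral domain, partitioned by a conforming mesh $\mathcal M=\{\Omega_K\}_{K=1}^{n_{el}}$ of simplices or of parallelotopes (affine images of a reference element); $\Gamma_K=\partial\Omega_K$, $\boldsymbol n$ is the unit outward normal on $\Gamma_K$, and $h_K$ is the size (e.g. diameter) of $\Omega_K$. $\boldsymbol a:\Omega\to\mathbb R^d$ is a smooth (up to the boundary) divergence-free velocity field, $\kappa>0$ is a constant diffusivity, $C_{pen}>0$ is a constant, and $\kappa_{art}\ge 0$ is an artificial diffusivity, constant on each element. On $\Gamma_K$, $a_n=\boldsymbol a\cdot\boldsymbol n$ and $a_n^+=\max\{a_n,0\}$. Spaces. $\overline{\mathcal V}\subset H^1_0(\Omega)$ is the space of continuous functions vanishing on $\partial\Omega$ whose restriction to each element is a polynomial of degree $p\ge1$ (simplices)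 or (the affine image of) a tensor-product polynomial of degree $p$ (parallelotopes). $\mathcal V'_{disc}\subset L^2(\Omega)$ is the space of functions, with no inter-element continuity and no boundary conditions, whose restriction to each element is a polynomial (resp. tensor-product polynomial) of degree $p_f$; $\mathcal V'_{disc,K}$ is the space of its restrictions to $\Omega_K$, and $\mathcal P'_K$ is the $L^2(\Omega_K)$-orthogonal projector onto $\mathcal V'_{disc,K}$. $\boldsymbol{\mathcal V}^h=\overline{\mathcal V}\times\mathcal V'_{disc}$. Norms. $\|\cdot\|_{0,D}$ is the $L^2(D)$ norm, $|v|_{1,D}=\|\nabla v\|_{L^2(D)}$, and $\|\boldsymbol a\|_{0,\infty,D}=\operatorname{ess\,sup}_D|\boldsymbol a|$. Moreover $$\tau_K=C_\tau\left(\max\left\{\frac{\|\boldsymbol a\|_{0,\infty,\Omega_K}}{h_K},\frac{C_{inv}\kappa}{h_K^2}\right\}\right)^{-1}$$ with $C_\tau>0$ an arbitrary positive constant. Bilinear form. For $\mathbf U^h=(\bar u,u')$, $\mathbf V^h=(\bar v,v')$ in $\boldsymbol{\mathcal V}^h$, $$\mathbf B(\mathbf U^h,\mathbf V^h)=\bar B(\bar u,\bar v)+\bar C(u',\bar v)+C'(\bar u,v')+B'(u',v'),$$ $$\bar B(\bar u,\bar v)=-\int_\Omega\bar u\,\boldsymbol a\cdot\nabla\bar v+\int_\Omega\kappa\nabla\bar u\cdot\nabla\bar v,\qquad \bar C(u',\bar v)=-\sum_K\int_{\Omega_K}u'\,\boldsymbol a\cdot\nabla\bar v,$$ $$C'(\bar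 u,v')=\sum_K\int_{\Omega_K}v'\left(\boldsymbol a\cdot\nabla\bar u-\nabla\cdot(\kappa\nabla\bar u)\right),$$ $$B'(u',v')=\sum_K\Big(-\int_{\Omega_K}u'\boldsymbol a\cdot\nabla v'+\int_{\Omega_K}(\kappa+\kappa_{art})\nabla u'\cdot\nabla v'+\int_{\Gamma_K}u'v'a_n^+-\int_{\Gamma_K}\kappa\nabla u'\cdot\boldsymbol n\,v'-\int_{\Gamma_K}u'\kappa\nabla v'\cdot\boldsymbol n+\int_{\Gamma_K}\frac{C_{pen}\kappa}{h_K}u'v'\Big),$$ where derivatives on $\Omega_K$ and traces on $\Gamma_K$ are taken from inside $\Omega_K$. Convention on constants. "Independent of $\boldsymbol a$, $\kappa$ and $h$" means that the constant may depend only on the fixed data $\Omega$, $d$, $p$, $p_f$, the mesh (shape) regularity, and the constants $C_{trace},C_{inv},C_{pen},C_{art},C_\tau$. *)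

theory Defs
  imports "HOL-Probability.Essential_Supremum"
begin

section \<open>Domain and mesh\<close>

text \<open>The condition that \<open>\<Omega>\<close> is the interior of its closure excludes slit domains.\<close>

definition polyhedral_domain :: "'a::euclidean_space set \<Rightarrow> bool" where
  "polyhedral_domain \<Omega> \<longleftrightarrow>
     open \<Omega> \<and> connected \<Omega> \<and> bounded \<Omega> \<and> \<Omega> \<noteq> {} \<and> interior (closure \<Omega>) = \<Omega> \<and>
     (\<exists>\<P>. finite \<P> \<and> (\<forall>P\<in>\<P>. polytope P) \<and> closure \<Omega> = \<Union>\<P>)"

datatype cell_shape = Simplices | Parallelotopes

definition ref_parallelotope_map :: "'a::euclidean_space set \<Rightarrow> ('a \<Rightarrow> 'a) \<Rightarrow> bool" where
  "ref_parallelotope_map K T \<longleftrightarrow>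
     (\<exists>c L. linear L \<and> inj L \<and> T = (\<lambda>x. c + L x)) \<and> T ` cbox 0 One = K"

fun is_cell :: "cell_shape \<Rightarrow> 'a::euclidean_space set \<Rightarrow> bool" where
  "is_cell Simplices K \<longleftrightarrow> int DIM('a) simplex K"
| "is_cell Parallelotopes K \<longleftrightarrow> (\<exists>T. ref_parallelotope_map K T)"

text \<open>A mesh is a finite set of closed cells \<open>K\<close>; the open element \<open>\<Omega>\<^sub>K\<close> is \<open>interior K\<close>, and
  \<open>\<Gamma>\<^sub>K\<close> is the union of the facets of \<open>K\<close>.\<close>

definition conforming_mesh :: "cell_shape \<Rightarrow> 'a::euclidean_space set \<Rightarrow> 'a set set \<Rightarrow> bool" where
  "conforming_mesh s \<Omega> \<M> \<longleftrightarrow>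
     finite \<M> \<and> (\<forall>K\<in>\<M>. is_cell s K) \<and> \<Union>\<M> = closure \<Omega> \<and>
     (\<forall>K\<in>\<M>. \<forall>L\<in>\<M>. K \<noteq> L \<longrightarrow> interior K \<inter> interior L = {}) \<and>
     (\<forall>K\<in>\<M>. \<forall>L\<in>\<M>. K \<inter> L face_of K \<and> K \<inter> L face_of L)"

text \<open>The mesh size \<open>h\<^sub>K\<close> is \<^term>\<open>diameter K\<close>. Shape regularity bounds the ratio of \<open>h\<^sub>K\<close> to the
  diameter of the largest ball inscribed in \<open>K\<close>.\<close>

definition inball_diameter :: "'a::euclidean_space set \<Rightarrow> real" where
  "inball_diameter K = Sup {2 * r | r. 0 \<le> r \<and> (\<exists>x. cball x r \<subseteq> K)}"

definition shape_regular :: "real \<Rightarrow> 'a::euclidean_space set set \<Rightarrow> bool" where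
  "shape_regular \<sigma> \<M> \<longleftrightarrow> (\<forall>K\<in>\<M>. diameter K \<le> \<sigma> * inball_diameter K)"


section \<open>Derivatives, traces, integrals and norms\<close>

definition grad :: "('a::euclidean_space \<Rightarrow> real) \<Rightarrow> 'a \<Rightarrow> 'a" where
  "grad u x = (\<Sum>b\<in>Basis. frechet_derivative u (at x) b *\<^sub>R b)"

definition divg :: "('a::euclidean_space \<Rightarrow> 'a) \<Rightarrow> 'a \<Rightarrow> real" where
  "divg f x = (\<Sum>b\<in>Basis. frechet_derivative f (at x) b \<bullet> b)"

definition laplacian :: "('a::euclidean_space \<Rightarrow> real) \<Rightarrow> 'a \<Rightarrow> real" where
  "laplacian u = divg (grad u)"

text \<open>\<open>C\<^sup>\<infinity>\<close> up to the boundary: the partial derivatives of all orders exist in \<open>\<Omega>\<close> and extend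
  continuously to the closure. The function \<open>D [b\<^sub>1, \<dots>, b\<^sub>k]\<close> is the (extended) derivative of \<open>f\<close>
  in the coordinate directions \<open>b\<^sub>k, \<dots>, b\<^sub>1\<close>.\<close>

definition smooth_up_to_boundary ::
  "'a::euclidean_space set \<Rightarrow> ('a \<Rightarrow> 'b::real_normed_vector) \<Rightarrow> bool" where
  "smooth_up_to_boundary \<Omega> f \<longleftrightarrow>
     (\<exists>D :: 'a list \<Rightarrow> 'a \<Rightarrow> 'b. D [] = f \<and>
        (\<forall>bs \<in> lists Basis. continuous_on (closure \<Omega>) (D bs) \<and>
           (\<forall>x\<in>\<Omega>. (D bs has_derivative (\<lambda>v. \<Sum>b\<in>Basis. (v \<bullet> b) *\<^sub>R D (b # bs) x)) (at x))))"

text \<open>Trace on \<open>\<Gamma>\<^sub>K\<close> from inside \<open>\<Omega>\<^sub>K\<close>.\<close>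

definition trace_from :: "'a::euclidean_space set \<Rightarrow> ('a \<Rightarrow> 'b::t2_space) \<Rightarrow> 'a \<Rightarrow> 'b" where
  "trace_from K f x = Lim (at x within interior K) f"

definition outward_normal :: "'a::euclidean_space set \<Rightarrow> 'a set \<Rightarrow> 'a" where
  "outward_normal K F =
     (THE n. norm n = 1 \<and> (\<exists>c. (\<forall>x\<in>F. n \<bullet> x = c) \<and> (\<forall>x\<in>K. n \<bullet> x \<le> c)))"

text \<open>Surface integral over a facet \<open>F\<close> with unit normal \<open>n\<close>. By Fubini, \<open>(d-1)\<close>-dimensional Lebesgue
  measure on the hyperplane spanned by \<open>F\<close> is \<open>d\<close>-dimensional Lebesgue measure of the right prism of
  height 1 over \<open>F\<close>; there \<^term>\<open>closest_point F\<close> is the projection \<open>y + t n \<mapsto> y\<close> onto the base.\<close>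

definition facet_integral :: "'a::euclidean_space set \<Rightarrow> 'a \<Rightarrow> ('a \<Rightarrow> real) \<Rightarrow> real" where
  "facet_integral F n g =
     (LINT x : {y + t *\<^sub>R n | y t. y \<in> F \<and> 0 \<le> t \<and> t \<le> 1} | lebesgue. g (closest_point F x))"

text \<open>Integral over \<open>\<Gamma>\<^sub>K\<close>. The integrand also receives the outward unit normal as its first argument,
  which is constant on each facet.\<close>

definition bd_integral :: "'a::euclidean_space set \<Rightarrow> ('a \<Rightarrow> 'a \<Rightarrow> real) \<Rightarrow> real" where
  "bd_integral K g =
     (\<Sum>F | F facet_of K. facet_integral F (outward_normal K F) (g (outward_normal K F)))"

definition L2_norm :: "'a::euclidean_space set \<Rightarrow> ('a \<Rightarrow> real) \<Rightarrow> real" where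
  "L2_norm D f = sqrt (LINT x : D | lebesgue. (f x)\<^sup>2)"

definition bd_norm :: "'a::euclidean_space set \<Rightarrow> ('a \<Rightarrow> 'a \<Rightarrow> real) \<Rightarrow> real" where
  "bd_norm K g = sqrt (bd_integral K (\<lambda>n x. (g n x)\<^sup>2))"

definition H1_seminorm :: "'a::euclidean_space set \<Rightarrow> ('a \<Rightarrow> real) \<Rightarrow> real" where
  "H1_seminorm D v = L2_norm D (\<lambda>x. norm (grad v x))"

definition Linf_norm :: "'a::euclidean_space set \<Rightarrow> ('a \<Rightarrow> 'a) \<Rightarrow> real" where
  "Linf_norm D f = real_of_ereal (esssup (lebesgue_on D) (\<lambda>x. ereal (norm (f x))))"


section \<open>Discrete spaces\<close>

definition poly_total :: "nat \<Rightarrow> ('a::euclidean_space \<Rightarrow> real) set" where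
  "poly_total p = {f. \<exists>c. \<forall>x. f x =
     (\<Sum>\<alpha> | \<alpha> \<in> Basis \<rightarrow>\<^sub>E {..p} \<and> sum \<alpha> Basis \<le> p. c \<alpha> * (\<Prod>b\<in>Basis. (x \<bullet> b) ^ \<alpha> b))}"

definition poly_tensor :: "nat \<Rightarrow> ('a::euclidean_space \<Rightarrow> real) set" where
  "poly_tensor p = {f. \<exists>c. \<forall>x. f x =
     (\<Sum>\<alpha> \<in> Basis \<rightarrow>\<^sub>E {..p}. c \<alpha> * (\<Prod>b\<in>Basis. (x \<bullet> b) ^ \<alpha> b))}"

text \<open>Polynomials on \<open>K\<close>, as functions on the whole space. On a parallelotope they are the images of
  tensor-product polynomials on the unit cube; the choice of the reference map \<open>T\<close> is irrelevant, since
  two of them differ by a symmetry of the cube.\<close>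

fun local_space :: "cell_shape \<Rightarrow> nat \<Rightarrow> 'a::euclidean_space set \<Rightarrow> ('a \<Rightarrow> real) set" where
  "local_space Simplices p K = poly_total p"
| "local_space Parallelotopes p K = {f. \<exists>T. ref_parallelotope_map K T \<and> f \<circ> T \<in> poly_tensor p}"

text \<open>Values on the mesh skeleton (a null set) are unconstrained: functions of the discontinuous
  space matter only up to null sets.\<close>

definition V_disc :: "cell_shape \<Rightarrow> nat \<Rightarrow> 'a::euclidean_space set set \<Rightarrow> ('a \<Rightarrow> real) set" where
  "V_disc s p \<M> = {v. \<forall>K\<in>\<M>. \<exists>q \<in> local_space s p K. \<forall>x \<in> interior K. v x = q x}"

definition V_bar ::
  "cell_shape \<Rightarrow> nat \<Rightarrow> 'a::euclidean_space set \<Rightarrow> 'a set set \<Rightarrow> ('a \<Rightarrow> real) set" where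
  "V_bar s p \<Omega> \<M> =
     {v \<in> V_disc s p \<M>. continuous_on (closure \<Omega>) v \<and> (\<forall>x \<in> frontier \<Omega>. v x = 0)}"

text \<open>Pairs that are nonzero as elements of \<open>L\<^sup>2(\<Omega>) \<times> L\<^sup>2(\<Omega>)\<close>.\<close>

definition nonzero_pairs :: "cell_shape \<Rightarrow> nat \<Rightarrow> nat \<Rightarrow> 'a::euclidean_space set \<Rightarrow> 'a set set
    \<Rightarrow> (('a \<Rightarrow> real) \<times> ('a \<Rightarrow> real)) set" where
  "nonzero_pairs s p p\<^sub>f \<Omega> \<M> = {U \<in> V_bar s p \<Omega> \<M> \<times> V_disc s p\<^sub>f \<M>.
     \<not> (AE x in lebesgue_on \<Omega>. fst U x = 0 \<and> snd U x = 0)}"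

text \<open>\<open>L\<^sup>2(\<Omega>\<^sub>K)\<close>-orthogonal projection onto the restrictions of \<^const>\<open>V_disc\<close> to \<open>\<Omega>\<^sub>K\<close>.\<close>

definition L2_proj ::
  "cell_shape \<Rightarrow> nat \<Rightarrow> 'a::euclidean_space set \<Rightarrow> ('a \<Rightarrow> real) \<Rightarrow> 'a \<Rightarrow> real" where
  "L2_proj s p\<^sub>f K f = (SOME g. g \<in> local_space s p\<^sub>f K \<and>
     (\<forall>w \<in> local_space s p\<^sub>f K. (LINT x : interior K | lebesgue. (f x - g x) * w x) = 0))"


section \<open>Bilinear form and stability norm\<close>

definition rate :: "real \<Rightarrow> real \<Rightarrow> ('a::euclidean_space \<Rightarrow> 'a) \<Rightarrow> 'a set \<Rightarrow> real" where
  "rate C_inv \<kappa> a K =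
     max (Linf_norm (interior K) a / diameter K) (C_inv * \<kappa> / (diameter K)\<^sup>2)"

definition tau :: "real \<Rightarrow> real \<Rightarrow> real \<Rightarrow> ('a::euclidean_space \<Rightarrow> 'a) \<Rightarrow> 'a set \<Rightarrow> real" where
  "tau C_\<tau> C_inv \<kappa> a K = C_\<tau> * inverse (rate C_inv \<kappa> a K)"

definition Bbar where
  "Bbar \<Omega> a \<kappa> u v =
     - (LINT x : \<Omega> | lebesgue. u x * (a x \<bullet> grad v x))
     + (LINT x : \<Omega> | lebesgue. \<kappa> * (grad u x \<bullet> grad v x))"

definition Cbar where
  "Cbar \<M> a u' v = - (\<Sum>K\<in>\<M>. LINT x : interior K | lebesgue. u' x * (a x \<bullet> grad v x))"

definition Cprime where
  "Cprime \<M> a \<kappa> u v' = (\<Sum>K\<in>\<M>. LINT x : interior K | lebesgue.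
     v' x * (a x \<bullet> grad u x - divg (\<lambda>y. \<kappa> *\<^sub>R grad u y) x))"

definition Bprime where
  "Bprime \<M> a \<kappa> \<kappa>_art C_pen u' v' = (\<Sum>K\<in>\<M>.
     - (LINT x : interior K | lebesgue. u' x * (a x \<bullet> grad v' x))
     + (LINT x : interior K | lebesgue. (\<kappa> + \<kappa>_art K) * (grad u' x \<bullet> grad v' x))
     + bd_integral K (\<lambda>n x. trace_from K u' x * trace_from K v' x * max (a x \<bullet> n) 0)
     - bd_integral K (\<lambda>n x. \<kappa> * (trace_from K (grad u') x \<bullet> n) * trace_from K v' x)
     - bd_integral K (\<lambda>n x. trace_from K u' x * (\<kappa> * (trace_from K (grad v') x \<bullet> n)))
     + bd_integral K (\<lambda>n x. C_pen * \<kappa> / diameter K * (trace_from K u' x * trace_from K v' x)))"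

definition Bform :: "'a::euclidean_space set \<Rightarrow> 'a set set \<Rightarrow> ('a \<Rightarrow> 'a) \<Rightarrow> real \<Rightarrow> ('a set \<Rightarrow> real)
    \<Rightarrow> real \<Rightarrow> ('a \<Rightarrow> real) \<times> ('a \<Rightarrow> real) \<Rightarrow> ('a \<Rightarrow> real) \<times> ('a \<Rightarrow> real) \<Rightarrow> real" where
  "Bform \<Omega> \<M> a \<kappa> \<kappa>_art C_pen U V =
     Bbar \<Omega> a \<kappa> (fst U) (fst V) + Cbar \<M> a (snd U) (fst V)
     + Cprime \<M> a \<kappa> (fst U) (snd V) + Bprime \<M> a \<kappa> \<kappa>_art C_pen (snd U) (snd V)"

definition S_norm :: "cell_shape \<Rightarrow> nat \<Rightarrow> 'a::euclidean_space set \<Rightarrow> 'a set set \<Rightarrow> ('a \<Rightarrow> 'a) \<Rightarrow> real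
    \<Rightarrow> ('a set \<Rightarrow> real) \<Rightarrow> real \<Rightarrow> real \<Rightarrow> real \<Rightarrow> ('a \<Rightarrow> real) \<times> ('a \<Rightarrow> real) \<Rightarrow> real" where
  "S_norm s p\<^sub>f \<Omega> \<M> a \<kappa> \<kappa>_art C_pen C_inv C_\<tau> V = sqrt (
     \<kappa> * (H1_seminorm \<Omega> (fst V))\<^sup>2
     + (\<Sum>K\<in>\<M>. (\<kappa> + \<kappa>_art K) * (H1_seminorm (interior K) (snd V))\<^sup>2
          + C_pen * \<kappa> / diameter K * (bd_norm K (\<lambda>n. trace_from K (snd V)))\<^sup>2
          + (bd_norm K (\<lambda>n x. sqrt \<bar>a x \<bullet> n\<bar> * trace_from K (snd V) x))\<^sup>2)
     + (\<Sum>K\<in>\<M>. (L2_norm (interior K) (\<lambda>x. sqrt (tau C_\<tau> C_inv \<kappa> a K) *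
          L2_proj s p\<^sub>f K (\<lambda>y. a y \<bullet> grad (\<lambda>z. fst V z + snd V z) y) x))\<^sup>2))"


section \<open>Trace and inverse inequalities\<close>

definition trace_inequalities ::
  "real \<Rightarrow> 'a::euclidean_space set set \<Rightarrow> ('a \<Rightarrow> real) set \<Rightarrow> bool" where
  "trace_inequalities C_trace \<M> W \<longleftrightarrow> (\<forall>w\<in>W. \<forall>K\<in>\<M>.
     (bd_norm K (\<lambda>n. trace_from K w))\<^sup>2 \<le> C_trace / diameter K * (L2_norm (interior K) w)\<^sup>2 \<and>
     (bd_norm K (\<lambda>n x. trace_from K (grad w) x \<bullet> n))\<^sup>2
       \<le> C_trace / diameter K * (H1_seminorm (interior K) w)\<^sup>2)"

definition inverse_inequalities ::
  "real \<Rightarrow> 'a::euclidean_space set set \<Rightarrow> ('a \<Rightarrow> real) set \<Rightarrow> bool" where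
  "inverse_inequalities C_inv \<M> W \<longleftrightarrow> (\<forall>w\<in>W. \<forall>K\<in>\<M>.
     (H1_seminorm (interior K) w)\<^sup>2 \<le> C_inv / (diameter K)\<^sup>2 * (L2_norm (interior K) w)\<^sup>2 \<and>
     (L2_norm (interior K) (laplacian w))\<^sup>2
       \<le> C_inv / (diameter K)\<^sup>2 * (H1_seminorm (interior K) w)\<^sup>2)"

end

theory Submission
  imports Defs
begin

text \<open>Testing with \<open>V = U\<close> controls every part of the norm except the streamline term: the advective terms
  reduce to half the boundary flux because \<open>a\<close> is divergence free, and the penalty absorbs the consistency terms
  because \<open>C\<^sub>p\<^sub>e\<^sub>n \<ge> 8 C\<^sub>t\<^sub>r\<^sub>a\<^sub>c\<^sub>e\<close>. Testing with \<open>V = (0, \<tau>\<^sub>K \<P>'\<^sub>K(a \<cdot> \<nabla>(u + u')))\<close>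
  produces the streamline term up to multiples of the coercive part. According to which part of the norm of \<open>U\<close>
  dominates, one of these two test functions gives the bound, so that no linear combination is needed.

  The divergence theorem on a polytope rests on the fact that a compactly supported Lipschitz function has
  directional derivatives of integral zero, which is translation invariance of Lebesgue measure. It is applied to the
  given function times a cutoff of width \<open>1/m\<close> at every facet; a stretch by the factor \<open>m\<close> along the
  normal turns the boundary layers into the prisms that define the surface integral.\<close>

section \<open>Scaling Lebesgue measure along a direction\<close>

text \<open>Let A be the energy part and P the streamline part of the squared norm of
  \<open>U\<close>. The first test yields A/4, the second P/2 - D A, and its test function has
  squared norm at most T P. The cases are separated at P = 4 D A: below it A + P <= (1 + 4 D) A,
  above it P/2 - D A > P/4. The two entries of the minimum defining \<beta> are the resulting
  quotients.

  D and T must not see the velocity, \<kappa> or the mesh size. Each inverse or trace inequality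
  costs powers of 1/h, and these are paid for by \<open>\<tau> * (L / h)\<close> and
  \<open>\<tau> * (Ci * \<kappa> / h\<^sup>2)\<close> being at most \<open>C\<tau>\<close>, together
  with the analogous bound for the artificial diffusivity. The projector is what makes the second
  test function admissible, and its orthogonality is what turns the advective terms into a square.

  A quotient by 0 is 0 in HOL, so a nonzero pair of norm 0 would refute the bound. Hence
  definiteness of the energy part and nonvanishing of the second test function have to be proved as
  well.\<close>

lemma nn_integral_lborel_translate:
  fixes f :: "'a::euclidean_space \<Rightarrow> ennreal"
  assumes "f \<in> borel_measurable borel"
  shows "(\<integral>\<^sup>+x. f (x + c) \<partial>lborel) = (\<integral>\<^sup>+x. f x \<partial>lborel)"
proof -
  have "(\<integral>\<^sup>+x. f x \<partial>lborel) = (\<integral>\<^sup>+x. f x \<partial>distr lborel borel ((+) c))"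
    by (simp add: lborel_distr_plus)
  also have "\<dots> = (\<integral>\<^sup>+x. f (c + x) \<partial>lborel)"
    using assms by (subst nn_integral_distr) auto
  finally show ?thesis by (simp add: add.commute)
qed

text \<open>Uniqueness of Haar measure: integrate \<open>1\<^sub>C(x) 1\<^sub>E(T y)\<close> over pairs, with \<open>C\<close> the unit ball,
  and shift the variables.\<close>

lemma emeasure_linear_vimage:
  fixes T S :: "'a::euclidean_space \<Rightarrow> 'a"
  assumes lin: "linear T" and inv: "\<And>x. T (S x) = x" and E: "E \<in> sets borel"
  defines "C \<equiv> ball 0 1"
  shows "emeasure lborel C * emeasure lborel (T -` E) = emeasure lborel E * emeasure lborel (T -` C)"
proof -
  have cont: "continuous_on UNIV T"
    using lin by (simp add: linear_continuous_on linear_linear)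
  have Tm [measurable]: "T \<in> borel_measurable borel"
    using cont by (rule borel_measurable_continuous_onI)
  note E [measurable]
  have C [measurable]: "C \<in> sets borel" by (simp add: C_def)
  \<comment> \<open>Moving \<open>y\<close> by \<open>S x\<close> moves \<open>T y\<close> by
    \<open>x\<close>, so a translation in one variable can be absorbed by the other.\<close>
  have add: "T (y + S x) = T y + x" for x y
    using lin inv by (simp add: linear_add)
  have "emeasure lborel C * emeasure lborel (T -` E)
      = (\<integral>\<^sup>+x. (\<integral>\<^sup>+y. indicator C x * indicator E (T y) \<partial>lborel) \<partial>lborel)"
  proof -
    have "(\<integral>\<^sup>+y. indicator E (T y) \<partial>lborel) = emeasure lborel (T -` E)"
    proof -
      have "(\<lambda>y. indicator E (T y) :: ennreal) = indicator (T -` E)"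
        by (auto simp: indicator_def fun_eq_iff)
      then show ?thesis
        using measurable_sets[OF Tm E] by simp
    qed
    then show ?thesis
      by (simp add: nn_integral_cmult nn_integral_multc)
  qed
  also have "\<dots> = (\<integral>\<^sup>+x. (\<integral>\<^sup>+y. indicator C x * indicator E (T y + x) \<partial>lborel) \<partial>lborel)"
  proof (rule nn_integral_cong)
    fix x
    have "(\<lambda>y. indicator C x * indicator E (T y) :: ennreal) \<in> borel_measurable borel" by measurable
    from nn_integral_lborel_translate[OF this, of "S x"]
    show "(\<integral>\<^sup>+y. indicator C x * indicator E (T y) \<partial>lborel)
        = (\<integral>\<^sup>+y. indicator C x * indicator E (T y + x) \<partial>lborel)"
      by (simp add: add)
  qed
  also have "\<dots> = (\<integral>\<^sup>+y. (\<integral>\<^sup>+x. indicator C x * indicator E (T y + x) \<partial>lborel) \<partial>lborel)"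
    by (rule lborel_pair.Fubini') measurable
  also have "\<dots> = (\<integral>\<^sup>+y. (\<integral>\<^sup>+x. indicator C (x - T y) * indicator E x \<partial>lborel) \<partial>lborel)"
  proof (rule nn_integral_cong)
    fix y
    have "(\<lambda>x. indicator C x * indicator E (T y + x) :: ennreal) \<in> borel_measurable borel" by measurable
    from nn_integral_lborel_translate[OF this, of "- T y"]
    show "(\<integral>\<^sup>+x. indicator C x * indicator E (T y + x) \<partial>lborel)
        = (\<integral>\<^sup>+x. indicator C (x - T y) * indicator E x \<partial>lborel)"
      by simp
  qed
  also have "\<dots> = (\<integral>\<^sup>+x. (\<integral>\<^sup>+y. indicator C (x - T y) * indicator E x \<partial>lborel) \<partial>lborel)"
    by (rule lborel_pair.Fubini') measurable
  also have "\<dots> = (\<integral>\<^sup>+x. (\<integral>\<^sup>+y. indicator C (T y) * indicator E x \<partial>lborel) \<partial>lborel)"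
  proof (rule nn_integral_cong)
    fix x
    have "(\<integral>\<^sup>+y. indicator C (x - T y) * indicator E x \<partial>lborel)
       = (\<integral>\<^sup>+y. indicator C (x - T (y + S x)) * indicator E x \<partial>lborel)"
      by (subst nn_integral_lborel_translate[of "\<lambda>y. indicator C (x - T y) * indicator E x" "S x"]) auto
    \<comment> \<open>Here \<open>C\<close> must be symmetric: the shift leaves \<open>- T y\<close>
      inside the indicator, and the centred ball does not see the sign.\<close>
    also have "\<dots> = (\<integral>\<^sup>+y. indicator C (T y) * indicator E x \<partial>lborel)"
      by (simp add: add C_def indicator_def)
    finally show "(\<integral>\<^sup>+y. indicator C (x - T y) * indicator E x \<partial>lborel)
       = (\<integral>\<^sup>+y. indicator C (T y) * indicator E x \<partial>lborel)" .
  qed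
  also have "\<dots> = emeasure lborel E * emeasure lborel (T -` C)"
  proof -
    have "(\<integral>\<^sup>+y. indicator C (T y) \<partial>lborel) = emeasure lborel (T -` C)"
    proof -
      have "(\<lambda>y. indicator C (T y) :: ennreal) = indicator (T -` C)"
        by (auto simp: indicator_def fun_eq_iff)
      then show ?thesis
        using measurable_sets[OF Tm C] by simp
    qed
    then show ?thesis
      by (simp add: nn_integral_cmult nn_integral_multc mult.commute)
  qed
  finally show ?thesis .
qed

text \<open>Along \<open>n\<close>, \<open>squeeze n r c\<close> maps the slab \<open>c \<le> n \<bullet> x \<le> c + 1\<close> onto \<open>c - 1/r \<le> n \<bullet> x \<le> c\<close>.\<close>

definition squeeze :: "'a::euclidean_space \<Rightarrow> real \<Rightarrow> real \<Rightarrow> 'a \<Rightarrow> 'a" where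
  "squeeze n r c x = x + ((n \<bullet> x - c - 1) / r - (n \<bullet> x - c)) *\<^sub>R n"

lemma inner_squeeze: "norm n = 1 \<Longrightarrow> n \<bullet> squeeze n r c x = c + (n \<bullet> x - c - 1) / r"
  by (simp add: squeeze_def inner_add_right dot_square_norm)

text \<open>By \<open>emeasure_linear_vimage\<close>, taking preimages under \<open>T\<close>
  multiplies measure by one factor common to all sets. The factor is read off from a cylinder with
  axis \<open>n\<close>: its preimage is the cylinder of height \<open>m\<close>, a stack of
  \<open>m\<close> translates. Counting them is why \<open>m\<close> is a natural number.\<close>

lemma emeasure_scale_vimage:
  fixes n :: "'a::euclidean_space"
  assumes n: "norm n = 1" and m: "m > 0" and E: "E \<in> sets borel"
  defines "T \<equiv> (\<lambda>x. x + ((n \<bullet> x) / real m - n \<bullet> x) *\<^sub>R n)"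
  shows "emeasure lborel (T -` E) = of_nat m * emeasure lborel E"
proof -
  define S where "S = (\<lambda>x. x + ((n \<bullet> x) * real m - n \<bullet> x) *\<^sub>R n)"
  define C :: "'a set" where "C = ball 0 1"
  \<comment> \<open>Half-open along \<open>n\<close>, so that translates by multiples of
    \<open>n\<close> tile without overlap.\<close>
  define Q where "Q r = {x. 0 \<le> n \<bullet> x \<and> n \<bullet> x < r \<and> norm (x - (n \<bullet> x) *\<^sub>R n) \<le> 1}" for r
  have nn: "n \<bullet> n = 1" using n by (simp add: dot_square_norm)
  have lin: "linear T"
    by (auto simp: T_def inner_add_right algebra_simps add_divide_distrib intro!: linearI)
  have inv: "T (S x) = x" for x
  proof -
    have "n \<bullet> S x = real m * (n \<bullet> x)"
      using nn by (simp add: S_def inner_add_right algebra_simps)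
    then show ?thesis
      using m by (simp add: T_def) (simp add: S_def algebra_simps)
  qed
  have QB [measurable]: "Q r \<in> sets borel" for r
    unfolding Q_def by measurable
  have TQ: "T -` Q 1 = Q (real m)"
  proof -
    have "n \<bullet> T x = (n \<bullet> x) / real m" for x
      using nn by (simp add: T_def inner_add_right algebra_simps)
    moreover have "T x - ((n \<bullet> x) / real m) *\<^sub>R n = x - (n \<bullet> x) *\<^sub>R n" for x
      by (simp add: T_def scaleR_left_diff_distrib)
    ultimately show ?thesis
      using m by (auto simp: Q_def zero_le_divide_iff divide_less_eq)
  qed
  have tr: "emeasure lborel ((\<lambda>x. x - c) -` A) = emeasure lborel A" if "A \<in> sets borel" for A and c :: 'a
  proof -
    have "emeasure lborel A = emeasure (distr lborel borel ((+) (-c))) A"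
      by (simp add: lborel_distr_plus)
    also have "\<dots> = emeasure lborel ((+) (-c) -` A)"
      using that by (subst emeasure_distr) auto
    finally show ?thesis by (auto intro!: arg_cong[of _ _ "emeasure lborel"])
  qed
  have Qk: "emeasure lborel (Q (real k)) = of_nat k * emeasure lborel (Q 1)" for k
  proof (induction k)
    case 0
    have "Q 0 = {}" by (auto simp: Q_def)
    then show ?case by simp
  next
    case (Suc k)
    define Q' where "Q' = (\<lambda>x. x - real k *\<^sub>R n) -` Q 1"
    have "Q (real (Suc k)) = Q (real k) \<union> Q'"
      using nn by (auto simp: Q_def Q'_def inner_diff_right algebra_simps)
    moreover have "Q (real k) \<inter> Q' = {}"
      using nn by (auto simp: Q_def Q'_def inner_diff_right)
    moreover have "Q' \<in> sets borel"
      using measurable_sets[of "\<lambda>x. x - real k *\<^sub>R n" borel borel "Q 1"] by (simp add: Q'_def)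
    ultimately have "emeasure lborel (Q (real (Suc k))) = emeasure lborel (Q (real k)) + emeasure lborel Q'"
      using plus_emeasure[of "Q (real k)" lborel Q'] by simp
    also have "emeasure lborel Q' = emeasure lborel (Q 1)"
      unfolding Q'_def by (rule tr) simp
    finally show ?case
      using Suc by (simp add: algebra_simps)
  qed
  \<comment> \<open>The measure of \<open>Q 1\<close> is cancelled below in \<open>ennreal\<close>,
    which requires it to be finite and nonzero.\<close>
  have "Q 1 \<subseteq> cball 0 2"
  proof
    fix x assume "x \<in> Q 1"
    then have "norm (x - (n \<bullet> x) *\<^sub>R n) \<le> 1" "norm ((n \<bullet> x) *\<^sub>R n) \<le> 1"
      using n by (auto simp: Q_def)
    then show "x \<in> cball 0 2"
      using norm_triangle_ineq[of "x - (n \<bullet> x) *\<^sub>R n" "(n \<bullet> x) *\<^sub>R n"] by simp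
  qed
  then have fin: "emeasure lborel (Q 1) < \<infinity>"
    by (meson bounded_cball bounded_subset emeasure_bounded_finite)
  have pos: "emeasure lborel (Q 1) > 0"
  proof -
    define O' where "O' = {x. 0 < n \<bullet> x} \<inter> {x. n \<bullet> x < 1} \<inter> {x. norm (x - (n \<bullet> x) *\<^sub>R n) < 1}"
    have o: "open O'" unfolding O'_def
      by (intro open_Int open_Collect_less continuous_intros)
    have "(1/2) *\<^sub>R n \<in> O'" using nn by (simp add: O'_def)
    then obtain r where r: "r > 0" "ball ((1/2) *\<^sub>R n) r \<subseteq> O'"
      using o openE by blast
    have "0 < measure lborel (ball ((1/2) *\<^sub>R n) r)"
      using r(1) by (rule content_ball_pos)
    then have "0 < emeasure lborel (ball ((1/2) *\<^sub>R n) r)"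
      by (auto simp: measure_def zero_less_iff_neq_zero)
    also have "\<dots> \<le> emeasure lborel O'"
      using r(2) o by (intro emeasure_mono) auto
    finally have "emeasure lborel O' > 0" .
    moreover have "O' \<subseteq> Q 1" by (auto simp: O'_def Q_def)
    ultimately show ?thesis
      using emeasure_mono[of O' "Q 1" lborel] by (simp add: order_less_le_trans)
  qed
  note haar = emeasure_linear_vimage[OF lin inv, folded C_def]
  have eq1: "emeasure lborel C * (of_nat m * emeasure lborel (Q 1)) = emeasure lborel (Q 1) * emeasure lborel (T -` C)"
    using haar[of "Q 1"] Qk TQ by simp
  have "emeasure lborel (T -` C) = of_nat m * emeasure lborel C"
  proof -
    have "emeasure lborel (Q 1) * emeasure lborel (T -` C) = emeasure lborel (Q 1) * (of_nat m * emeasure lborel C)"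
      using eq1 by (simp add: ac_simps)
    then show ?thesis
      using fin pos by (subst (asm) ennreal_mult_cancel_left) auto
  qed
  then have "emeasure lborel C * emeasure lborel (T -` E) = emeasure lborel C * (of_nat m * emeasure lborel E)"
    using haar[OF E] by (simp add: ac_simps)
  moreover have "emeasure lborel C \<noteq> \<infinity>" "emeasure lborel C \<noteq> 0"
  proof -
    show "emeasure lborel C \<noteq> \<infinity>"
      unfolding C_def using emeasure_lborel_ball_finite by (metis less_irrefl)
    show "emeasure lborel C \<noteq> 0"
      unfolding C_def using content_ball_pos[of 1 "0::'a"] by (auto simp: measure_def)
  qed
  ultimately show ?thesis
    by (subst (asm) ennreal_mult_cancel_left) auto
qed

text \<open>\<open>squeeze\<close> is the contraction of \<open>emeasure_scale_vimage\<close>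
  followed by a translation. The factor \<open>m\<close> is the one by which cutoffs of width
  \<open>1/m\<close> have to be multiplied to keep their slope in view.\<close>

lemma integral_squeeze:
  fixes n :: "'a::euclidean_space" and f :: "'a \<Rightarrow> real"
  assumes n: "norm n = 1" and m: "m > 0" and f: "f \<in> borel_measurable borel"
  shows "(LINT x|lborel. f (squeeze n (real m) c x)) = real m * (LINT x|lborel. f x)"
proof -
  define T where "T = (\<lambda>x. x + ((n \<bullet> x) / real m - n \<bullet> x) *\<^sub>R n)"
  define v where "v = (c - (c + 1) / real m) *\<^sub>R n"
  have sq: "squeeze n (real m) c x = v + T x" for x
    by (simp add: squeeze_def T_def v_def algebra_simps diff_divide_distrib add_divide_distrib)
  have Tm [measurable]: "T \<in> borel_measurable borel"
    unfolding T_def by measurable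
  have d: "distr lborel borel T = density lborel (\<lambda>_. of_nat m)"
  proof (rule measure_eqI)
    fix A assume "A \<in> sets (distr lborel borel T)"
    then have A: "A \<in> sets borel" by simp
    then have "emeasure (distr lborel borel T) A = of_nat m * emeasure lborel A"
      using emeasure_scale_vimage[OF n m A] by (simp add: emeasure_distr T_def)
    also have "\<dots> = emeasure (density lborel (\<lambda>_. of_nat m)) A"
      using A by (subst emeasure_density) (auto simp: nn_integral_cmult)
    finally show "emeasure (distr lborel borel T) A = emeasure (density lborel (\<lambda>_. of_nat m)) A" .
  qed simp
  have "(LINT x|lborel. f (squeeze n (real m) c x)) = (LINT x|distr lborel borel T. f (v + x))"
    using f by (subst integral_distr) (auto simp: sq)
  also have "\<dots> = (LINT x|density lborel (\<lambda>_. ennreal (real m)). f (v + x))"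
    by (simp add: d ennreal_of_nat_eq_real_of_nat)
  also have "\<dots> = (LINT x|lborel. real m *\<^sub>R f (v + x))"
    using f by (subst integral_density) auto
  also have "\<dots> = real m * (LINT x|lborel. f (v + x))"
    by simp
  also have "(LINT x|lborel. f (v + x)) = (LINT x|distr lborel borel ((+) v). f x)"
    using f by (subst integral_distr) auto
  also have "\<dots> = (LINT x|lborel. f x)"
    by (simp add: lborel_distr_plus)
  finally show ?thesis .
qed

section \<open>Integrals of directional derivatives\<close>

text \<open>Completeness of Lebesgue measure. It serves integrands that are under control only off a
  negligible set of hyperplanes.\<close>

lemma borel_measurable_lebesgue_AE:
  fixes f g :: "'a::euclidean_space \<Rightarrow> 'b::topological_space"
  assumes f: "f \<in> borel_measurable lebesgue" and ae: "AE x in lebesgue. f x = g x"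
  shows "g \<in> borel_measurable lebesgue"
proof (rule measurableI)
  fix A :: "'b set" assume "A \<in> sets borel"
  then have fA: "f -` A \<in> sets lebesgue"
    using measurable_sets[OF f] by simp
  have "AE x in lebesgue. x \<in> f -` A \<longleftrightarrow> x \<in> g -` A"
    using ae by eventually_elim simp
  from completion.in_sets_AE[OF this fA] have "g -` A \<in> sets lebesgue"
    by simp
  then show "g -` A \<inter> space lebesgue \<in> sets lebesgue" by simp
qed simp

lemma set_integrable_bounded_continuous:
  fixes f :: "'a::euclidean_space \<Rightarrow> real"
  assumes S: "S \<in> sets borel" "bounded S" and f: "continuous_on S f" and bd: "\<And>x. x \<in> S \<Longrightarrow> \<bar>f x\<bar> \<le> M"
  shows "set_integrable lebesgue S f"
proof -
  have m: "(\<lambda>x. indicator S x *\<^sub>R f x) \<in> borel_measurable borel"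
    using S(1) f by (rule borel_measurable_continuous_on_indicator)
  have "integrable lborel (\<lambda>x. indicator S x * M)"
    using S emeasure_bounded_finite[of S]
    by (intro integrable_mult_left integrable_real_indicator) auto
  then have "integrable lborel (\<lambda>x. indicator S x *\<^sub>R f x)"
  proof (rule Bochner_Integration.integrable_bound)
    show "AE x in lborel. norm (indicator S x *\<^sub>R f x) \<le> norm (indicator S x * M)"
    proof (intro AE_I2)
      fix x show "norm (indicator S x *\<^sub>R f x) \<le> norm (indicator S x * M)"
        using bd[of x] by (cases "x \<in> S") auto
    qed
  qed (use m in simp)
  then show ?thesis
    using m unfolding set_integrable_def by (simp add: integrable_completion)
qed

lemma set_integrable_compact_continuous:
  fixes f :: "'a::euclidean_space \<Rightarrow> real"
  assumes S: "compact S" and f: "continuous_on S f"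
  shows "set_integrable lebesgue S f"
proof -
  have "bounded (f ` S)"
    using S f by (intro compact_imp_bounded compact_continuous_image)
  then obtain M where "\<And>x. x \<in> S \<Longrightarrow> \<bar>f x\<bar> \<le> M"
    by (auto simp: bounded_iff)
  with S f show ?thesis
    by (intro set_integrable_bounded_continuous)
      (auto simp: compact_imp_bounded borel_compact)
qed

text \<open>Exceptional sets are kept in this concrete form because a line through a point outside
  meets them only finitely often. Pairs with zero normal are discarded, since they would describe
  the empty set or the whole space.\<close>

definition hyperplanes :: "('a::euclidean_space \<times> real) set \<Rightarrow> 'a set" where
  "hyperplanes \<H> = {x. \<exists>(n, c)\<in>\<H>. n \<noteq> 0 \<and> n \<bullet> x = c}"

lemma hyperplanes_eq: "hyperplanes \<H> = (\<Union>p\<in>{p\<in>\<H>. fst p \<noteq> 0}. {x. fst p \<bullet> x = snd p})"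
  by (force simp: hyperplanes_def)

lemma negligible_hyperplanes:
  assumes "finite \<H>"
  shows "negligible (hyperplanes \<H>)"
  unfolding hyperplanes_eq
proof (rule negligible_Union)
  show "finite ((\<lambda>p. {x. fst p \<bullet> x = snd p}) ` {p \<in> \<H>. fst p \<noteq> 0})"
    using assms by simp
qed (use negligible_hyperplane in blast)

lemma AE_not_hyperplanes:
  assumes "finite \<H>"
  shows "AE x in lebesgue. x \<notin> hyperplanes \<H>"
  using negligible_hyperplanes[OF assms] by (simp add: AE_not_in negligible_iff_null_sets)

lemma closed_hyperplanes:
  assumes "finite \<H>"
  shows "closed (hyperplanes \<H>)"
  unfolding hyperplanes_eq
  using assms by (intro closed_UN) (simp_all add: closed_hyperplane)

text \<open>A line through a point off the hyperplanes meets each of them at most once.\<close>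

lemma bounded_difference_off_hyperplanes:
  fixes g :: "'a::euclidean_space \<Rightarrow> real"
  assumes cont: "continuous_on UNIV g" and fin: "finite \<H>"
    and der: "\<And>x. x \<notin> hyperplanes \<H> \<Longrightarrow> (g has_derivative g' x) (at x)"
    and bd: "\<And>x. x \<notin> hyperplanes \<H> \<Longrightarrow> \<bar>g' x e\<bar> \<le> M"
    and x: "x \<notin> hyperplanes \<H>" and t: "0 \<le> t"
  shows "\<bar>g (x + t *\<^sub>R e) - g x\<bar> \<le> M * t"
proof -
  define S where "S = {s. x + s *\<^sub>R e \<in> hyperplanes \<H>}"
  have "finite {s. n \<bullet> (x + s *\<^sub>R e) = c}" if "(n, c) \<in> \<H>" "n \<noteq> 0" for n c
  proof (cases "n \<bullet> e = 0")
    case True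
    then have "{s. n \<bullet> (x + s *\<^sub>R e) = c} = {}"
      using x that by (auto simp: hyperplanes_def inner_add_right)
    then show ?thesis by simp
  next
    case False
    then have "{s. n \<bullet> (x + s *\<^sub>R e) = c} \<subseteq> {(c - n \<bullet> x) / (n \<bullet> e)}"
      by (auto simp: inner_add_right field_simps)
    then show ?thesis by (meson finite.simps finite_subset)
  qed
  then have "finite (\<Union>p\<in>{p\<in>\<H>. fst p \<noteq> 0}. {s. fst p \<bullet> (x + s *\<^sub>R e) = snd p})"
    using fin by auto
  moreover have "S \<subseteq> (\<Union>p\<in>{p\<in>\<H>. fst p \<noteq> 0}. {s. fst p \<bullet> (x + s *\<^sub>R e) = snd p})"
    by (auto simp: S_def hyperplanes_def)
  ultimately have finS: "finite S" by (rule finite_subset[rotated])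
  \<comment> \<open>Along the line \<open>g\<close> is continuous, and differentiable off the finite
    set \<open>S\<close>, so the fundamental theorem applies across the crossings.\<close>
  have "((\<lambda>s. g' (x + s *\<^sub>R e) e) has_integral (g (x + t *\<^sub>R e) - g (x + 0 *\<^sub>R e))) {0..t}"
  proof (rule fundamental_theorem_of_calculus_interior_strong[OF finS t])
    fix s assume "s \<in> {0<..<t} - S"
    then have "(g has_derivative g' (x + s *\<^sub>R e)) (at (x + s *\<^sub>R e))"
      by (intro der) (auto simp: S_def)
    moreover have "((\<lambda>s. x + s *\<^sub>R e) has_derivative (\<lambda>r. r *\<^sub>R e)) (at s)"
      by (auto intro!: derivative_eq_intros)
    ultimately have "((\<lambda>s. g (x + s *\<^sub>R e)) has_derivative (\<lambda>r. g' (x + s *\<^sub>R e) (r *\<^sub>R e))) (at s)"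
      using has_derivative_compose by blast
    moreover have "g' (x + s *\<^sub>R e) (r *\<^sub>R e) = r *\<^sub>R g' (x + s *\<^sub>R e) e" for r
      using \<open>(g has_derivative _) _\<close> by (simp add: has_derivative_linear linear_scale)
    ultimately show "((\<lambda>s. g (x + s *\<^sub>R e)) has_vector_derivative g' (x + s *\<^sub>R e) e) (at s)"
      by (simp add: has_vector_derivative_def)
  next
    show "continuous_on {0..t} (\<lambda>s. g (x + s *\<^sub>R e))"
      by (intro continuous_on_compose2[OF cont] continuous_intros) auto
  qed
  moreover have "0 \<le> M" using bd[OF x] by linarith
  ultimately have "norm (g (x + t *\<^sub>R e) - g (x + 0 *\<^sub>R e)) \<le> M * measure lborel (cbox 0 t)"
    using t bd by (intro has_integral_bound_spike_finite[OF _ finS]) (auto simp: S_def)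
  then show ?thesis using t by simp
qed

text \<open>The integral of a difference quotient vanishes by translation invariance.\<close>

lemma integral_directional_derivative_eq_0:
  fixes g :: "'a::euclidean_space \<Rightarrow> real"
  assumes cont: "continuous_on UNIV g" and fin: "finite \<H>"
    and supp: "\<And>x. R < norm x \<Longrightarrow> g x = 0"
    and der: "\<And>x. x \<notin> hyperplanes \<H> \<Longrightarrow> (g has_derivative g' x) (at x)"
    and bd: "\<And>x. x \<notin> hyperplanes \<H> \<Longrightarrow> \<bar>g' x e\<bar> \<le> M"
    and h: "\<And>x. x \<notin> hyperplanes \<H> \<Longrightarrow> h x = g' x e"
  shows "integrable lebesgue h" "integral\<^sup>L lebesgue h = 0"
proof -
  define q where "q k x = real (Suc k) * (g (x + (1 / real (Suc k)) *\<^sub>R e) - g x)" for k x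
  have gm: "g \<in> borel_measurable borel"
    using cont by (rule borel_measurable_continuous_onI)
  have gm' [measurable]: "(\<lambda>x. g (x + v)) \<in> borel_measurable borel" for v
    using gm by simp
  have gi: "integrable lborel (\<lambda>x. g (x + v))" for v
  proof -
    have "compact (g ` cball 0 R)"
      by (intro compact_continuous_image continuous_on_subset[OF cont]) auto
    then have "bounded (g ` cball 0 R)" by (rule compact_imp_bounded)
    then obtain B where B: "\<And>x. norm x \<le> R \<Longrightarrow> \<bar>g x\<bar> \<le> B"
      unfolding bounded_iff by force
    have "integrable lborel (\<lambda>x. indicator (cball (-v) R) x * B)"
      by (intro integrable_mult_left integrable_real_indicator)
        (auto intro!: emeasure_bounded_finite[unfolded infinity_ennreal_def])
    then show ?thesis
    proof (rule Bochner_Integration.integrable_bound)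
      show "AE x in lborel. norm (g (x + v)) \<le> norm (indicator (cball (-v) R) x * B)"
      proof (intro AE_I2)
        fix x show "norm (g (x + v)) \<le> norm (indicator (cball (-v) R) x * B)"
        proof (cases "norm (x + v) \<le> R")
          case True
          then have "x \<in> cball (-v) R"
            by (simp add: dist_norm norm_minus_commute[of "-v" x])
          then show ?thesis using B[OF True] by simp
        next
          case False
          then show ?thesis using supp[of "x + v"] by simp
        qed
      qed
    qed simp
  qed
  have shift: "(LINT x|lborel. g (x + v)) = (LINT x|lborel. g x)" for v
  proof -
    have "(LINT x|lborel. g x) = (LINT x|distr lborel borel ((+) v). g x)"
      by (simp add: lborel_distr_plus)
    also have "\<dots> = (LINT x|lborel. g (v + x))"
      using gm by (subst integral_distr) auto
    finally show ?thesis by (simp add: add.commute)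
  qed
  have q0: "integral\<^sup>L lborel (q k) = 0" for k
    unfolding q_def using gi[of "(1 / real (Suc k)) *\<^sub>R e"] gi[of 0] shift
    by simp
  have qm: "q k \<in> borel_measurable borel" for k
    using gm'[of 0] unfolding q_def by (intro borel_measurable_times borel_measurable_diff) auto
  have lim: "(\<lambda>k. q k x) \<longlonglongrightarrow> h x" if "x \<notin> hyperplanes \<H>" for x
  proof -
    have d: "(g has_derivative g' x) (at x)" by (rule der) fact
    have "((\<lambda>s. g (x + s *\<^sub>R e)) has_derivative (\<lambda>r. g' x (r *\<^sub>R e))) (at 0)"
    proof -
      have "((\<lambda>s. x + s *\<^sub>R e) has_derivative (\<lambda>r. r *\<^sub>R e)) (at 0)"
        by (auto intro!: derivative_eq_intros)
      from has_derivative_compose[OF this, of g "g' x"] d show ?thesis by simp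
    qed
    moreover have "g' x (r *\<^sub>R e) = g' x e * r" for r
      using d by (simp add: has_derivative_linear linear_scale)
    ultimately have "((\<lambda>s. g (x + s *\<^sub>R e)) has_field_derivative g' x e) (at 0)"
      by (simp add: has_field_derivative_def)
    then have "((\<lambda>s. (g (x + s *\<^sub>R e) - g x) / s) \<longlongrightarrow> g' x e) (at 0)"
      by (simp add: has_field_derivative_iff)
    moreover have "filterlim (\<lambda>k. 1 / real (Suc k)) (at 0) sequentially"
      unfolding filterlim_at using LIMSEQ_Suc[OF lim_1_over_n[where 'a=real]] by auto
    ultimately have "((\<lambda>k. (g (x + (1 / real (Suc k)) *\<^sub>R e) - g x) / (1 / real (Suc k))) \<longlongrightarrow> g' x e) sequentially"
      by (rule filterlim_compose)
    then show ?thesis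
      using h[OF that] by (simp add: q_def mult.commute)
  qed
  \<comment> \<open>Measurability is inherited from the continuous difference quotients, of which
    \<open>h\<close> is the limit off the hyperplanes.\<close>
  have hm: "h \<in> borel_measurable lebesgue"
  proof -
    define f where "f x = (if x \<in> hyperplanes \<H> then 0 else h x)" for x
    have cl [measurable]: "hyperplanes \<H> \<in> sets borel"
      using closed_hyperplanes[OF fin] by simp
    have "f \<in> borel_measurable borel"
    proof (rule borel_measurable_LIMSEQ_real)
      fix x show "(\<lambda>k. (if x \<in> hyperplanes \<H> then 0 else q k x)) \<longlonglongrightarrow> f x"
        using lim by (auto simp: f_def)
    next
      fix k show "(\<lambda>x. if x \<in> hyperplanes \<H> then 0 else q k x) \<in> borel_measurable borel"
        using qm by measurable
    qed
    then have "f \<in> borel_measurable lebesgue"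
      by (simp add: measurable_completion)
    then show ?thesis
    proof (rule borel_measurable_lebesgue_AE)
      show "AE x in lebesgue. f x = h x"
        using AE_not_hyperplanes[OF fin] by eventually_elim (simp add: f_def)
    qed
  qed
  \<comment> \<open>The displacement in \<open>q k\<close> has length at most \<open>norm e\<close>,
    so outside this ball both values of \<open>g\<close> vanish; inside, the Lipschitz constant
    \<open>M\<close> dominates.\<close>
  define w where "w x = indicator (cball 0 (R + norm e)) x * M" for x :: 'a
  have dom: "norm (q k x) \<le> w x" if x: "x \<notin> hyperplanes \<H>" for k x
  proof (cases "norm x \<le> R + norm e")
    case True
    have "\<bar>g (x + (1 / real (Suc k)) *\<^sub>R e) - g x\<bar> \<le> M * (1 / real (Suc k))"
      by (rule bounded_difference_off_hyperplanes[OF cont fin der bd x]) auto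
    then have "\<bar>q k x\<bar> \<le> real (Suc k) * (M * (1 / real (Suc k)))"
      unfolding q_def abs_mult by (intro mult_mono) auto
    then show ?thesis using True by (simp add: w_def)
  next
    case False
    have "norm x \<le> norm (x + (1 / real (Suc k)) *\<^sub>R e) + norm ((1 / real (Suc k)) *\<^sub>R e)"
      using norm_triangle_ineq4[of "x + (1 / real (Suc k)) *\<^sub>R e" "(1 / real (Suc k)) *\<^sub>R e"] by simp
    also have "norm ((1 / real (Suc k)) *\<^sub>R e) \<le> norm e"
      by (simp add: divide_le_eq mult_le_cancel_left1)
    finally have "g (x + (1 / real (Suc k)) *\<^sub>R e) = 0"
      using False by (intro supp) simp
    moreover have "g x = 0" using False norm_ge_zero[of e] by (intro supp) linarith
    ultimately show ?thesis using False by (simp add: q_def w_def)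
  qed
  have wi: "integrable lebesgue w"
  proof -
    have "integrable lborel w" unfolding w_def
      by (intro integrable_mult_left integrable_real_indicator)
        (auto intro!: emeasure_bounded_finite[unfolded infinity_ennreal_def])
    then show ?thesis
      by (simp add: integrable_completion)
  qed
  have ae: "AE x in lebesgue. (\<lambda>k. q k x) \<longlonglongrightarrow> h x"
    using AE_not_hyperplanes[OF fin] by eventually_elim (rule lim)
  have aed: "AE x in lebesgue. norm (q k x) \<le> w x" for k
    using AE_not_hyperplanes[OF fin] by eventually_elim (rule dom)
  have qm': "q k \<in> borel_measurable lebesgue" for k
    using qm by (simp add: measurable_completion)
  show "integrable lebesgue h"
    by (rule integrable_dominated_convergence[OF hm qm' wi ae aed])
  have "(\<lambda>k. integral\<^sup>L lebesgue (q k)) \<longlonglongrightarrow> integral\<^sup>L lebesgue h"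
    by (rule integral_dominated_convergence[OF hm qm' wi ae aed])
  moreover have "integral\<^sup>L lebesgue (q k) = 0" for k
    using q0 qm by (simp add: integral_completion)
  ultimately show "integral\<^sup>L lebesgue h = 0"
    by (simp add: LIMSEQ_const_iff)
qed

section \<open>Facets of a full-dimensional polytope\<close>

definition clamp01 :: "real \<Rightarrow> real" where
  "clamp01 t = max 0 (min 1 t)"

lemma clamp01_simps:
  "0 \<le> clamp01 t" "clamp01 t \<le> 1" "t \<le> 0 \<Longrightarrow> clamp01 t = 0" "1 \<le> t \<Longrightarrow> clamp01 t = 1"
  by (auto simp: clamp01_def)

lemma continuous_on_clamp01 [continuous_intros]:
  "continuous_on S f \<Longrightarrow> continuous_on S (\<lambda>x. clamp01 (f x))"
  unfolding clamp01_def by (intro continuous_intros)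

text \<open>The kinks of \<open>clamp01\<close> are at 0 and 1. Inside a polytope the arguments are
  positive, so there only the kink at 1 has to be avoided.\<close>

lemma has_derivative_clamp01:
  fixes f :: "'a::real_normed_vector \<Rightarrow> real"
  assumes f: "(f has_derivative f') (at x)" and "0 < f x" "f x \<noteq> 1"
  shows "((\<lambda>x. clamp01 (f x)) has_derivative (\<lambda>v. if f x < 1 then f' v else 0)) (at x)"
proof (cases "f x < 1")
  case True
  have "(f \<longlongrightarrow> f x) (at x)"
    using has_derivative_continuous[OF f] by (simp add: continuous_within)
  then have "\<forall>\<^sub>F y in at x. 0 < f y \<and> f y < 1"
    using assms True by (intro eventually_conj order_tendstoD)
  then have "\<forall>\<^sub>F y in at x. f y = clamp01 (f y)"
    by eventually_elim (simp add: clamp01_def)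
  moreover have "f x = clamp01 (f x)" using assms True by (simp add: clamp01_def)
  ultimately show ?thesis
    using has_derivative_transform_eventually[OF f, of "\<lambda>x. clamp01 (f x)"] True by simp
next
  case False
  then have "1 < f x" using assms by simp
  have "(f \<longlongrightarrow> f x) (at x)"
    using has_derivative_continuous[OF f] by (simp add: continuous_within)
  then have "\<forall>\<^sub>F y in at x. 1 < f y"
    using \<open>1 < f x\<close> by (rule order_tendstoD)
  then have "\<forall>\<^sub>F y in at x. 1 = clamp01 (f y)"
    by eventually_elim (simp add: clamp01_def)
  moreover have "1 = clamp01 (f x)" using \<open>1 < f x\<close> by (simp add: clamp01_def)
  ultimately show ?thesis
    using has_derivative_transform_eventually[OF has_derivative_const[of 1], where g="\<lambda>x. clamp01 (f x)"] False by simp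
qed

text \<open>\<open>outward_normal\<close> is a definite description, so existence and uniqueness are
  both due. Existence: facets of a polytope are exposed. Uniqueness: the affine hull of a facet is a
  full hyperplane by dimension, so a competing unit vector is plus or minus the normal, and the sign
  is fixed because \<open>K\<close> is not flat.\<close>

lemma facet_outward_normal:
  fixes K :: "'a::euclidean_space set"
  assumes K: "polytope K" "interior K \<noteq> {}" and F: "F facet_of K"
  defines "n \<equiv> outward_normal K F"
  shows "norm n = 1 \<and> (\<exists>c. K \<subseteq> {x. n \<bullet> x \<le> c} \<and> F = K \<inter> {x. n \<bullet> x = c})"
proof -
  have "F exposed_face_of K"
    using F K by (simp add: exposed_face_of_polyhedron polytope_imp_polyhedron facet_of_imp_face_of)
  then obtain a b where ab: "K \<subseteq> {x. a \<bullet> x \<le> b}" "F = K \<inter> {x. a \<bullet> x = b}"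
    by (auto simp: exposed_face_of_def)
  have ne: "F \<noteq> {}" "F \<noteq> K" using F by (auto simp: facet_of_def)
  then have "a \<noteq> 0" using ab by auto
  define n0 where "n0 = a /\<^sub>R norm a"
  define c0 where "c0 = b / norm a"
  have n0: "norm n0 = 1" using \<open>a \<noteq> 0\<close> by (simp add: n0_def)
  have sub: "K \<subseteq> {x. n0 \<bullet> x \<le> c0}" and eq: "F = K \<inter> {x. n0 \<bullet> x = c0}"
    using ab \<open>a \<noteq> 0\<close> by (auto simp: n0_def c0_def field_simps)
  have dimK: "aff_dim K = DIM('a)"
    using K by (simp add: aff_dim_nonempty_interior)
  have hull: "affine hull F = {x. n0 \<bullet> x = c0}"
  proof (rule affine_dim_equal)
    show "affine hull F \<subseteq> {x. n0 \<bullet> x = c0}"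
      using eq by (intro hull_minimal) (auto simp: affine_hyperplane)
    have "n0 \<noteq> 0" using n0 by auto
    then show "aff_dim (affine hull F) = aff_dim {x. n0 \<bullet> x = c0}"
      using F dimK by (simp add: facet_of_def aff_dim_hyperplane)
  qed (use ne in \<open>auto simp: affine_hyperplane\<close>)
  obtain z where z: "z \<in> interior K" using K by auto
  have "n = n0" unfolding n_def outward_normal_def
  proof (rule the_equality)
    show "norm n0 = 1 \<and> (\<exists>c. (\<forall>x\<in>F. n0 \<bullet> x = c) \<and> (\<forall>x\<in>K. n0 \<bullet> x \<le> c))"
      using n0 sub eq by auto
  next
    fix m assume "norm m = 1 \<and> (\<exists>c. (\<forall>x\<in>F. m \<bullet> x = c) \<and> (\<forall>x\<in>K. m \<bullet> x \<le> c))"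
    then obtain c where m: "norm m = 1" "\<And>x. x \<in> F \<Longrightarrow> m \<bullet> x = c" "\<And>x. x \<in> K \<Longrightarrow> m \<bullet> x \<le> c"
      by auto
    have "affine hull F \<subseteq> {x. m \<bullet> x = c}"
      using m by (intro hull_minimal) (auto simp: affine_hyperplane)
    then have mc: "m \<bullet> x = c" if "n0 \<bullet> x = c0" for x
      using that hull by auto
    obtain x0 where x0: "n0 \<bullet> x0 = c0" using ne eq by auto
    \<comment> \<open>The part of \<open>m\<close> tangential to the facet plane. As
      \<open>m\<close> is constant on that plane, \<open>m\<close> is orthogonal to
      \<open>v\<close>, which forces \<open>v\<close> to vanish.\<close>
    define v where "v = m - (n0 \<bullet> m) *\<^sub>R n0"
    have nn: "n0 \<bullet> n0 = 1" "m \<bullet> m = 1" using n0 m by (auto simp: dot_square_norm)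
    have "n0 \<bullet> (x0 + v) = c0" using x0 nn by (simp add: v_def inner_add_right inner_diff_right)
    from mc[OF this] mc[OF x0] have mv: "m \<bullet> v = 0" by (simp add: inner_add_right)
    moreover have "n0 \<bullet> v = 0" using nn by (simp add: v_def inner_diff_right)
    ultimately have "v \<bullet> v = 0" by (simp add: v_def inner_diff_left)
    then have "m = (n0 \<bullet> m) *\<^sub>R n0" by (simp add: v_def)
    then obtain l where l: "m = l *\<^sub>R n0" by blast
    then have "\<bar>l\<bar> = 1" using n0 m by simp
    \<comment> \<open>The opposite normal would bound \<open>K\<close> from both sides by the same
      plane and leave it without interior.\<close>
    moreover have "l \<noteq> -1"
    proof
      assume "l = -1"
      then have "m = - n0" using l by simp
      then have "c = - c0" using mc[OF x0] x0 by simp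
      then have "K \<subseteq> {x. n0 \<bullet> x = c0}"
        using sub m(3) \<open>m = - n0\<close> by force
      then have "interior K \<subseteq> interior {x. n0 \<bullet> x = c0}" by (rule interior_mono)
      also have "\<dots> = {}" using n0 by (intro interior_hyperplane) auto
      finally show False using K by auto
    qed
    ultimately have "l = 1" by auto
    then show "m = n0" using l by simp
  qed
  then show ?thesis using n0 sub eq by auto
qed

definition facet_offset :: "'a::euclidean_space set \<Rightarrow> 'a set \<Rightarrow> real" where
  "facet_offset K F = (SOME c. K \<subseteq> {x. outward_normal K F \<bullet> x \<le> c} \<and> F = K \<inter> {x. outward_normal K F \<bullet> x = c})"

definition facet_prism :: "'a::euclidean_space set \<Rightarrow> 'a \<Rightarrow> 'a set" where
  "facet_prism F n = {y + t *\<^sub>R n | y t. y \<in> F \<and> 0 \<le> t \<and> t \<le> 1}"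

locale solid_polytope =
  fixes K :: "'a::euclidean_space set"
  assumes polytope: "polytope K" and interior_nonempty: "interior K \<noteq> {}"
begin

abbreviation "facets \<equiv> {F. F facet_of K}"
abbreviation "nrm \<equiv> outward_normal K"
abbreviation "off \<equiv> facet_offset K"

lemma finite_facets: "finite facets"
  by (rule finite_polytope_facets[OF polytope])

lemma compact: "compact K" and convex: "convex K" and closed: "closed K"
  using polytope by (simp_all add: polytope_imp_compact polytope_imp_convex compact_imp_closed)

lemma norm_normal: "F \<in> facets \<Longrightarrow> norm (nrm F) = 1"
  using facet_outward_normal[OF polytope interior_nonempty] by auto

lemma inner_normal: "F \<in> facets \<Longrightarrow> nrm F \<bullet> nrm F = 1"
  using norm_normal by (simp add: dot_square_norm)

lemma facet_offset:
  assumes "F \<in> facets"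
  shows "K \<subseteq> {x. nrm F \<bullet> x \<le> off F} \<and> F = K \<inter> {x. nrm F \<bullet> x = off F}"
  unfolding facet_offset_def
proof (rule someI_ex)
  show "\<exists>c. K \<subseteq> {x. nrm F \<bullet> x \<le> c} \<and> F = K \<inter> {x. nrm F \<bullet> x = c}"
    using facet_outward_normal[OF polytope interior_nonempty, of F] assms by simp
qed

lemma le_offset: "F \<in> facets \<Longrightarrow> x \<in> K \<Longrightarrow> nrm F \<bullet> x \<le> off F"
  using facet_offset[of F] by (simp only: subset_iff mem_Collect_eq)

lemma in_facet_iff:
  assumes "F \<in> facets"
  shows "x \<in> F \<longleftrightarrow> x \<in> K \<and> nrm F \<bullet> x = off F"
proof -
  have "x \<in> F \<longleftrightarrow> x \<in> K \<inter> {x. nrm F \<bullet> x = off F}"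
    by (rule arg_cong[OF conjunct2[OF facet_offset[OF assms]]])
  then show ?thesis by simp
qed

lemma facet_nonempty: "F \<in> facets \<Longrightarrow> F \<noteq> {}"
  by (simp add: facet_of_def)

lemma facet_subset: "F \<in> facets \<Longrightarrow> F \<subseteq> K"
  by (simp add: facet_of_imp_subset)

lemma compact_facet: "F \<in> facets \<Longrightarrow> compact F"
  using face_of_imp_compact[OF convex compact] by (simp add: facet_of_imp_face_of)

lemma convex_facet: "F \<in> facets \<Longrightarrow> convex F"
  by (simp add: facet_of_imp_face_of face_of_imp_convex[of F K])

text \<open>The relative boundary of a polyhedron is the union of its facets, and full dimension
  makes the relative interior the interior.\<close>

lemma frontier_subset_facets: "x \<in> K \<Longrightarrow> x \<notin> interior K \<Longrightarrow> \<exists>F\<in>facets. x \<in> F"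
proof -
  assume "x \<in> K" "x \<notin> interior K"
  then have "x \<in> K - rel_interior K"
    by (simp add: rel_interior_nonempty_interior interior_nonempty)
  then show ?thesis
    unfolding rel_boundary_of_polyhedron[OF polytope_imp_polyhedron[OF polytope]] by simp
qed

lemma less_offset:
  assumes F: "F \<in> facets" and x: "x \<in> interior K"
  shows "nrm F \<bullet> x < off F"
proof -
  obtain r where r: "r > 0" "ball x r \<subseteq> K"
    using x by (auto simp: mem_interior)
  have "x + (r/2) *\<^sub>R nrm F \<in> K"
    using r norm_normal[OF F] by (intro subsetD[OF r(2)]) (simp add: dist_norm)
  from le_offset[OF F this] show ?thesis
    using r inner_normal[OF F] by (simp add: inner_add_right)
qed

text \<open>Otherwise the segment from an interior point \<open>z\<close> to \<open>x\<close> would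
  cross the frontier at a point \<open>w\<close> of some facet; but the inequality of that facet is
  strict at both ends, hence at \<open>w\<close>.\<close>

lemma mem_interiorI:
  assumes "\<And>F. F \<in> facets \<Longrightarrow> nrm F \<bullet> x < off F"
  shows "x \<in> interior K"
proof (rule ccontr)
  assume nx: "x \<notin> interior K"
  obtain z where z: "z \<in> interior K" using interior_nonempty by auto
  have "closed_segment z x \<inter> frontier (interior K) \<noteq> {}"
    using z nx by (intro connected_Int_frontier) auto
  then obtain w where w: "w \<in> closed_segment z x" "w \<in> frontier (interior K)" by auto
  have "w \<in> K" "w \<notin> interior K"
    using w(2) closed closure_minimal[OF interior_subset closed]
    by (auto simp: frontier_def)
  then obtain F where F: "F \<in> facets" "w \<in> F" using frontier_subset_facets by blast
  obtain u where u: "0 \<le> u" "u \<le> 1" "w = (1 - u) *\<^sub>R z + u *\<^sub>R x"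
    using w(1) by (auto simp: in_segment)
  have "nrm F \<bullet> w = off F" using F in_facet_iff by blast
  moreover have "nrm F \<bullet> w = (1 - u) * (nrm F \<bullet> z) + u * (nrm F \<bullet> x)"
    by (simp add: u(3) inner_add_right)
  moreover have "(1 - u) * (nrm F \<bullet> z) + u * (nrm F \<bullet> x) < off F"
    using less_offset[OF F(1) z] assms[OF F(1)] u by (intro convex_bound_lt) auto
  ultimately show False by simp
qed

lemma not_in_facet_offset:
  assumes x: "x \<in> K" "x \<notin> interior K"
  shows "\<exists>F\<in>facets. nrm F \<bullet> x = off F"
  using frontier_subset_facets[OF x] in_facet_iff by blast

lemma compact_prism: "F \<in> facets \<Longrightarrow> compact (facet_prism F n)"
proof -
  assume F: "F \<in> facets"
  have "facet_prism F n = (\<lambda>(y, t). y + t *\<^sub>R n) ` (F \<times> {0..1})"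
    by (force simp: facet_prism_def)
  moreover have "compact ((\<lambda>(y, t). y + t *\<^sub>R n) ` (F \<times> {0..1}))"
    unfolding case_prod_unfold
    by (intro compact_continuous_image continuous_intros compact_Times compact_facet F) auto
  ultimately show ?thesis by simp
qed

lemma continuous_on_closest_point_comp:
  assumes F: "F \<in> facets" and w: "continuous_on F w"
  shows "continuous_on S (\<lambda>x. w (closest_point F x))"
  using compact_facet[OF F] facet_nonempty[OF F] convex_facet[OF F] closest_point_in_set[of F]
  by (intro continuous_on_compose2[OF w] continuous_on_closest_point) (auto simp: compact_imp_closed)

lemma integrable_prism:
  fixes w :: "'a \<Rightarrow> real"
  assumes F: "F \<in> facets" and w: "continuous_on F w"
  shows "set_integrable lebesgue (facet_prism F n) (\<lambda>x. w (closest_point F x))"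
  by (intro set_integrable_compact_continuous compact_prism continuous_on_closest_point_comp assms)

end

section \<open>The divergence theorem in one direction\<close>

context solid_polytope
begin

definition cutoff :: "nat \<Rightarrow> 'a set set \<Rightarrow> 'a \<Rightarrow> real" where
  "cutoff m \<F> x = (\<Prod>F\<in>\<F>. clamp01 (real m * (off F - nrm F \<bullet> x)))"

text \<open>Up to the factor \<open>- real m * (nrm F \<bullet> e)\<close>, this is the term that
  arises in the \<open>e\<close>-derivative of \<open>w\<close> times the full cutoff when the
  factor belonging to \<open>F\<close> is differentiated: that factor has slope only within depth
  \<open>1/m\<close>, and the other cutoffs stay.\<close>

definition layer :: "nat \<Rightarrow> 'a set \<Rightarrow> ('a \<Rightarrow> real) \<Rightarrow> 'a \<Rightarrow> real" where
  "layer m F w x = indicator K x * w x * indicator {x. real m * (off F - nrm F \<bullet> x) < 1} x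
     * cutoff m (facets - {F}) x"

lemma cutoff_bounds: "0 \<le> cutoff m \<F> x" "cutoff m \<F> x \<le> 1"
  unfolding cutoff_def by (auto intro!: prod_nonneg prod_le_1 clamp01_simps)

lemma continuous_on_cutoff [continuous_intros]: "continuous_on S (cutoff m \<F>)"
  unfolding cutoff_def by (intro continuous_intros)

lemma layer_measurable:
  assumes w: "continuous_on K w"
  shows "layer m F w \<in> borel_measurable borel"
proof -
  have "(\<lambda>x. indicator K x *\<^sub>R w x) \<in> borel_measurable borel"
    using closed w by (intro borel_measurable_continuous_on_indicator) auto
  then have [measurable]: "(\<lambda>x. indicator K x * w x) \<in> borel_measurable borel" by simp
  have [measurable]: "cutoff m (facets - {F}) \<in> borel_measurable borel"
    by (intro borel_measurable_continuous_onI continuous_on_cutoff)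
  show ?thesis unfolding layer_def by measurable
qed

lemma bounded_on_K:
  fixes w :: "'a \<Rightarrow> real"
  assumes w: "continuous_on K w"
  obtains B where "\<And>x. x \<in> K \<Longrightarrow> \<bar>w x\<bar> \<le> B" "0 \<le> B"
proof -
  have "bounded (w ` K)"
    using compact w by (intro compact_imp_bounded compact_continuous_image)
  then obtain B where "B > 0" "\<And>x. x \<in> K \<Longrightarrow> \<bar>w x\<bar> \<le> B"
    unfolding bounded_pos by force
  then show ?thesis using that[of B] by simp
qed

lemma layer_bound:
  assumes "\<And>x. x \<in> K \<Longrightarrow> \<bar>w x\<bar> \<le> B" "0 \<le> B"
  shows "\<bar>layer m F w x\<bar> \<le> B * indicator K x"
proof (cases "x \<in> K")
  case True
  have "\<bar>w x\<bar> * (indicator {x. real m * (off F - nrm F \<bullet> x) < 1} x * cutoff m (facets - {F}) x) \<le> B * 1"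
    using cutoff_bounds[of m "facets - {F}" x] assms True
    by (intro mult_mono) (auto simp: indicator_def)
  then show ?thesis
    using True cutoff_bounds[of m "facets - {F}" x] by (simp add: layer_def abs_mult mult.assoc)
qed (simp add: layer_def)

lemma integrable_layer:
  assumes w: "continuous_on K w"
  shows "integrable lborel (layer m F w)"
proof -
  obtain B where B: "\<And>x. x \<in> K \<Longrightarrow> \<bar>w x\<bar> \<le> B" "0 \<le> B" using bounded_on_K[OF w] by blast
  have "integrable lborel (\<lambda>x. B * indicator K x)"
    using compact emeasure_bounded_finite[of K]
    by (intro integrable_mult_right integrable_real_indicator) (auto simp: compact_imp_bounded borel_compact)
  then show ?thesis
  proof (rule Bochner_Integration.integrable_bound)
    show "layer m F w \<in> borel_measurable lborel" using layer_measurable[OF w] by simp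
    show "AE x in lborel. norm (layer m F w x) \<le> norm (B * indicator K x)"
      using layer_bound[OF B] B(2) by (intro AE_I2) simp
  qed
qed

text \<open>The displacement is orthogonal to the facet, so by Pythagoras no other point of
  \<open>F\<close> is nearer.\<close>

lemma closest_point_facet:
  assumes F: "F \<in> facets" and y: "y \<in> F"
  shows "closest_point F (y + t *\<^sub>R nrm F) = y"
proof (rule closest_point_unique[symmetric])
  show "\<forall>z\<in>F. dist (y + t *\<^sub>R nrm F) y \<le> dist (y + t *\<^sub>R nrm F) z"
  proof
    fix z assume z: "z \<in> F"
    have o: "nrm F \<bullet> (y - z) = 0"
      using y z in_facet_iff[OF F] by (simp add: inner_diff_right)
    have "norm ((y - z) + t *\<^sub>R nrm F) ^ 2 = norm (y - z) ^ 2 + norm (t *\<^sub>R nrm F) ^ 2"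
      using o by (intro norm_add_Pythagorean) (simp add: orthogonal_def inner_commute)
    then have "norm (t *\<^sub>R nrm F) ^ 2 \<le> norm ((y - z) + t *\<^sub>R nrm F) ^ 2" by simp
    then have "norm (t *\<^sub>R nrm F) \<le> norm ((y - z) + t *\<^sub>R nrm F)"
      by (rule power2_le_imp_le) simp
    then show "dist (y + t *\<^sub>R nrm F) y \<le> dist (y + t *\<^sub>R nrm F) z"
      by (simp add: dist_norm algebra_simps)
  qed
qed (use F y in \<open>auto simp: convex_facet compact_facet compact_imp_closed\<close>)

text \<open>Pointwise limit of the rescaled boundary layers: off a null set, \<open>squeeze\<close> pushes a point of
  the prism into the interior of \<open>K\<close>, and every other point out of the layer.\<close>

lemma layer_squeeze_tendsto:
  assumes F: "F \<in> facets" and w: "continuous_on K w"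
  defines "s \<equiv> (\<lambda>x. nrm F \<bullet> x - off F)"
  assumes s: "s x \<noteq> 0" "s x \<noteq> 1"
    and edge: "\<And>G. G \<in> facets - {F} \<Longrightarrow> nrm G \<bullet> (x - s x *\<^sub>R nrm F) \<noteq> off G"
  shows "(\<lambda>k. layer (Suc k) F w (squeeze (nrm F) (real (Suc k)) (off F) x))
    \<longlonglongrightarrow> indicator (facet_prism F (nrm F)) x * w (closest_point F x)"
proof -
  define y where "y = x - s x *\<^sub>R nrm F"
  define q where "q k = squeeze (nrm F) (real (Suc k)) (off F) x" for k
  \<comment> \<open>\<open>y\<close> is the foot of \<open>x\<close> on the facet plane and
    \<open>s x\<close> the height over it. Squeezing changes only the height, so the images run to
    \<open>y\<close> along the normal.\<close>
  have qy: "q k = y + ((s x - 1) / real (Suc k)) *\<^sub>R nrm F" for k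
    by (simp add: q_def y_def squeeze_def s_def algebra_simps)
  have ny: "nrm F \<bullet> y = off F"
    using inner_normal[OF F] by (simp add: y_def s_def inner_diff_right)
  have sq: "real (Suc k) * (off F - nrm F \<bullet> q k) = 1 - s x" for k
    using inner_normal[OF F] by (simp add: qy ny inner_add_right)
  have lim: "q \<longlonglongrightarrow> y"
  proof -
    have "(\<lambda>k. y + ((s x - 1) / real (Suc k)) *\<^sub>R nrm F) \<longlonglongrightarrow> y + 0 *\<^sub>R nrm F"
      by (intro tendsto_intros LIMSEQ_Suc lim_const_over_n)
    then show ?thesis by (simp add: qy[abs_def])
  qed
  have prism: "x \<in> facet_prism F (nrm F) \<longleftrightarrow> 0 \<le> s x \<and> s x \<le> 1 \<and> y \<in> F"
  proof
    assume "x \<in> facet_prism F (nrm F)"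
    then obtain y' t where yt: "x = y' + t *\<^sub>R nrm F" "y' \<in> F" "0 \<le> t" "t \<le> 1"
      by (auto simp: facet_prism_def)
    then have "s x = t"
      using inner_normal[OF F] in_facet_iff[OF F] by (simp add: s_def inner_add_right)
    then show "0 \<le> s x \<and> s x \<le> 1 \<and> y \<in> F" using yt by (simp add: y_def)
  next
    assume "0 \<le> s x \<and> s x \<le> 1 \<and> y \<in> F"
    then show "x \<in> facet_prism F (nrm F)"
      unfolding facet_prism_def by (auto simp: y_def intro!: exI[of _ "x - s x *\<^sub>R nrm F"] exI[of _ "s x"])
  qed
  show ?thesis
  proof (cases "x \<in> facet_prism F (nrm F)")
    case False
    have "\<forall>\<^sub>F k in sequentially. layer (Suc k) F w (q k) = 0"
    proof (cases "0 < s x \<and> s x < 1")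
      case True
      then have "y \<notin> K" using False prism ny in_facet_iff[OF F] by simp
      then have "\<forall>\<^sub>F k in sequentially. q k \<in> - K"
        using lim closed by (intro topological_tendstoD) auto
      then show ?thesis
        by eventually_elim (simp add: layer_def)
    next
      \<comment> \<open>Negative heights land deeper than \<open>1 / real (Suc k)\<close>, where the
        layer has ended; heights above 1 land outside \<open>K\<close>.\<close>
      case out: False
      have "layer (Suc k) F w (q k) = 0" for k
      proof (cases "s x < 0")
        case True
        then show ?thesis using sq[of k] by (simp add: layer_def)
      next
        case False
        with out s have "1 < s x" by simp
        then have "real (Suc k) * (off F - nrm F \<bullet> q k) < 0" using sq by simp
        then have "off F < nrm F \<bullet> q k" by (simp add: mult_less_0_iff del: of_nat_Suc)
        then have "q k \<notin> K" using le_offset[OF F, of "q k"] by auto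
        then show ?thesis by (simp add: layer_def)
      qed
      then show ?thesis by simp
    qed
    then show ?thesis
      using False by (simp add: q_def tendsto_eventually)
  next
    case True
    then have sx: "0 < s x" "s x < 1" and y: "y \<in> F" using prism s by auto
    then have yK: "y \<in> K" using facet_subset[OF F] by auto
    \<comment> \<open>Away from the edges \<open>y\<close> has positive distance from the planes of
      the other facets, so the cutoffs there are eventually saturated along
      \<open>q\<close>.\<close>
    have "\<forall>\<^sub>F k in sequentially. 1 < real (Suc k) * (off G - nrm G \<bullet> q k)" if G: "G \<in> facets - {F}" for G
    proof -
      have "0 < off G - nrm G \<bullet> y"
        using le_offset[of G y] yK edge[OF G] G by (simp add: y_def[symmetric])
      moreover have "(\<lambda>k. off G - nrm G \<bullet> q k) \<longlonglongrightarrow> off G - nrm G \<bullet> y"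
        by (intro tendsto_intros lim)
      moreover have "filterlim (\<lambda>k. real (Suc k)) at_top sequentially"
        using filterlim_real_sequentially by (rule filterlim_compose[OF _ filterlim_Suc])
      ultimately have "filterlim (\<lambda>k. (off G - nrm G \<bullet> q k) * real (Suc k)) at_top sequentially"
        by (intro filterlim_tendsto_pos_mult_at_top)
      then have "\<forall>\<^sub>F k in sequentially. 1 < (off G - nrm G \<bullet> q k) * real (Suc k)"
        by (simp only: filterlim_at_top_dense)
      then show ?thesis by (simp add: mult.commute)
    qed
    then have "\<forall>\<^sub>F k in sequentially. \<forall>G\<in>facets - {F}. 1 < real (Suc k) * (off G - nrm G \<bullet> q k)"
      using finite_facets by (intro eventually_ball_finite) auto
    then have ev: "\<forall>\<^sub>F k in sequentially. q k \<in> K \<and> layer (Suc k) F w (q k) = w (q k)"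
    proof eventually_elim
      case (elim k)
      have "q k \<in> interior K"
      proof (rule mem_interiorI)
        fix G assume G: "G \<in> facets"
        have "0 < real (Suc k) * (off G - nrm G \<bullet> q k)"
        proof (cases "G = F")
          case True
          then show ?thesis using sq[of k] sx by simp
        next
          case False
          then have "1 < real (Suc k) * (off G - nrm G \<bullet> q k)" using elim G by blast
          then show ?thesis by linarith
        qed
        then show "nrm G \<bullet> q k < off G" by (simp add: zero_less_mult_iff del: of_nat_Suc)
      qed
      then have "q k \<in> K" using interior_subset by blast
      moreover have "cutoff (Suc k) (facets - {F}) (q k) = 1"
        unfolding cutoff_def
      proof (rule prod.neutral, rule ballI)
        fix G assume "G \<in> facets - {F}"
        then have "1 < real (Suc k) * (off G - nrm G \<bullet> q k)" using elim by blast
        then show "clamp01 (real (Suc k) * (off G - nrm G \<bullet> q k)) = 1"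
          by (intro clamp01_simps) simp
      qed
      moreover have "real (Suc k) * (off F - nrm F \<bullet> q k) < 1" using sq[of k] sx by simp
      ultimately show ?case by (simp add: layer_def del: of_nat_Suc)
    qed
    then have "\<forall>\<^sub>F k in sequentially. q k \<in> K" by eventually_elim simp
    then have "(\<lambda>k. w (q k)) \<longlonglongrightarrow> w y"
      by (rule continuous_on_tendsto_compose[OF w lim yK])
    moreover have "\<forall>\<^sub>F k in sequentially. w (q k) = layer (Suc k) F w (q k)"
      using ev by eventually_elim simp
    ultimately have "(\<lambda>k. layer (Suc k) F w (q k)) \<longlonglongrightarrow> w y"
      by (rule Lim_transform_eventually)
    moreover have "closest_point F x = y"
      using closest_point_facet[OF F y, of "s x"] by (simp add: y_def)
    ultimately show ?thesis using True by (simp add: q_def)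
  qed
qed

text \<open>Two facets cannot lie in the same hyperplane, since \<open>K\<close> is neither flat nor has a facet twice.\<close>

lemma AE_not_over_edge:
  assumes F: "F \<in> facets"
  shows "AE x in lborel. nrm F \<bullet> x - off F \<noteq> 0 \<and> nrm F \<bullet> x - off F \<noteq> 1 \<and>
    (\<forall>G\<in>facets - {F}. nrm G \<bullet> (x - (nrm F \<bullet> x - off F) *\<^sub>R nrm F) \<noteq> off G)"
proof -
  have ae: "AE x in lborel. n \<bullet> x \<noteq> c" if "n \<noteq> 0" for n :: 'a and c
  proof -
    have "AE x in lebesgue. x \<notin> hyperplanes {(n, c)}" by (rule AE_not_hyperplanes) simp
    then have "AE x in lborel. x \<notin> hyperplanes {(n, c)}" by (simp add: AE_completion_iff)
    then show ?thesis by eventually_elim (use that in \<open>simp add: hyperplanes_def\<close>)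
  qed
  have F0: "nrm F \<noteq> 0" using norm_normal[OF F] by auto
  have "AE x in lborel. nrm G \<bullet> (x - (nrm F \<bullet> x - off F) *\<^sub>R nrm F) \<noteq> off G" if G: "G \<in> facets - {F}" for G
  \<comment> \<open>If the normals are not parallel, the excluded equation describes a hyperplane in
    \<open>x\<close>. If they are, its left side is constant in \<open>x\<close>, and it differs
    from \<open>off G\<close> because the two facet planes are distinct.\<close>
  proof (cases "nrm G = (nrm G \<bullet> nrm F) *\<^sub>R nrm F")
    case False
    have "AE x in lborel. (nrm G - (nrm G \<bullet> nrm F) *\<^sub>R nrm F) \<bullet> x \<noteq> off G - off F * (nrm G \<bullet> nrm F)"
      by (rule ae) (use False in auto)
    then show ?thesis
      by eventually_elim (simp add: inner_diff_left inner_diff_right algebra_simps)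
  next
    case True
    define l where "l = nrm G \<bullet> nrm F"
    have l: "nrm G = l *\<^sub>R nrm F" using True by (simp add: l_def)
    then have "\<bar>l\<bar> = 1" using norm_normal[OF F] norm_normal[of G] G by simp
    have "l * off F \<noteq> off G"
    proof
      assume eq: "l * off F = off G"
      show False
      proof (cases "l = 1")
        case True
        then have "x \<in> F \<longleftrightarrow> x \<in> G" for x
          using in_facet_iff[OF F, of x] in_facet_iff[of G x] G eq l by simp
        then show False using G by blast
      next
        case False
        then have "l = -1" using \<open>\<bar>l\<bar> = 1\<close> by auto
        obtain z where z: "z \<in> interior K" using interior_nonempty by auto
        show False using less_offset[OF F z] less_offset[OF _ z, of G] G eq l \<open>l = -1\<close> by simp
      qed
    qed
    moreover have "nrm G \<bullet> (x - (nrm F \<bullet> x - off F) *\<^sub>R nrm F) = l * off F" for x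
      using inner_normal[OF F] by (simp add: l inner_diff_right algebra_simps)
    ultimately show ?thesis by simp
  qed
  then have "AE x in lborel. \<forall>G\<in>facets - {F}. nrm G \<bullet> (x - (nrm F \<bullet> x - off F) *\<^sub>R nrm F) \<noteq> off G"
    using finite_facets by (intro AE_finite_allI) auto
  with ae[OF F0, of "off F"] ae[OF F0, of "off F + 1"] show ?thesis
    by eventually_elim auto
qed

text \<open>The factor \<open>real (Suc k)\<close> is the Jacobian of \<open>squeeze\<close>: the
  sequence consists of the integrals of the layers composed with \<open>squeeze\<close>, whose
  supports stay in a fixed ball, so dominated convergence applies.\<close>

lemma layer_tendsto_facet_integral:
  assumes F: "F \<in> facets" and w: "continuous_on K w"
  shows "(\<lambda>k. real (Suc k) * integral\<^sup>L lborel (layer (Suc k) F w)) \<longlonglongrightarrow> facet_integral F (nrm F) w"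
proof -
  obtain B where B: "\<And>x. x \<in> K \<Longrightarrow> \<bar>w x\<bar> \<le> B" "0 \<le> B" using bounded_on_K[OF w] by blast
  obtain R where R: "\<And>x. x \<in> K \<Longrightarrow> norm x \<le> R"
    using compact_imp_bounded[OF compact] by (auto simp: bounded_iff)
  define P where "P = facet_prism F (nrm F)"
  define h where "h x = indicator P x * w (closest_point F x)" for x
  define f where "f k x = layer (Suc k) F w (squeeze (nrm F) (real (Suc k)) (off F) x)" for k x
  have PB: "P \<in> sets borel"
    using compact_prism[OF F] by (simp add: P_def borel_compact)
  have wF: "continuous_on F w" using w facet_subset[OF F] by (rule continuous_on_subset)
  have hm: "h \<in> borel_measurable borel"
  proof -
    have "(\<lambda>x. indicator P x *\<^sub>R w (closest_point F x)) \<in> borel_measurable borel"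
      by (intro borel_measurable_continuous_on_indicator PB continuous_on_closest_point_comp F wF)
    then show ?thesis by (simp add: h_def[abs_def])
  qed
  have fm: "f k \<in> borel_measurable lborel" for k
  proof -
    have "squeeze (nrm F) (real (Suc k)) (off F) \<in> borel_measurable borel"
      unfolding squeeze_def by measurable
    from measurable_compose[OF this layer_measurable[OF w]] show ?thesis by (simp add: f_def[abs_def])
  qed
  \<comment> \<open>Where the squeezed layer is nonzero, the height lies in \<open>(0, 1]\<close>
    and the point is moved by at most 2; hence the radius \<open>R + 2\<close>.\<close>
  define W where "W x = B * indicator (cball 0 (R + 2)) x" for x :: 'a
  have Wi: "integrable lborel W" unfolding W_def
    using emeasure_bounded_finite[of "cball (0::'a) (R + 2)"]
    by (intro integrable_mult_right integrable_real_indicator) auto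
  have dom: "norm (f k x) \<le> W x" for k x
  proof (cases "f k x = 0")
    case True
    then show ?thesis using B(2) by (simp add: W_def)
  next
    case False
    define q where "q = squeeze (nrm F) (real (Suc k)) (off F) x"
    define s where "s = nrm F \<bullet> x - off F"
    have "layer (Suc k) F w q \<noteq> 0" using False by (simp add: f_def q_def)
    then have q: "q \<in> K" "real (Suc k) * (off F - nrm F \<bullet> q) < 1"
      by (auto simp: layer_def indicator_def split: if_splits)
    have nq: "nrm F \<bullet> q = off F + (s - 1) / real (Suc k)"
      using inner_squeeze[OF norm_normal[OF F]] by (simp add: q_def s_def)
    then have "real (Suc k) * (off F - nrm F \<bullet> q) = 1 - s" by simp
    then have "0 < s" using q by linarith
    have "(s - 1) / real (Suc k) \<le> 0" using le_offset[OF F q(1)] nq by simp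
    then have "s \<le> 1" by (simp add: divide_le_0_iff)
    have "x = q - ((s - 1) / real (Suc k) - s) *\<^sub>R nrm F"
      by (simp add: q_def squeeze_def s_def)
    then have "norm x \<le> norm q + \<bar>(s - 1) / real (Suc k) - s\<bar>"
      using norm_triangle_ineq4[of q "((s - 1) / real (Suc k) - s) *\<^sub>R nrm F"] norm_normal[OF F] by simp
    also have "\<dots> \<le> R + (1 + 1)"
    proof -
      have "\<bar>(s - 1) / real (Suc k)\<bar> \<le> \<bar>s - 1\<bar>"
        unfolding abs_divide by (simp add: divide_le_eq mult_le_cancel_left1)
      then have "\<bar>(s - 1) / real (Suc k) - s\<bar> \<le> 1 + 1" using \<open>0 < s\<close> \<open>s \<le> 1\<close> by linarith
      then show ?thesis using R[OF q(1)] by simp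
    qed
    finally have "x \<in> cball 0 (R + 2)" by simp
    moreover have "\<bar>f k x\<bar> \<le> B * indicator K q"
      unfolding f_def q_def by (rule layer_bound[OF B])
    ultimately show ?thesis using q(1) by (simp add: W_def)
  qed
  have ae: "AE x in lborel. (\<lambda>k. f k x) \<longlonglongrightarrow> h x"
    using AE_not_over_edge[OF F]
    by eventually_elim (unfold f_def h_def P_def, rule layer_squeeze_tendsto[OF F w], blast+)
  have "(\<lambda>k. integral\<^sup>L lborel (f k)) \<longlonglongrightarrow> integral\<^sup>L lborel h"
    by (rule integral_dominated_convergence[where w=W]) (use hm fm Wi ae dom in auto)
  moreover have "integral\<^sup>L lborel (f k) = real (Suc k) * integral\<^sup>L lborel (layer (Suc k) F w)" for k
    unfolding f_def by (rule integral_squeeze) (use norm_normal[OF F] layer_measurable[OF w] in auto)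
  moreover have "integral\<^sup>L lborel h = facet_integral F (nrm F) w"
    using hm unfolding facet_integral_def set_lebesgue_integral_def facet_prism_def[symmetric]
    by (simp add: integral_completion h_def[abs_def] P_def)
  ultimately show ?thesis by simp
qed

end

context solid_polytope
begin

lemma cutoff_eq_0:
  assumes "x \<notin> interior K"
  shows "cutoff m facets x = 0"
proof -
  obtain F where F: "F \<in> facets" "off F \<le> nrm F \<bullet> x"
    using assms mem_interiorI[of x] by (meson not_less)
  then have "clamp01 (real m * (off F - nrm F \<bullet> x)) = 0"
    by (intro clamp01_simps) (simp add: mult_nonneg_nonpos)
  then show ?thesis
    unfolding cutoff_def using F(1) finite_facets by (intro prod_zero) auto
qed

lemma cutoff_tendsto:
  assumes x: "x \<in> interior K"
  shows "(\<lambda>k. cutoff (Suc k) facets x) \<longlonglongrightarrow> 1"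
proof -
  have "(\<lambda>k. clamp01 (real (Suc k) * (off F - nrm F \<bullet> x))) \<longlonglongrightarrow> 1" if F: "F \<in> facets" for F
  proof (rule tendsto_eventually)
    have "0 < off F - nrm F \<bullet> x" using less_offset[OF F x] by simp
    then have "filterlim (\<lambda>k. (off F - nrm F \<bullet> x) * real (Suc k)) at_top sequentially"
      by (intro filterlim_tendsto_pos_mult_at_top[OF tendsto_const]
          filterlim_compose[OF filterlim_real_sequentially filterlim_Suc])
    then have "\<forall>\<^sub>F k in sequentially. 1 < (off F - nrm F \<bullet> x) * real (Suc k)"
      by (simp only: filterlim_at_top_dense)
    then show "\<forall>\<^sub>F k in sequentially. clamp01 (real (Suc k) * (off F - nrm F \<bullet> x)) = 1"
      by eventually_elim (intro clamp01_simps, simp add: mult.commute)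
  qed
  from tendsto_prod[of facets "\<lambda>F k. clamp01 (real (Suc k) * (off F - nrm F \<bullet> x))", OF this] show ?thesis
    unfolding cutoff_def by simp
qed

text \<open>Differentiating \<open>w\<close> times the cutoff gives an interior term and one layer
  for each facet, and their total integral is 0 for every positive \<open>m\<close>. As
  \<open>m\<close> grows, the cutoff tends to 1 inside while the layers tend to the surface
  integrals.\<close>

lemma directional_divergence:
  fixes w :: "'a \<Rightarrow> real"
  assumes w: "continuous_on K w"
    and der: "\<And>x. x \<in> interior K \<Longrightarrow> (w has_derivative w' x) (at x)"
    and w': "continuous_on (interior K) (\<lambda>x. w' x e)"
    and bd: "\<And>x. x \<in> interior K \<Longrightarrow> \<bar>w' x e\<bar> \<le> M"
  shows "(LINT x:interior K|lebesgue. w' x e) = (\<Sum>F\<in>facets. (nrm F \<bullet> e) * facet_integral F (nrm F) w)"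
proof -
  obtain B where B: "\<And>x. x \<in> K \<Longrightarrow> \<bar>w x\<bar> \<le> B" "0 \<le> B" using bounded_on_K[OF w] by blast
  obtain R where R: "\<And>x. x \<in> K \<Longrightarrow> norm x \<le> R"
    using compact_imp_bounded[OF compact] by (auto simp: bounded_iff)
  have M0: "0 \<le> M" using bd interior_nonempty by fastforce
  have bdi: "bounded (interior K)"
    using compact_imp_bounded[OF compact] interior_subset by (rule bounded_subset)
  define t where "t m x = indicator (interior K) x * (w' x e * cutoff m facets x)" for m x
  have ti: "integrable lebesgue (t m)" for m
  proof -
    have "set_integrable lebesgue (interior K) (\<lambda>x. w' x e * cutoff m facets x)"
    proof (rule set_integrable_bounded_continuous)
      show "continuous_on (interior K) (\<lambda>x. w' x e * cutoff m facets x)"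
        by (intro continuous_intros w')
      show "\<bar>w' x e * cutoff m facets x\<bar> \<le> M * 1" if "x \<in> interior K" for x
        unfolding abs_mult using bd[OF that] cutoff_bounds[of m facets x] M0 by (intro mult_mono) auto
    qed (use bdi in auto)
    then show ?thesis by (simp add: set_integrable_def t_def[abs_def])
  qed
  have eq: "integral\<^sup>L lebesgue (t m) = (\<Sum>F\<in>facets. (nrm F \<bullet> e) * (real m * integral\<^sup>L lborel (layer m F w)))"
    if m: "m > 0" for m
  proof -
    define g where "g x = (if x \<in> K then w x * cutoff m facets x else 0)" for x
    \<comment> \<open>The kinks: the facet planes, and the parallel planes at depth
      \<open>1/m\<close> where a cutoff becomes constant.\<close>
    define \<H> where "\<H> = (\<lambda>F. (nrm F, off F)) ` facets \<union> (\<lambda>F. (nrm F, off F - 1 / real m)) ` facets"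
    define S where "S x v = (\<Sum>F\<in>facets. (if real m * (off F - nrm F \<bullet> x) < 1 then - (real m * (nrm F \<bullet> v)) else 0)
        * cutoff m (facets - {F}) x)" for x v
    define g' where "g' x v = (if x \<in> interior K then w x * S x v + w' x v * cutoff m facets x else 0)" for x v
    \<comment> \<open>Equals \<open>g' x e\<close> off the kinks, but is assembled from integrable
      pieces, so that its vanishing integral can be split.\<close>
    define h where "h x = t m x - (\<Sum>F\<in>facets. (nrm F \<bullet> e) * (real m * layer m F w x))" for x
    have finH: "finite \<H>" by (simp add: \<H>_def finite_facets)
    have nz: "nrm F \<noteq> 0" if "F \<in> facets" for F using norm_normal[OF that] by auto
    have off1: "nrm F \<bullet> x \<noteq> off F" if "x \<notin> hyperplanes \<H>" "F \<in> facets" for x F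
    proof
      assume "nrm F \<bullet> x = off F"
      moreover have "(nrm F, off F) \<in> \<H>" using that(2) by (simp add: \<H>_def)
      ultimately show False using that nz unfolding hyperplanes_def by blast
    qed
    have off2: "real m * (off F - nrm F \<bullet> x) \<noteq> 1" if "x \<notin> hyperplanes \<H>" "F \<in> facets" for x F
    proof
      assume "real m * (off F - nrm F \<bullet> x) = 1"
      then have "nrm F \<bullet> x = off F - 1 / real m" using m by (simp add: field_simps)
      moreover have "(nrm F, off F - 1 / real m) \<in> \<H>" using that(2) by (simp add: \<H>_def)
      ultimately show False using that nz unfolding hyperplanes_def by blast
    qed
    have cases: "x \<in> interior K \<or> x \<notin> K" if "x \<notin> hyperplanes \<H>" for x
      using not_in_facet_offset[of x] off1[OF that] by blast
    have gc: "continuous_on UNIV g"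
    proof -
      have "continuous_on (K \<union> - interior K) g" unfolding g_def
      proof (rule continuous_on_cases)
        show "\<forall>x. x \<in> K \<and> x \<notin> K \<or> x \<in> - interior K \<and> x \<in> K \<longrightarrow> w x * cutoff m facets x = 0"
          using cutoff_eq_0 by auto
      qed (use closed in \<open>auto intro!: continuous_intros w\<close>)
      moreover have "K \<union> - interior K = UNIV" using interior_subset by auto
      ultimately show ?thesis by simp
    qed
    have supp: "g x = 0" if "R < norm x" for x
      using that R[of x] by (auto simp: g_def)
    have derg: "(g has_derivative g' x) (at x)" if x: "x \<notin> hyperplanes \<H>" for x
    proof (cases "x \<in> interior K")
      case True
      have "((\<lambda>x. clamp01 (real m * (off F - nrm F \<bullet> x))) has_derivative
          (\<lambda>v. if real m * (off F - nrm F \<bullet> x) < 1 then - (real m * (nrm F \<bullet> v)) else 0)) (at x)"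
        if F: "F \<in> facets" for F
      proof (rule has_derivative_clamp01)
        show "((\<lambda>x. real m * (off F - nrm F \<bullet> x)) has_derivative (\<lambda>v. - (real m * (nrm F \<bullet> v)))) (at x)"
          by (auto intro!: derivative_eq_intros)
        show "0 < real m * (off F - nrm F \<bullet> x)" using m less_offset[OF F True] by simp
        show "real m * (off F - nrm F \<bullet> x) \<noteq> 1" using x F by (rule off2)
      qed
      then have "(cutoff m facets has_derivative S x) (at x)"
        unfolding cutoff_def[abs_def] S_def[abs_def] by (rule has_derivative_prod)
      from has_derivative_mult[OF der[OF True] this]
      have "((\<lambda>x. w x * cutoff m facets x) has_derivative g' x) (at x)"
        using True by (simp add: g'_def[abs_def])
      then show ?thesis
        by (rule has_derivative_transform_within_open[of _ _ _ _ "interior K"])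
          (use True interior_subset in \<open>auto simp: g_def\<close>)
    next
      case False
      then have "x \<notin> K" using cases[OF x] by blast
      have "((\<lambda>x. 0) has_derivative g' x) (at x)"
        using False by (simp add: g'_def[abs_def])
      then show ?thesis
        by (rule has_derivative_transform_within_open[of _ _ _ _ "- K"])
          (use \<open>x \<notin> K\<close> closed in \<open>auto simp: g_def\<close>)
    qed
    define D where "D = B * (\<Sum>F\<in>facets. real m * \<bar>nrm F \<bullet> e\<bar>) + M"
    have D0: "0 \<le> D"
      unfolding D_def using B(2) M0 by (intro add_nonneg_nonneg mult_nonneg_nonneg sum_nonneg) auto
    have bdg: "\<bar>g' x e\<bar> \<le> D" for x
    proof (cases "x \<in> interior K")
      case True
      have "\<bar>S x e\<bar> \<le> (\<Sum>F\<in>facets. real m * \<bar>nrm F \<bullet> e\<bar>)"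
        unfolding S_def
      proof (intro order_trans[OF sum_abs] sum_mono)
        fix F
        have "\<bar>if real m * (off F - nrm F \<bullet> x) < 1 then - (real m * (nrm F \<bullet> e)) else 0\<bar>
            * \<bar>cutoff m (facets - {F}) x\<bar> \<le> (real m * \<bar>nrm F \<bullet> e\<bar>) * 1"
          using cutoff_bounds[of m "facets - {F}" x] by (intro mult_mono) (auto simp: abs_mult)
        then show "\<bar>(if real m * (off F - nrm F \<bullet> x) < 1 then - (real m * (nrm F \<bullet> e)) else 0)
            * cutoff m (facets - {F}) x\<bar> \<le> real m * \<bar>nrm F \<bullet> e\<bar>"
          by (simp add: abs_mult)
      qed
      then have "\<bar>w x * S x e\<bar> \<le> B * (\<Sum>F\<in>facets. real m * \<bar>nrm F \<bullet> e\<bar>)"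
        unfolding abs_mult using B True interior_subset by (intro mult_mono) auto
      moreover have "\<bar>w' x e * cutoff m facets x\<bar> \<le> M * 1"
        unfolding abs_mult using bd[OF True] cutoff_bounds[of m facets x] M0 by (intro mult_mono) auto
      ultimately show ?thesis
        using True by (simp add: g'_def D_def)
    qed (use D0 in \<open>simp add: g'_def\<close>)
    have hg: "h x = g' x e" if x: "x \<notin> hyperplanes \<H>" for x
    proof (cases "x \<in> interior K")
      case True
      then have "x \<in> K" using interior_subset by blast
      have "(nrm F \<bullet> e) * (real m * layer m F w x) = - (w x * ((if real m * (off F - nrm F \<bullet> x) < 1
          then - (real m * (nrm F \<bullet> e)) else 0) * cutoff m (facets - {F}) x))" for F
        using \<open>x \<in> K\<close> by (simp add: layer_def)
      then show ?thesis
        using True by (simp add: h_def g'_def t_def S_def sum_negf sum_distrib_left)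
    next
      case False
      then have "x \<notin> K" using cases[OF x] by blast
      then show ?thesis using False by (simp add: h_def g'_def t_def layer_def)
    qed
    have "integral\<^sup>L lebesgue h = 0"
      by (rule integral_directional_derivative_eq_0(2)[OF gc finH supp derg bdg hg])
    moreover have li: "integrable lebesgue (layer m F w)" for F
      using integrable_layer[OF w] layer_measurable[OF w] by (simp add: integrable_completion)
    ultimately have "integral\<^sup>L lebesgue (t m) =
        (\<Sum>F\<in>facets. (nrm F \<bullet> e) * (real m * integral\<^sup>L lebesgue (layer m F w)))"
      using ti[of m] unfolding h_def[abs_def]
      by (simp add: Bochner_Integration.integral_diff Bochner_Integration.integral_sum)
    also have "\<dots> = (\<Sum>F\<in>facets. (nrm F \<bullet> e) * (real m * integral\<^sup>L lborel (layer m F w)))"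
      using layer_measurable[OF w] by (simp add: integral_completion)
    finally show ?thesis .
  qed
  have "(\<lambda>k. integral\<^sup>L lebesgue (t (Suc k))) \<longlonglongrightarrow> integral\<^sup>L lebesgue (\<lambda>x. indicator (interior K) x * w' x e)"
  proof (rule integral_dominated_convergence[where w="\<lambda>x. M * indicator (interior K) x"])
    have "set_integrable lebesgue (interior K) (\<lambda>x. w' x e)"
      by (rule set_integrable_bounded_continuous[OF _ bdi w' bd]) auto
    then show "(\<lambda>x. indicator (interior K) x * w' x e) \<in> borel_measurable lebesgue"
      by (auto simp: set_integrable_def dest: borel_measurable_integrable)
    show "t (Suc k) \<in> borel_measurable lebesgue" for k
      using ti by (rule borel_measurable_integrable)
    have "set_integrable lebesgue (interior K) (\<lambda>x. M)"
      by (rule set_integrable_bounded_continuous[OF _ bdi, of _ "\<bar>M\<bar>"]) auto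
    then show "integrable lebesgue (\<lambda>x. M * indicator (interior K) x)"
      by (simp add: set_integrable_def mult.commute)
    show "AE x in lebesgue. (\<lambda>k. t (Suc k) x) \<longlonglongrightarrow> indicator (interior K) x * w' x e"
    proof (intro AE_I2)
      fix x
      show "(\<lambda>k. t (Suc k) x) \<longlonglongrightarrow> indicator (interior K) x * w' x e"
      proof (cases "x \<in> interior K")
        case True
        have "(\<lambda>k. indicator (interior K) x * (w' x e * cutoff (Suc k) facets x))
          \<longlonglongrightarrow> indicator (interior K) x * (w' x e * 1)"
          by (intro tendsto_intros cutoff_tendsto True)
        then show ?thesis by (simp add: t_def)
      qed (simp add: t_def)
    qed
    show "AE x in lebesgue. norm (t (Suc k) x) \<le> M * indicator (interior K) x" for k
    proof (intro AE_I2)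
      fix x
      show "norm (t (Suc k) x) \<le> M * indicator (interior K) x"
      proof (cases "x \<in> interior K")
        case True
        have "\<bar>w' x e * cutoff (Suc k) facets x\<bar> \<le> M * 1"
          unfolding abs_mult using bd[OF True] cutoff_bounds[of "Suc k" facets x] M0 by (intro mult_mono) auto
        then show ?thesis using True by (simp add: t_def)
      qed (simp add: t_def)
    qed
  qed
  moreover have "(\<lambda>k. integral\<^sup>L lebesgue (t (Suc k)))
      \<longlonglongrightarrow> (\<Sum>F\<in>facets. (nrm F \<bullet> e) * facet_integral F (nrm F) w)"
    unfolding eq[OF zero_less_Suc]
    by (intro tendsto_sum tendsto_mult tendsto_const layer_tendsto_facet_integral[OF _ w])
  ultimately have "integral\<^sup>L lebesgue (\<lambda>x. indicator (interior K) x * w' x e)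
      = (\<Sum>F\<in>facets. (nrm F \<bullet> e) * facet_integral F (nrm F) w)"
    by (rule LIMSEQ_unique)
  then show ?thesis by (simp add: set_lebesgue_integral_def)
qed

end

section \<open>Polynomials and local spaces\<close>

text \<open>The induction carries the derivative explicitly, because what counts is that directional
  derivatives are polynomials again. Gradients and Laplacians are then continuous up to the boundary
  of a cell.\<close>

lemma real_polynomial_function_derivative:
  assumes "real_polynomial_function q"
  shows "\<exists>q'. (\<forall>x. (q has_derivative q' x) (at x)) \<and> (\<forall>v. real_polynomial_function (\<lambda>x. q' x v))"
  using assms
proof induction
  case (linear f)
  then show ?case
    by (intro exI[of _ "\<lambda>x. f"] conjI allI bounded_linear_imp_has_derivative real_polynomial_function.intros(2))
next
  case (const c)
  show ?case
    by (intro exI[of _ "\<lambda>x v. 0"] conjI allI has_derivative_const real_polynomial_function.intros(2))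
next
  case (add f g)
  then obtain f' g' where "\<And>x. (f has_derivative f' x) (at x)" "\<And>v. real_polynomial_function (\<lambda>x. f' x v)"
    "\<And>x. (g has_derivative g' x) (at x)" "\<And>v. real_polynomial_function (\<lambda>x. g' x v)"
    by blast
  then show ?case
    by (intro exI[of _ "\<lambda>x v. f' x v + g' x v"] conjI allI has_derivative_add real_polynomial_function.intros(3))
next
  case (mult f g)
  then obtain f' g' where "\<And>x. (f has_derivative f' x) (at x)" "\<And>v. real_polynomial_function (\<lambda>x. f' x v)"
    "\<And>x. (g has_derivative g' x) (at x)" "\<And>v. real_polynomial_function (\<lambda>x. g' x v)"
    by blast
  with mult.hyps show ?case
    by (intro exI[of _ "\<lambda>x v. f x * g' x v + f' x v * g x"] conjI allI has_derivative_mult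
        real_polynomial_function.intros(3,4))
qed

lemma polynomial_has_frechet_derivative:
  assumes "real_polynomial_function q"
  shows "(q has_derivative frechet_derivative q (at x)) (at x)"
proof -
  obtain q' where "\<And>x. (q has_derivative q' x) (at x)"
    using real_polynomial_function_derivative[OF assms] by blast
  then have "q differentiable at x" by (auto simp: differentiable_def)
  then show ?thesis by (simp add: frechet_derivative_works)
qed

lemma polynomial_frechet_derivative:
  assumes "real_polynomial_function q"
  shows "real_polynomial_function (\<lambda>x. frechet_derivative q (at x) v)"
proof -
  obtain q' where q': "\<And>x. (q has_derivative q' x) (at x)" "\<And>v. real_polynomial_function (\<lambda>x. q' x v)"
    using real_polynomial_function_derivative[OF assms] by blast
  have "frechet_derivative q (at x) = q' x" for x
    using frechet_derivative_at[OF q'(1)] by simp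
  then show ?thesis using q'(2) by simp
qed

lemma continuous_on_polynomial:
  assumes "real_polynomial_function q"
  shows "continuous_on S q"
  using polynomial_has_frechet_derivative[OF assms]
  by (meson continuous_at_imp_continuous_on has_derivative_continuous)

lemma inner_grad:
  assumes "u differentiable at x"
  shows "grad u x \<bullet> v = frechet_derivative u (at x) v"
proof -
  have lin: "linear (frechet_derivative u (at x))" using assms by (rule linear_frechet_derivative)
  have "frechet_derivative u (at x) v = frechet_derivative u (at x) (\<Sum>b\<in>Basis. (v \<bullet> b) *\<^sub>R b)"
    by (simp add: euclidean_representation)
  also have "\<dots> = (\<Sum>b\<in>Basis. (v \<bullet> b) * frechet_derivative u (at x) b)"
    using lin by (simp add: linear_sum linear_scale)
  also have "\<dots> = grad u x \<bullet> v"
    by (simp add: grad_def inner_sum_left inner_commute[of v] mult.commute)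
  finally show ?thesis by simp
qed

lemma continuous_on_grad_polynomial:
  assumes "real_polynomial_function q"
  shows "continuous_on S (grad q)"
  unfolding grad_def[abs_def]
  by (intro continuous_intros continuous_on_polynomial polynomial_frechet_derivative assms)

lemma grad_polynomial_has_derivative:
  assumes "real_polynomial_function q"
  shows "(grad q has_derivative
    (\<lambda>v. \<Sum>b\<in>Basis. frechet_derivative (\<lambda>y. frechet_derivative q (at y) b) (at x) v *\<^sub>R b)) (at x)"
  unfolding grad_def[abs_def]
  by (intro has_derivative_sum has_derivative_scaleR_left polynomial_has_frechet_derivative
      polynomial_frechet_derivative assms)

lemma divg_eq: "(f has_derivative f') (at x) \<Longrightarrow> divg f x = (\<Sum>b\<in>Basis. f' b \<bullet> b)"
  using frechet_derivative_at[of f f' x] by (simp add: divg_def)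

lemma laplacian_polynomial:
  assumes "real_polynomial_function q"
  shows "laplacian q x = (\<Sum>b\<in>Basis. frechet_derivative (\<lambda>y. frechet_derivative q (at y) b) (at x) b)"
  unfolding laplacian_def divg_eq[OF grad_polynomial_has_derivative[OF assms]]
  by (simp add: inner_sum_left inner_Basis if_distrib cong: if_cong)

lemma continuous_on_laplacian_polynomial:
  assumes "real_polynomial_function q"
  shows "continuous_on S (laplacian q)"
  unfolding laplacian_polynomial[OF assms, abs_def]
  by (intro continuous_intros continuous_on_polynomial polynomial_frechet_derivative assms)

text \<open>\<open>frechet_derivative\<close> is a choice from the set of derivatives, and that set
  depends only on the germ of the function at the point.\<close>

lemma frechet_derivative_cong_open:
  assumes "open S" "x \<in> S" "\<And>y. y \<in> S \<Longrightarrow> f y = g y"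
  shows "frechet_derivative f (at x) = frechet_derivative g (at x)"
proof -
  have "(f has_derivative D) (at x) \<longleftrightarrow> (g has_derivative D) (at x)" for D
    using assms has_derivative_transform_within_open[of f D x UNIV S g]
      has_derivative_transform_within_open[of g D x UNIV S f] by auto
  then show ?thesis by (simp add: frechet_derivative_def)
qed

lemma grad_cong_open:
  assumes "open S" "x \<in> S" "\<And>y. y \<in> S \<Longrightarrow> f y = g y"
  shows "grad f x = grad g x"
  using frechet_derivative_cong_open[OF assms] by (simp add: grad_def)

lemma laplacian_cong_open:
  assumes "open S" "x \<in> S" "\<And>y. y \<in> S \<Longrightarrow> f y = g y"
  shows "laplacian f x = laplacian g x"
  unfolding laplacian_def divg_def
  using frechet_derivative_cong_open[of S x "grad f" "grad g"] grad_cong_open[OF assms(1) _ assms(3)] assms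
  by simp

lemma solid_polytope_cell:
  fixes K :: "'a::euclidean_space set"
  assumes "is_cell s K"
  shows "solid_polytope K"
proof (cases s)
  case Simplices
  then have K: "int DIM('a) simplex K" using assms by simp
  then have poly: "polytope K" by (rule simplex_imp_polytope)
  have dim: "aff_dim K = int DIM('a)" using K by (rule aff_dim_simplex)
  then have "affine hull K = UNIV" by (simp add: aff_dim_eq_full)
  moreover have "K \<noteq> {}" using dim by auto
  ultimately have "interior K \<noteq> {}"
    using poly rel_interior_interior[of K] rel_interior_eq_empty[of K] by (simp add: polytope_imp_convex)
  then show ?thesis using poly by unfold_locales
next
  case Parallelotopes
  then obtain T c and L :: "'a \<Rightarrow> 'a" where T: "linear L" "inj L" "T = (\<lambda>x. c + L x)" "T ` cbox 0 One = K"
    using assms unfolding is_cell.simps ref_parallelotope_map_def Parallelotopes by blast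
  then have L: "linear L" "inj L" "(\<lambda>x. c + L x) ` cbox 0 One = K" by simp_all
  have K: "K = (+) c ` (L ` cbox 0 One)" using L(3) by (simp add: image_image)
  have "polytope (L ` cbox 0 One)"
    using L(1) by (simp add: polytope_linear_image polytope_interval)
  then have "polytope K"
    unfolding K polytope_translation_eq .
  moreover have "interior K \<noteq> {}"
  proof -
    have "surj L" using L by (simp add: linear_injective_imp_surjective)
    then have "interior (L ` cbox 0 One) = L ` interior (cbox 0 One)"
      using L by (intro interior_bijective_linear_image) (auto simp: bij_def)
    then show ?thesis unfolding K interior_translation by (simp add: box_ne_empty)
  qed
  ultimately show ?thesis by unfold_locales
qed

section \<open>Tensor-product polynomials and the symmetries of the cube\<close>

lemma poly_tensor_linear_combination:
  assumes "finite I" "\<And>i. i \<in> I \<Longrightarrow> f i \<in> poly_tensor p"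
  shows "(\<lambda>x. \<Sum>i\<in>I. k i * f i x) \<in> poly_tensor p"
proof -
  have "\<exists>c. \<forall>i\<in>I. \<forall>x. f i x = (\<Sum>\<alpha> \<in> Basis \<rightarrow>\<^sub>E {..p}. c i \<alpha> * (\<Prod>b\<in>Basis. (x \<bullet> b) ^ \<alpha> b))"
    using assms(2) unfolding poly_tensor_def by (intro bchoice) auto
  then obtain c where c: "\<And>i x. i \<in> I \<Longrightarrow> f i x = (\<Sum>\<alpha> \<in> Basis \<rightarrow>\<^sub>E {..p}. c i \<alpha> * (\<Prod>b\<in>Basis. (x \<bullet> b) ^ \<alpha> b))"
    by blast
  have "(\<Sum>i\<in>I. k i * f i x) = (\<Sum>\<alpha> \<in> Basis \<rightarrow>\<^sub>E {..p}. (\<Sum>i\<in>I. k i * c i \<alpha>) * (\<Prod>b\<in>Basis. (x \<bullet> b) ^ \<alpha> b))" for x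
  proof -
    have "(\<Sum>i\<in>I. k i * f i x) = (\<Sum>i\<in>I. \<Sum>\<alpha> \<in> Basis \<rightarrow>\<^sub>E {..p}. k i * c i \<alpha> * (\<Prod>b\<in>Basis. (x \<bullet> b) ^ \<alpha> b))"
      by (intro sum.cong) (auto simp: c sum_distrib_left mult.assoc)
    also have "\<dots> = (\<Sum>\<alpha> \<in> Basis \<rightarrow>\<^sub>E {..p}. \<Sum>i\<in>I. k i * c i \<alpha> * (\<Prod>b\<in>Basis. (x \<bullet> b) ^ \<alpha> b))"
      by (rule sum.swap)
    finally show ?thesis by (simp add: sum_distrib_right)
  qed
  then show ?thesis
    unfolding poly_tensor_def mem_Collect_eq
    by (intro exI[of _ "\<lambda>\<alpha>. \<Sum>i\<in>I. k i * c i \<alpha>"] allI)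
qed

lemma prod_univariate_in_poly_tensor:
  "(\<lambda>x::'a::euclidean_space. \<Prod>b\<in>Basis. \<Sum>i\<le>p. k b i * (x \<bullet> b) ^ i) \<in> poly_tensor p"
proof -
  have "(\<Prod>b\<in>Basis. \<Sum>i\<le>p. k b i * (x \<bullet> b) ^ i) =
      (\<Sum>\<alpha> \<in> Basis \<rightarrow>\<^sub>E {..p}. (\<Prod>b\<in>Basis. k b (\<alpha> b)) * (\<Prod>b\<in>Basis. (x \<bullet> b) ^ \<alpha> b))" for x :: 'a
    by (simp add: prod_sum_PiE prod.distrib)
  then show ?thesis
    unfolding poly_tensor_def mem_Collect_eq
    by (intro exI[of _ "\<lambda>\<alpha>. \<Prod>b\<in>Basis. k b (\<alpha> b)"] allI)
qed

text \<open>Among the vertices of the cube, one maximises and one minimises coordinate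
  \<open>b\<close> of the image. The difference of the two values is the sum of the moduli of row
  \<open>b\<close>, and both values lie in the unit interval.\<close>

lemma cube_map_row_sum:
  fixes L :: "'a::euclidean_space \<Rightarrow> 'a"
  assumes lin: "linear L" and cube: "\<And>x. x \<in> cbox 0 One \<Longrightarrow> c + L x \<in> cbox 0 One" and b: "b \<in> Basis"
  shows "(\<Sum>j\<in>Basis. \<bar>L j \<bullet> b\<bar>) \<le> 1"
proof -
  define x where "x = (\<Sum>j\<in>Basis. (if 0 < L j \<bullet> b then 1 else 0) *\<^sub>R j)"
  define y where "y = (\<Sum>j\<in>Basis. (if L j \<bullet> b < 0 then 1 else 0) *\<^sub>R j)"
  have cx: "x \<in> cbox 0 One" unfolding mem_box x_def by (simp add: inner_sum_left_Basis)
  have cy: "y \<in> cbox 0 One" unfolding mem_box y_def by (simp add: inner_sum_left_Basis)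
  have "L x \<bullet> b = (\<Sum>j\<in>Basis. (if 0 < L j \<bullet> b then 1 else 0) * (L j \<bullet> b))"
    unfolding x_def using lin by (simp add: linear_sum linear_scale inner_sum_left)
  moreover have "L y \<bullet> b = (\<Sum>j\<in>Basis. (if L j \<bullet> b < 0 then 1 else 0) * (L j \<bullet> b))"
    unfolding y_def using lin by (simp add: linear_sum linear_scale inner_sum_left)
  ultimately have "(c + L x) \<bullet> b - (c + L y) \<bullet> b = (\<Sum>j\<in>Basis. \<bar>L j \<bullet> b\<bar>)"
    by (simp add: inner_add_left flip: sum_subtractf) (intro sum.cong, auto)
  moreover have "(c + L x) \<bullet> b \<le> 1" "0 \<le> (c + L y) \<bullet> b"
    using cube[OF cx] cube[OF cy] b by (auto simp: mem_box)
  ultimately show ?thesis by simp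
qed

text \<open>The matrix of a symmetry of the cube and its inverse both have rows of \<open>\<ell>\<^sup>1\<close>-norm at most \<open>1\<close>;
  their product being the identity forces equality everywhere, so that both are signed permutations.\<close>

lemma cube_symmetry:
  fixes L N :: "'a::euclidean_space \<Rightarrow> 'a"
  assumes L: "linear L" "\<And>x. x \<in> cbox 0 One \<Longrightarrow> c + L x \<in> cbox 0 One"
    and N: "linear N" "\<And>x. x \<in> cbox 0 One \<Longrightarrow> d + N x \<in> cbox 0 One"
    and LN: "\<And>x. L (N x) = x" and NL: "\<And>x. N (L x) = x"
  obtains \<pi> where "bij_betw \<pi> Basis Basis"
    "\<And>b. b \<in> Basis \<Longrightarrow> (\<forall>x. (c + L x) \<bullet> b = x \<bullet> \<pi> b) \<or> (\<forall>x. (c + L x) \<bullet> b = 1 - x \<bullet> \<pi> b)"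
proof -
  have le1: "\<bar>L j \<bullet> b\<bar> \<le> 1" "\<bar>N j \<bullet> b\<bar> \<le> 1" if "j \<in> Basis" "b \<in> Basis" for j b
    using member_le_sum[of j Basis "\<lambda>j. \<bar>L j \<bullet> b\<bar>"] cube_map_row_sum[OF L that(2)]
      member_le_sum[of j Basis "\<lambda>j. \<bar>N j \<bullet> b\<bar>"] cube_map_row_sum[OF N that(2)] that by auto
  have expand: "f y \<bullet> b = (\<Sum>k\<in>Basis. (y \<bullet> k) * (f k \<bullet> b))" if "linear f" for f :: "'a \<Rightarrow> 'a" and y b
  proof -
    have "f y = f (\<Sum>k\<in>Basis. (y \<bullet> k) *\<^sub>R k)" by (simp add: euclidean_representation)
    also have "\<dots> = (\<Sum>k\<in>Basis. (y \<bullet> k) *\<^sub>R f k)" using that by (simp add: linear_sum linear_scale)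
    finally show ?thesis by (simp add: inner_sum_left)
  qed
  \<comment> \<open>The diagonal entry 1 of the product is a sum of products of entries of
    \<open>g\<close>, of modulus at most 1, with a row of \<open>f\<close> whose moduli sum to at
    most 1. So every nonzero entry of that row meets an entry of modulus exactly 1.\<close>
  have tight: "\<bar>g b \<bullet> k\<bar> = 1"
    if f: "linear f" "\<And>j b. j \<in> Basis \<Longrightarrow> b \<in> Basis \<Longrightarrow> \<bar>g j \<bullet> b\<bar> \<le> 1" "(\<Sum>j\<in>Basis. \<bar>f j \<bullet> b\<bar>) \<le> 1" "\<And>x. f (g x) = x"
      and b: "b \<in> Basis" and k: "k \<in> Basis" "f k \<bullet> b \<noteq> 0" for f g :: "'a \<Rightarrow> 'a" and b k
  proof (rule ccontr)
    assume "\<bar>g b \<bullet> k\<bar> \<noteq> 1"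
    then have lt: "\<bar>g b \<bullet> k\<bar> < 1" using f(2)[OF b k(1)] by simp
    have "1 = f (g b) \<bullet> b" using f(4) b by simp
    also have "\<dots> = (\<Sum>j\<in>Basis. (g b \<bullet> j) * (f j \<bullet> b))" by (rule expand[OF f(1)])
    also have "\<dots> \<le> (\<Sum>j\<in>Basis. \<bar>g b \<bullet> j\<bar> * \<bar>f j \<bullet> b\<bar>)"
      by (intro sum_mono) (simp flip: abs_mult)
    also have "\<dots> < (\<Sum>j\<in>Basis. \<bar>f j \<bullet> b\<bar>)"
    proof (rule sum_strict_mono_ex1)
      show "\<forall>j\<in>Basis. \<bar>g b \<bullet> j\<bar> * \<bar>f j \<bullet> b\<bar> \<le> \<bar>f j \<bullet> b\<bar>"
        using f(2)[OF b] by (auto intro!: mult_left_le_one_le)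
      show "\<exists>j\<in>Basis. \<bar>g b \<bullet> j\<bar> * \<bar>f j \<bullet> b\<bar> < \<bar>f j \<bullet> b\<bar>"
        using lt k by (intro bexI[of _ k]) auto
    qed simp
    finally show False using f(3) by simp
  qed
  note tightL = tight[OF L(1) le1(2) cube_map_row_sum[OF L] LN]
  note tightN = tight[OF N(1) le1(1) cube_map_row_sum[OF N] NL]
  have "\<exists>k\<in>Basis. L k \<bullet> b \<noteq> 0" if b: "b \<in> Basis" for b
  proof (rule ccontr)
    assume "\<not> (\<exists>k\<in>Basis. L k \<bullet> b \<noteq> 0)"
    then have "L (N b) \<bullet> b = 0" by (subst expand[OF L(1)]) simp
    then show False using LN b by simp
  qed
  then have "\<exists>\<pi>. \<forall>b\<in>Basis. \<pi> b \<in> Basis \<and> L (\<pi> b) \<bullet> b \<noteq> 0" by (intro bchoice) blast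
  then obtain \<pi> where pi: "\<And>b. b \<in> Basis \<Longrightarrow> \<pi> b \<in> Basis" "\<And>b. b \<in> Basis \<Longrightarrow> L (\<pi> b) \<bullet> b \<noteq> 0" by blast
  have N1: "\<bar>N b \<bullet> \<pi> b\<bar> = 1" if b: "b \<in> Basis" for b
    by (rule tightL) (use b pi in auto)
  have L1: "\<bar>L (\<pi> b) \<bullet> b\<bar> = 1" if b: "b \<in> Basis" for b
  proof (rule tightN)
    show "N b \<bullet> \<pi> b \<noteq> 0" using N1[OF b] by auto
  qed (use b pi in auto)
  have zero: "f k \<bullet> b = 0"
    if "(\<Sum>j\<in>Basis. \<bar>f j \<bullet> b\<bar>) \<le> 1" "j \<in> Basis" "\<bar>f j \<bullet> b\<bar> = 1" "k \<in> Basis" "k \<noteq> j" for f :: "'a \<Rightarrow> 'a" and b j k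
  proof -
    have "(\<Sum>j\<in>{j, k}. \<bar>f j \<bullet> b\<bar>) \<le> (\<Sum>j\<in>Basis. \<bar>f j \<bullet> b\<bar>)"
      using that by (intro sum_mono2) auto
    then show ?thesis using that by simp
  qed
  \<comment> \<open>If \<open>\<pi>\<close> took a value twice, the row of \<open>N\<close> at that
    index would have two entries of modulus 1, above its bound on the sum of moduli.\<close>
  have inj: "inj_on \<pi> Basis"
  proof (rule inj_onI, rule ccontr)
    fix b b' :: 'a assume bb: "b \<in> Basis" "b' \<in> Basis" "\<pi> b = \<pi> b'" "b \<noteq> b'"
    have "N b' \<bullet> \<pi> b = 0"
    proof (rule zero[OF cube_map_row_sum[OF N]])
      show "\<bar>N b \<bullet> \<pi> b\<bar> = 1" using bb(1) by (rule N1)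
    qed (use bb pi in auto)
    then show False using N1[OF bb(2)] bb by simp
  qed
  then have bij: "bij_betw \<pi> Basis Basis"
    using pi(1) by (simp add: bij_betw_def endo_inj_surj image_subset_iff)
  show ?thesis
  proof (rule that[OF bij])
    fix b :: 'a assume b: "b \<in> Basis"
    define l where "l = L (\<pi> b) \<bullet> b"
    have Lx: "L x \<bullet> b = l * (x \<bullet> \<pi> b)" for x
    proof -
      have "L x \<bullet> b = (\<Sum>k\<in>Basis. (x \<bullet> k) * (L k \<bullet> b))" by (rule expand[OF L(1)])
      also have "\<dots> = (\<Sum>k\<in>Basis. if k = \<pi> b then (x \<bullet> k) * (L k \<bullet> b) else 0)"
        using zero[OF cube_map_row_sum[OF L b] pi(1)[OF b] L1[OF b]] by (intro sum.cong) auto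
      also have "\<dots> = l * (x \<bullet> \<pi> b)" using pi(1)[OF b] by (simp add: l_def)
      finally show ?thesis .
    qed
    \<comment> \<open>The images of the opposite corners \<open>0\<close> and \<open>One\<close>
      leave only \<open>c \<bullet> b = 0\<close> with \<open>l = 1\<close>, and
      \<open>c \<bullet> b = 1\<close> with \<open>l = -1\<close>.\<close>
    have c0: "0 \<le> c \<bullet> b" "c \<bullet> b \<le> 1"
      using L(2)[of 0] b linear_0[OF L(1)] by (auto simp: mem_box)
    have c1: "0 \<le> c \<bullet> b + l" "c \<bullet> b + l \<le> 1"
      using L(2)[of One] b Lx[of One] pi(1)[OF b] by (auto simp: mem_box inner_add_left)
    have "l = 1 \<or> l = -1" using L1[OF b] by (auto simp: l_def)
    then show "(\<forall>x. (c + L x) \<bullet> b = x \<bullet> \<pi> b) \<or> (\<forall>x. (c + L x) \<bullet> b = 1 - x \<bullet> \<pi> b)"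
      using c0 c1 by (auto simp: inner_add_left Lx)
  qed
qed

text \<open>A power of t or of 1 - t with exponent at most \<open>p\<close> is a univariate
  polynomial of degree at most \<open>p\<close>, so a monomial becomes a product of univariate
  polynomials in permuted coordinates; reindexing by the inverse permutation restores the standard
  form.\<close>

lemma poly_tensor_cube_symmetry:
  fixes A :: "'a::euclidean_space \<Rightarrow> 'a"
  assumes bij: "bij_betw \<pi> Basis Basis"
    and A: "\<And>b. b \<in> Basis \<Longrightarrow> (\<forall>x. A x \<bullet> b = x \<bullet> \<pi> b) \<or> (\<forall>x. A x \<bullet> b = 1 - x \<bullet> \<pi> b)"
    and f: "f \<in> poly_tensor p"
  shows "f \<circ> A \<in> poly_tensor p"
proof -
  obtain c where c: "\<And>x. f x = (\<Sum>\<alpha> \<in> Basis \<rightarrow>\<^sub>E {..p}. c \<alpha> * (\<Prod>b\<in>Basis. (x \<bullet> b) ^ \<alpha> b))"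
    using f unfolding poly_tensor_def by blast
  have "(\<lambda>x. \<Prod>b\<in>Basis. (A x \<bullet> b) ^ \<alpha> b) \<in> poly_tensor p" if \<alpha>: "\<alpha> \<in> Basis \<rightarrow>\<^sub>E {..p}" for \<alpha>
  proof -
    have "\<exists>k. \<forall>x. (A x \<bullet> b) ^ \<alpha> b = (\<Sum>i\<le>p. k i * (x \<bullet> \<pi> b) ^ i)" if b: "b \<in> Basis" for b
    proof -
      have le: "\<alpha> b \<le> p" using \<alpha> b by (auto dest: PiE_mem)
      show ?thesis using A[OF b]
      proof
        assume eq: "\<forall>x. A x \<bullet> b = x \<bullet> \<pi> b"
        show ?thesis
          by (rule exI[of _ "\<lambda>i. if i = \<alpha> b then 1 else 0"])
            (use le in \<open>simp add: eq if_distrib[of "\<lambda>z. z * _"] cong: if_cong\<close>)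
      next
        assume eq: "\<forall>x. A x \<bullet> b = 1 - x \<bullet> \<pi> b"
        have "(1 - t) ^ \<alpha> b = (\<Sum>i\<le>p. (real (\<alpha> b choose i) * (-1) ^ i) * t ^ i)" for t :: real
        proof -
          have "(1 - t) ^ \<alpha> b = (- t + 1) ^ \<alpha> b" by simp
          also have "\<dots> = (\<Sum>i\<le>\<alpha> b. of_nat (\<alpha> b choose i) * (- t) ^ i * 1 ^ (\<alpha> b - i))"
            by (rule binomial_ring)
          also have "\<dots> = (\<Sum>i\<le>\<alpha> b. (real (\<alpha> b choose i) * (-1) ^ i) * t ^ i)"
            by (intro sum.cong) (auto simp: power_minus[of t])
          also have "\<dots> = (\<Sum>i\<le>p. (real (\<alpha> b choose i) * (-1) ^ i) * t ^ i)"
            using le by (intro sum.mono_neutral_left) (auto simp: binomial_eq_0)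
          finally show ?thesis .
        qed
        then show ?thesis using eq by (intro exI[of _ "\<lambda>i. real (\<alpha> b choose i) * (-1) ^ i"]) simp
      qed
    qed
    then have "\<exists>k. \<forall>b\<in>Basis. \<forall>x. (A x \<bullet> b) ^ \<alpha> b = (\<Sum>i\<le>p. k b i * (x \<bullet> \<pi> b) ^ i)"
      by (intro bchoice) blast
    then obtain k where k: "\<And>b x. b \<in> Basis \<Longrightarrow> (A x \<bullet> b) ^ \<alpha> b = (\<Sum>i\<le>p. k b i * (x \<bullet> \<pi> b) ^ i)" by blast
    define \<rho> where "\<rho> = the_inv_into Basis \<pi>"
    have "(\<Prod>b\<in>Basis. (A x \<bullet> b) ^ \<alpha> b) = (\<Prod>b\<in>Basis. \<Sum>i\<le>p. k (\<rho> b) i * (x \<bullet> b) ^ i)" for x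
    proof -
      have "(\<Prod>b\<in>Basis. (A x \<bullet> b) ^ \<alpha> b) = (\<Prod>b\<in>Basis. \<Sum>i\<le>p. k (\<rho> (\<pi> b)) i * (x \<bullet> \<pi> b) ^ i)"
        using bij by (intro prod.cong) (auto simp: k \<rho>_def the_inv_into_f_f bij_betw_def)
      also have "\<dots> = (\<Prod>b\<in>Basis. \<Sum>i\<le>p. k (\<rho> b) i * (x \<bullet> b) ^ i)"
        by (rule prod.reindex_bij_betw[OF bij])
      finally show ?thesis .
    qed
    then show ?thesis using prod_univariate_in_poly_tensor[where k="\<lambda>b. k (\<rho> b)"] by simp
  qed
  then have "(\<lambda>x. \<Sum>\<alpha> \<in> Basis \<rightarrow>\<^sub>E {..p}. c \<alpha> * (\<Prod>b\<in>Basis. (A x \<bullet> b) ^ \<alpha> b)) \<in> poly_tensor p"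
    by (intro poly_tensor_linear_combination) (auto simp: finite_PiE)
  then show ?thesis by (simp add: c comp_def)
qed

lemma ref_parallelotope_map_inverse:
  fixes K :: "'a::euclidean_space set"
  assumes "ref_parallelotope_map K T"
  obtains L M c where "linear L" "linear M" "\<And>x. L (M x) = x" "\<And>x. M (L x) = x"
    "T = (\<lambda>x. c + L x)" "T ` cbox 0 One = K"
proof -
  obtain c L where L: "linear L" "inj L" "T = (\<lambda>x. c + L x)" "T ` cbox 0 One = K"
    using assms unfolding ref_parallelotope_map_def by blast
  obtain M where M: "linear M" "\<forall>x. M (L x) = x" "\<forall>x. L (M x) = x"
    using linear_injective_isomorphism[OF L(1,2)] by blast
  show ?thesis by (rule that[OF L(1) M(1) _ _ L(3,4)]) (use M in auto)
qed

text \<open>\<open>local_space\<close> quantifies existentially over the reference map, so two of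
  its members may come with different maps. The transition between two maps is a symmetry of the
  cube, so a single map can be fixed for all members.\<close>

lemma ref_parallelotope_map_change:
  fixes K :: "'a::euclidean_space set"
  assumes T: "ref_parallelotope_map K T" and S: "ref_parallelotope_map K S" and f: "f \<circ> T \<in> poly_tensor p"
  shows "f \<circ> S \<in> poly_tensor p"
proof -
  obtain L M c where L: "linear L" "linear M" "\<And>x. L (M x) = x" "\<And>x. M (L x) = x"
    "T = (\<lambda>x. c + L x)" "T ` cbox 0 One = K" using ref_parallelotope_map_inverse[OF T] by blast
  obtain L' M' c' where L': "linear L'" "linear M'" "\<And>x. L' (M' x) = x" "\<And>x. M' (L' x) = x"
    "S = (\<lambda>x. c' + L' x)" "S ` cbox 0 One = K" using ref_parallelotope_map_inverse[OF S] by blast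
  have A: "M (c' - c) + M (L' x) \<in> cbox 0 One" if x: "x \<in> cbox 0 One" for x
  proof -
    have "S x \<in> T ` cbox 0 One" using x L'(6) L(6) by blast
    then obtain y where y: "y \<in> cbox 0 One" "c' + L' x = c + L y" using L(5) L'(5) by auto
    have "c' - c + L' x = L y" using y(2) by (simp add: algebra_simps)
    then have "M (c' - c + L' x) = y" using L(4) by simp
    then show ?thesis using y(1) L(2) by (simp add: linear_add)
  qed
  have B: "M' (c - c') + M' (L x) \<in> cbox 0 One" if x: "x \<in> cbox 0 One" for x
  proof -
    have "T x \<in> S ` cbox 0 One" using x L'(6) L(6) by blast
    then obtain y where y: "y \<in> cbox 0 One" "c + L x = c' + L' y" using L(5) L'(5) by auto
    have "c - c' + L x = L' y" using y(2) by (simp add: algebra_simps)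
    then have "M' (c - c' + L x) = y" using L'(4) by simp
    then show ?thesis using y(1) L'(2) by (simp add: linear_add)
  qed
  have lin: "linear (\<lambda>x. M (L' x))" "linear (\<lambda>x. M' (L x))"
    using linear_compose[OF L'(1) L(2)] linear_compose[OF L(1) L'(2)] by (simp_all add: comp_def)
  obtain \<pi> where pi: "bij_betw \<pi> (Basis :: 'a set) Basis"
    "\<And>b. b \<in> Basis \<Longrightarrow> (\<forall>x. (M (c' - c) + M (L' x)) \<bullet> b = x \<bullet> \<pi> b) \<or> (\<forall>x. (M (c' - c) + M (L' x)) \<bullet> b = 1 - x \<bullet> \<pi> b)"
  proof (rule cube_symmetry[OF lin(1) A lin(2) B])
    show "M (L' (M' (L x))) = x" "M' (L (M (L' x))) = x" for x
      using L(3,4) L'(3,4) by simp_all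
  qed blast+
  have "(f \<circ> T) \<circ> (\<lambda>x. M (c' - c) + M (L' x)) \<in> poly_tensor p"
    by (rule poly_tensor_cube_symmetry[OF pi f])
  moreover have "T (M (c' - c) + M (L' x)) = S x" for x
  proof -
    have "M (c' - c) + M (L' x) = M (c' - c + L' x)" using L(2) by (simp add: linear_add)
    then show ?thesis using L(3,5) L'(5) by simp
  qed
  ultimately show ?thesis by (simp add: comp_def)
qed

section \<open>The local spaces as spans of finitely many polynomials\<close>

lemma polynomial_monomial: "real_polynomial_function (\<lambda>x::'a::euclidean_space. \<Prod>b\<in>Basis. (x \<bullet> b) ^ \<alpha> b)"
  by (intro real_polynomial_function_prod real_polynomial_function_power real_polynomial_function.intros(1)
      bounded_linear_inner_left) simp

text \<open>A common description of both cell shapes: closure under scaling, the zero function and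
  the orthogonal projection are later obtained from it without distinguishing them.\<close>

lemma local_space_span:
  fixes K :: "'a::euclidean_space set"
  assumes "is_cell s K"
  obtains A :: "('a \<Rightarrow> nat) set" and \<phi> where "finite A" "\<And>\<alpha>. \<alpha> \<in> A \<Longrightarrow> real_polynomial_function (\<phi> \<alpha>)"
    "local_space s p K = {f. \<exists>c. \<forall>x. f x = (\<Sum>\<alpha>\<in>A. c \<alpha> * \<phi> \<alpha> x)}"
proof (cases s)
  case Simplices
  show ?thesis
  proof (rule that[of "{\<alpha> \<in> Basis \<rightarrow>\<^sub>E {..p}. sum \<alpha> Basis \<le> p}" "\<lambda>\<alpha> x. \<Prod>b\<in>Basis. (x \<bullet> b) ^ \<alpha> b"])
    show "finite {\<alpha> \<in> Basis \<rightarrow>\<^sub>E {..p}. sum \<alpha> (Basis :: 'a set) \<le> p}"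
      by (rule finite_subset[OF _ finite_PiE[of Basis "\<lambda>_. {..p}"]]) auto
  qed (simp_all add: Simplices poly_total_def polynomial_monomial)
next
  case Parallelotopes
  then obtain T where T: "ref_parallelotope_map K T" using assms is_cell.simps(2) by blast
  obtain L M c where L: "linear L" "linear M" "\<And>x. L (M x) = x" "\<And>x. M (L x) = x"
    "T = (\<lambda>x. c + L x)" "T ` cbox 0 One = K" using ref_parallelotope_map_inverse[OF T] by blast
  define S where "S x = M (x - c)" for x
  have TS: "T (S x) = x" "S (T x) = x" for x using L by (simp_all add: S_def)
  have "real_polynomial_function (\<lambda>x. \<Prod>b\<in>Basis. (S x \<bullet> b) ^ \<alpha> b)" for \<alpha>
  proof (intro real_polynomial_function_prod real_polynomial_function_power)
    fix b :: 'a
    have "bounded_linear (\<lambda>x. M x \<bullet> b)"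
      using L(2) by (intro bounded_linear_inner_left_comp) (simp add: linear_conv_bounded_linear)
    then have "real_polynomial_function (\<lambda>x. M x \<bullet> b - M c \<bullet> b)"
      by (intro real_polynomial_function_diff real_polynomial_function.intros(1) real_polynomial_function.intros(2))
    then show "real_polynomial_function (\<lambda>x. S x \<bullet> b)"
      using L(2) by (simp add: S_def linear_diff inner_diff_left)
  qed simp
  moreover have "local_space s p K = {f. f \<circ> T \<in> poly_tensor p}"
    using T ref_parallelotope_map_change[OF _ T] unfolding Parallelotopes local_space.simps by blast
  moreover have "f \<circ> T \<in> poly_tensor p \<longleftrightarrow>
      (\<exists>c. \<forall>x. f x = (\<Sum>\<alpha> \<in> Basis \<rightarrow>\<^sub>E {..p}. c \<alpha> * (\<Prod>b\<in>Basis. (S x \<bullet> b) ^ \<alpha> b)))"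
    (is "?l = ?r") for f
  proof
    assume ?l
    then obtain c where "\<And>y. f (T y) = (\<Sum>\<alpha> \<in> Basis \<rightarrow>\<^sub>E {..p}. c \<alpha> * (\<Prod>b\<in>Basis. (y \<bullet> b) ^ \<alpha> b))"
      unfolding poly_tensor_def mem_Collect_eq comp_def by blast
    from this[of "S _"] show ?r unfolding TS(1) by blast
  next
    assume ?r
    then obtain c where "\<And>x. f x = (\<Sum>\<alpha> \<in> Basis \<rightarrow>\<^sub>E {..p}. c \<alpha> * (\<Prod>b\<in>Basis. (S x \<bullet> b) ^ \<alpha> b))"
      by blast
    from this[of "T _"] show ?l unfolding TS(2) poly_tensor_def mem_Collect_eq comp_def by blast
  qed
  ultimately show ?thesis
    by (intro that[of "Basis \<rightarrow>\<^sub>E {..p}" "\<lambda>\<alpha> x. \<Prod>b\<in>Basis. (S x \<bullet> b) ^ \<alpha> b"]) (simp_all add: finite_PiE)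
qed

lemma polynomial_local_space:
  assumes "is_cell s K" "q \<in> local_space s p K"
  shows "real_polynomial_function q"
proof -
  obtain A :: "('a \<Rightarrow> nat) set" and \<phi> where A: "finite A" "\<And>\<alpha>. \<alpha> \<in> A \<Longrightarrow> real_polynomial_function (\<phi> \<alpha>)"
    "local_space s p K = {f. \<exists>c. \<forall>x. f x = (\<Sum>\<alpha>\<in>A. c \<alpha> * \<phi> \<alpha> x)}"
    using local_space_span[OF assms(1)] by blast
  obtain c where c: "\<forall>x. q x = (\<Sum>\<alpha>\<in>A. c \<alpha> * \<phi> \<alpha> x)" using assms(2) A(3) by auto
  have "real_polynomial_function (\<lambda>x. \<Sum>\<alpha>\<in>A. c \<alpha> * \<phi> \<alpha> x)"
    by (intro real_polynomial_function_sum real_polynomial_function.intros(4) real_polynomial_function.intros(2) A)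
  moreover have "q = (\<lambda>x. \<Sum>\<alpha>\<in>A. c \<alpha> * \<phi> \<alpha> x)" using c by auto
  ultimately show ?thesis by simp
qed

lemma local_space_scale:
  assumes "is_cell s K" "q \<in> local_space s p K"
  shows "(\<lambda>x. k * q x) \<in> local_space s p K"
proof -
  obtain A :: "('a \<Rightarrow> nat) set" and \<phi> where A: "finite A" "\<And>\<alpha>. \<alpha> \<in> A \<Longrightarrow> real_polynomial_function (\<phi> \<alpha>)"
    "local_space s p K = {f. \<exists>c. \<forall>x. f x = (\<Sum>\<alpha>\<in>A. c \<alpha> * \<phi> \<alpha> x)}"
    using local_space_span[OF assms(1)] by blast
  obtain c where c: "\<forall>x. q x = (\<Sum>\<alpha>\<in>A. c \<alpha> * \<phi> \<alpha> x)" using assms(2) A(3) by auto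
  then have "\<forall>x. k * q x = (\<Sum>\<alpha>\<in>A. (k * c \<alpha>) * \<phi> \<alpha> x)"
    by (simp add: sum_distrib_left mult.assoc)
  then show ?thesis unfolding A(3) mem_Collect_eq by (rule exI[of _ "\<lambda>\<alpha>. k * c \<alpha>"])
qed

lemma zero_local_space: 
  assumes "is_cell s K"
  shows "(\<lambda>x. 0) \<in> local_space s p K"
proof -
  obtain A :: "('a \<Rightarrow> nat) set" and \<phi> where A: "finite A" "\<And>\<alpha>. \<alpha> \<in> A \<Longrightarrow> real_polynomial_function (\<phi> \<alpha>)"
    "local_space s p K = {f. \<exists>c. \<forall>x. f x = (\<Sum>\<alpha>\<in>A. c \<alpha> * \<phi> \<alpha> x)}"
    using local_space_span[OF assms(1)] by blast
  show ?thesis unfolding A(3) mem_Collect_eq by (rule exI[of _ "\<lambda>\<alpha>. 0"]) simp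
qed

section \<open>Projections, surface integrals and the divergence theorem on a cell\<close>

text \<open>Discrete functions agree with polynomials only inside a cell, so expressions built from
  them need not be continuous on the closed cell. Boundedness and continuity on the open cell
  survive, and they suffice for integrability.\<close>

definition bcont :: "'a::euclidean_space set \<Rightarrow> ('a \<Rightarrow> real) \<Rightarrow> bool" where
  "bcont S f \<longleftrightarrow> continuous_on S f \<and> (\<exists>M. \<forall>x\<in>S. \<bar>f x\<bar> \<le> M)"

lemma bcont_const [intro]: "bcont S (\<lambda>x. c)"
  unfolding bcont_def by auto

lemma bcont_add [intro]:
  assumes "bcont S f" "bcont S g"
  shows "bcont S (\<lambda>x. f x + g x)"
proof -
  obtain M N where "\<forall>x\<in>S. \<bar>f x\<bar> \<le> M" "\<forall>x\<in>S. \<bar>g x\<bar> \<le> N" using assms by (auto simp: bcont_def)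
  then have "\<forall>x\<in>S. \<bar>f x + g x\<bar> \<le> M + N" by (meson abs_triangle_ineq add_mono order_trans)
  then show ?thesis using assms by (auto simp: bcont_def intro!: continuous_intros)
qed

lemma bcont_mult [intro]:
  assumes "bcont S f" "bcont S g"
  shows "bcont S (\<lambda>x. f x * g x)"
proof -
  obtain M N where MN: "\<forall>x\<in>S. \<bar>f x\<bar> \<le> M" "\<forall>x\<in>S. \<bar>g x\<bar> \<le> N" using assms by (auto simp: bcont_def)
  have "\<forall>x\<in>S. \<bar>f x * g x\<bar> \<le> M * N"
    unfolding abs_mult
  proof (intro ballI mult_mono)
    fix x assume "x \<in> S"
    then show "\<bar>f x\<bar> \<le> M" "\<bar>g x\<bar> \<le> N" using MN by auto
    then show "0 \<le> M" by linarith
  qed auto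
  then show ?thesis using assms by (auto simp: bcont_def intro!: continuous_intros)
qed

lemma bcont_uminus [intro]: "bcont S f \<Longrightarrow> bcont S (\<lambda>x. - f x)"
  using bcont_mult[OF bcont_const[of S "-1"], of f] by simp

lemma bcont_diff [intro]: "bcont S f \<Longrightarrow> bcont S g \<Longrightarrow> bcont S (\<lambda>x. f x - g x)"
  using bcont_add[of S f "\<lambda>x. - g x"] bcont_uminus[of S g] by simp

lemma bcont_power [intro]: "bcont S f \<Longrightarrow> bcont S (\<lambda>x. f x ^ n)"
  by (induction n) auto

lemma bcont_sum [intro]: "(\<And>i. i \<in> I \<Longrightarrow> bcont S (f i)) \<Longrightarrow> bcont S (\<lambda>x. \<Sum>i\<in>I. f i x)"
  by (induction I rule: infinite_finite_induct) auto

lemma bcont_cong: "(\<And>x. x \<in> S \<Longrightarrow> f x = g x) \<Longrightarrow> bcont S f \<longleftrightarrow> bcont S g"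
  unfolding bcont_def by (simp cong: continuous_on_cong)

lemma bcont_compact:
  assumes "compact K" "S \<subseteq> K" "continuous_on K f"
  shows "bcont S f"
proof -
  have "bounded (f ` K)" using assms by (intro compact_imp_bounded compact_continuous_image)
  then obtain M where M: "\<And>x. x \<in> K \<Longrightarrow> \<bar>f x\<bar> \<le> M"
    unfolding bounded_iff by force
  then show ?thesis using assms continuous_on_subset by (auto simp: bcont_def)
qed

lemma bcont_integrable:
  assumes "open S" "bounded S" "bcont S f"
  shows "set_integrable lebesgue S f"
proof -
  obtain M where "\<And>x. x \<in> S \<Longrightarrow> \<bar>f x\<bar> \<le> M" using assms(3) by (auto simp: bcont_def)
  then show ?thesis
    using assms by (intro set_integrable_bounded_continuous[of S f M]) (auto simp: bcont_def)
qed

lemma set_integral_nonneg_real: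
  fixes f :: "'a \<Rightarrow> real"
  assumes "\<And>x. x \<in> A \<Longrightarrow> 0 \<le> f x"
  shows "0 \<le> (LINT x:A|M. f x)"
  unfolding set_lebesgue_integral_def
  by (rule Bochner_Integration.integral_nonneg) (use assms in \<open>simp add: indicator_def\<close>)

lemma set_integral_cong_on:
  fixes f g :: "'a \<Rightarrow> real"
  assumes "\<And>x. x \<in> A \<Longrightarrow> f x = g x"
  shows "(LINT x:A|M. f x) = (LINT x:A|M. g x)"
  unfolding set_lebesgue_integral_def
  by (rule Bochner_Integration.integral_cong) (use assms in \<open>auto simp: indicator_def\<close>)

lemma square_integral_0_AE:
  assumes S: "open S" "bounded S" and r: "bcont S r" and 0: "(LINT x:S|lebesgue. (r x)\<^sup>2) = 0"
  shows "AE x in lebesgue. x \<in> S \<longrightarrow> r x = 0"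
proof -
  have "set_integrable lebesgue S (\<lambda>x. (r x)\<^sup>2)" using S r by (intro bcont_integrable) auto
  then have "AE x in lebesgue. indicator S x *\<^sub>R (r x)\<^sup>2 = 0"
    using 0 unfolding set_integrable_def set_lebesgue_integral_def
    by (subst (asm) integral_nonneg_eq_0_iff_AE) auto
  then show ?thesis by eventually_elim (auto simp: indicator_def)
qed

text \<open>Gram-Schmidt by induction on the spanning family, which may be linearly dependent. With
  \<open>u\<close> and \<open>r\<close> the residuals of \<open>f\<close> and of the new function
  after projection onto the old ones, the component of \<open>u\<close> along \<open>r\<close> is
  removed.\<close>

lemma orthogonal_projection_exists:
  fixes \<phi> :: "'i \<Rightarrow> 'a::euclidean_space \<Rightarrow> real"
  assumes S: "open S" "bounded S" and A: "finite A" "\<And>i. i \<in> A \<Longrightarrow> bcont S (\<phi> i)" and f: "bcont S f"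
  shows "\<exists>c. \<forall>i\<in>A. (LINT x:S|lebesgue. (f x - (\<Sum>j\<in>A. c j * \<phi> j x)) * \<phi> i x) = 0"
  using A f
proof (induction A arbitrary: f)
  case empty
  then show ?case by simp
next
  case (insert a A)
  note int = bcont_integrable[OF S]
  have bA: "bcont S (\<phi> i)" if "i \<in> insert a A" for i using insert.prems that by blast
  obtain c where c: "\<forall>i\<in>A. (LINT x:S|lebesgue. (f x - (\<Sum>j\<in>A. c j * \<phi> j x)) * \<phi> i x) = 0"
    using insert.IH[of f] insert.prems by blast
  obtain d where d: "\<forall>i\<in>A. (LINT x:S|lebesgue. (\<phi> a x - (\<Sum>j\<in>A. d j * \<phi> j x)) * \<phi> i x) = 0"
    using insert.IH[of "\<phi> a"] insert.prems by blast
  define u where "u x = f x - (\<Sum>j\<in>A. c j * \<phi> j x)" for x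
  define r where "r x = \<phi> a x - (\<Sum>j\<in>A. d j * \<phi> j x)" for x
  have bu: "bcont S u" unfolding u_def using bA insert.prems by (intro bcont_diff bcont_sum bcont_mult bcont_const) auto
  have br: "bcont S r" unfolding r_def using bA by (intro bcont_diff bcont_sum bcont_mult bcont_const) auto
  \<comment> \<open>If \<open>r\<close> vanishes almost everywhere, the division by 0 gives
    \<open>l = 0\<close>; then the integral of \<open>u x * r x\<close> is 0 too, and orthogonality
    persists.\<close>
  define l where "l = (LINT x:S|lebesgue. u x * r x) / (LINT x:S|lebesgue. (r x)\<^sup>2)"
  define c' where "c' j = (if j = a then l else c j - l * d j)" for j
  have res: "f x - (\<Sum>j\<in>insert a A. c' j * \<phi> j x) = u x - l * r x" for x
  proof -
    have "(\<Sum>j\<in>A. c' j * \<phi> j x) = (\<Sum>j\<in>A. c j * \<phi> j x) - l * (\<Sum>j\<in>A. d j * \<phi> j x)"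
      unfolding sum_distrib_left sum_subtractf[symmetric] using insert.hyps
      by (intro sum.cong) (auto simp: c'_def algebra_simps)
    then show ?thesis using insert.hyps by (simp add: c'_def u_def r_def algebra_simps)
  qed
  have split: "(LINT x:S|lebesgue. (u x - l * r x) * g x) =
      (LINT x:S|lebesgue. u x * g x) - l * (LINT x:S|lebesgue. r x * g x)" if g: "bcont S g" for g
  proof -
    have "(LINT x:S|lebesgue. (u x - l * r x) * g x) = (LINT x:S|lebesgue. u x * g x - l * (r x * g x))"
      by (simp add: algebra_simps)
    also have "\<dots> = (LINT x:S|lebesgue. u x * g x) - (LINT x:S|lebesgue. l * (r x * g x))"
      by (intro set_integral_diff int bcont_mult bcont_const bu br g)
    finally show ?thesis by simp
  qed
  have orthA: "(LINT x:S|lebesgue. (u x - l * r x) * \<phi> i x) = 0" if "i \<in> A" for i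
    using split[of "\<phi> i"] bA[of i] c d that by (simp add: u_def r_def)
  have orthr: "(LINT x:S|lebesgue. (u x - l * r x) * r x) = 0"
  proof (cases "(LINT x:S|lebesgue. (r x)\<^sup>2) = 0")
    case True
    have "AE x in lebesgue. indicator S x *\<^sub>R (u x * r x) = 0"
      using square_integral_0_AE[OF S br True] by eventually_elim (auto simp: indicator_def)
    then have "(LINT x:S|lebesgue. u x * r x) = 0"
      unfolding set_lebesgue_integral_def by (rule integral_eq_zero_AE)
    then show ?thesis using split[OF br] True by (simp add: power2_eq_square)
  next
    case False
    then show ?thesis using split[OF br] by (simp add: l_def power2_eq_square)
  qed
  have "(LINT x:S|lebesgue. (u x - l * r x) * \<phi> a x) = 0"
  proof -
    have "(LINT x:S|lebesgue. (u x - l * r x) * \<phi> a x) =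
      (LINT x:S|lebesgue. (u x - l * r x) * r x + (\<Sum>j\<in>A. d j * ((u x - l * r x) * \<phi> j x)))"
    proof (rule set_integral_cong_on)
      fix x
      have "\<phi> a x = r x + (\<Sum>j\<in>A. d j * \<phi> j x)" by (simp add: r_def)
      then have "(u x - l * r x) * \<phi> a x = (u x - l * r x) * r x + (u x - l * r x) * (\<Sum>j\<in>A. d j * \<phi> j x)"
        by (simp only: distrib_left)
      then show "(u x - l * r x) * \<phi> a x = (u x - l * r x) * r x + (\<Sum>j\<in>A. d j * ((u x - l * r x) * \<phi> j x))"
        by (simp only: sum_distrib_left mult.left_commute)
    qed
    also have "\<dots> = (LINT x:S|lebesgue. (u x - l * r x) * r x) + (LINT x:S|lebesgue. (\<Sum>j\<in>A. d j * ((u x - l * r x) * \<phi> j x)))"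
      using bA by (intro set_integral_add int bcont_sum bcont_mult bcont_const bcont_diff bu br) auto
    also have "(LINT x:S|lebesgue. (\<Sum>j\<in>A. d j * ((u x - l * r x) * \<phi> j x))) =
       (\<Sum>j\<in>A. (LINT x:S|lebesgue. d j * ((u x - l * r x) * \<phi> j x)))"
    proof -
      have "integrable lebesgue (\<lambda>x. indicator S x *\<^sub>R (d j * ((u x - l * r x) * \<phi> j x)))" if "j \<in> A" for j
        using bA that unfolding set_integrable_def[symmetric]
        by (intro int bcont_mult bcont_const bcont_diff bu br) auto
      then show ?thesis
        unfolding set_lebesgue_integral_def scaleR_sum_right by (rule Bochner_Integration.integral_sum)
    qed
    finally show ?thesis using orthr orthA by simp
  qed
  then have "\<forall>i\<in>insert a A. (LINT x:S|lebesgue. (f x - (\<Sum>j\<in>insert a A. c' j * \<phi> j x)) * \<phi> i x) = 0"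
    unfolding res using orthA by blast
  then show ?case by blast
qed

text \<open>\<open>L2_proj\<close> is a Hilbert choice, so its properties wait for an existence
  proof. Orthogonality to the spanning functions extends to the whole space by linearity.\<close>

lemma L2_proj_props:
  fixes K :: "'a::euclidean_space set" and p :: nat
  assumes cell: "is_cell s K" and f: "bcont (interior K) f"
  defines "g \<equiv> L2_proj s p K f"
  shows "g \<in> local_space s p K"
    "w \<in> local_space s p K \<Longrightarrow> (LINT x:interior K|lebesgue. (f x - g x) * w x) = 0"
proof -
  interpret solid_polytope K using cell by (rule solid_polytope_cell)
  have S: "open (interior K)" "bounded (interior K)"
    using compact_imp_bounded[OF compact] interior_subset by (auto intro: bounded_subset)
  obtain A :: "('a \<Rightarrow> nat) set" and \<phi> where A: "finite A" "\<And>\<alpha>. \<alpha> \<in> A \<Longrightarrow> real_polynomial_function (\<phi> \<alpha>)"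
    "local_space s p K = {f. \<exists>c. \<forall>x. f x = (\<Sum>\<alpha>\<in>A. c \<alpha> * \<phi> \<alpha> x)}"
    using local_space_span[OF cell] by blast
  have b: "bcont (interior K) (\<phi> i)" if "i \<in> A" for i
    by (rule bcont_compact[OF compact interior_subset continuous_on_polynomial[OF A(2)[OF that]]])
  obtain c where c: "\<forall>i\<in>A. (LINT x:interior K|lebesgue. (f x - (\<Sum>j\<in>A. c j * \<phi> j x)) * \<phi> i x) = 0"
    using orthogonal_projection_exists[where \<phi>=\<phi>, OF S A(1) b f] by blast
  define h where "h x = (\<Sum>j\<in>A. c j * \<phi> j x)" for x
  have bh: "bcont (interior K) h" unfolding h_def using b by (intro bcont_sum bcont_mult bcont_const) auto
  have "h \<in> local_space s p K" unfolding A(3) mem_Collect_eq h_def by blast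
  moreover have "(LINT x:interior K|lebesgue. (f x - h x) * w x) = 0" if w: "w \<in> local_space s p K" for w
  proof -
    obtain d where d: "\<forall>x. w x = (\<Sum>j\<in>A. d j * \<phi> j x)" using w unfolding A(3) mem_Collect_eq by blast
    have "(LINT x:interior K|lebesgue. (f x - h x) * w x) =
        (LINT x:interior K|lebesgue. (\<Sum>j\<in>A. d j * ((f x - h x) * \<phi> j x)))"
      by (simp add: d sum_distrib_left algebra_simps)
    also have "\<dots> = (\<Sum>j\<in>A. (LINT x:interior K|lebesgue. d j * ((f x - h x) * \<phi> j x)))"
    proof -
      have "integrable lebesgue (\<lambda>x. indicator (interior K) x *\<^sub>R (d j * ((f x - h x) * \<phi> j x)))" if "j \<in> A" for j
        using b that unfolding set_integrable_def[symmetric]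
        by (intro bcont_integrable[OF S] bcont_mult bcont_const bcont_diff bh f) auto
      then show ?thesis
        unfolding set_lebesgue_integral_def scaleR_sum_right by (rule Bochner_Integration.integral_sum)
    qed
    also have "\<dots> = 0" using c by (simp add: h_def)
    finally show ?thesis .
  qed
  ultimately have "\<exists>g. g \<in> local_space s p K \<and> (\<forall>w\<in>local_space s p K. (LINT x:interior K|lebesgue. (f x - g x) * w x) = 0)"
    by blast
  from someI_ex[OF this] have "g \<in> local_space s p K \<and> (\<forall>w\<in>local_space s p K. (LINT x:interior K|lebesgue. (f x - g x) * w x) = 0)"
    unfolding g_def L2_proj_def .
  then show "g \<in> local_space s p K"
    "w \<in> local_space s p K \<Longrightarrow> (LINT x:interior K|lebesgue. (f x - g x) * w x) = 0" by blast+
qed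

section \<open>Calculus of surface integrals and the divergence theorem on a polytope\<close>

lemma facet_integral_prism:
  "facet_integral F n g = (LINT x:facet_prism F n|lebesgue. g (closest_point F x))"
  by (simp add: facet_integral_def facet_prism_def)

context solid_polytope
begin

lemma open_bounded_interior: "open (interior K)" "bounded (interior K)"
  using compact_imp_bounded[OF compact] interior_subset by (auto intro: bounded_subset)

lemma integrable_interior: "bcont (interior K) f \<Longrightarrow> set_integrable lebesgue (interior K) f"
  by (rule bcont_integrable[OF open_bounded_interior])

lemma bcont_interior: "continuous_on K f \<Longrightarrow> bcont (interior K) f"
  by (rule bcont_compact[OF compact interior_subset])

text \<open>Continuity is demanded facet by facet, because the normal in the first argument jumps
  across edges.\<close>

definition bdcont :: "('a \<Rightarrow> 'a \<Rightarrow> real) \<Rightarrow> bool" where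
  "bdcont g \<longleftrightarrow> (\<forall>F\<in>facets. continuous_on F (g (nrm F)))"

lemma closest_point_facet_mem: "F \<in> facets \<Longrightarrow> closest_point F x \<in> F"
  using compact_facet facet_nonempty by (auto intro!: closest_point_in_set simp: compact_imp_closed)

lemma bd_integral_cong:
  assumes "\<And>F x. F \<in> facets \<Longrightarrow> x \<in> F \<Longrightarrow> g (nrm F) x = h (nrm F) x"
  shows "bd_integral K g = bd_integral K h"
  unfolding bd_integral_def facet_integral_prism
  by (intro sum.cong refl set_integral_cong_on assms closest_point_facet_mem)

lemma bd_integral_add:
  assumes "bdcont g" "bdcont h"
  shows "bd_integral K (\<lambda>n x. g n x + h n x) = bd_integral K g + bd_integral K h"
  unfolding bd_integral_def facet_integral_prism sum.distrib[symmetric]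
proof (rule sum.cong[OF refl])
  fix F assume F: "F \<in> facets"
  show "(LINT x:facet_prism F (nrm F)|lebesgue. g (nrm F) (closest_point F x) + h (nrm F) (closest_point F x)) =
    (LINT x:facet_prism F (nrm F)|lebesgue. g (nrm F) (closest_point F x)) +
    (LINT x:facet_prism F (nrm F)|lebesgue. h (nrm F) (closest_point F x))"
    using assms F unfolding bdcont_def by (intro set_integral_add integrable_prism) auto
qed

lemma bd_integral_cmult: "bd_integral K (\<lambda>n x. c * g n x) = c * bd_integral K g"
  unfolding bd_integral_def facet_integral_prism by (simp add: sum_distrib_left)

lemma bd_integral_uminus: "bd_integral K (\<lambda>n x. - g n x) = - bd_integral K g"
  using bd_integral_cmult[of "-1" g] by simp

lemma bdcont_uminus: "bdcont g \<Longrightarrow> bdcont (\<lambda>n x. - g n x)"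
  unfolding bdcont_def by (auto intro: continuous_intros)

lemma bd_integral_diff:
  assumes "bdcont g" "bdcont h"
  shows "bd_integral K (\<lambda>n x. g n x - h n x) = bd_integral K g - bd_integral K h"
  using bd_integral_add[OF assms(1) bdcont_uminus[OF assms(2)]] by (simp add: bd_integral_uminus)

lemma bd_integral_mono:
  assumes "bdcont g" "bdcont h" "\<And>F x. F \<in> facets \<Longrightarrow> x \<in> F \<Longrightarrow> g (nrm F) x \<le> h (nrm F) x"
  shows "bd_integral K g \<le> bd_integral K h"
  unfolding bd_integral_def facet_integral_prism
proof (rule sum_mono)
  fix F assume F: "F \<in> facets"
  show "(LINT x:facet_prism F (nrm F)|lebesgue. g (nrm F) (closest_point F x))
    \<le> (LINT x:facet_prism F (nrm F)|lebesgue. h (nrm F) (closest_point F x))"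
    using assms(1,2) F unfolding bdcont_def
    by (intro set_integral_mono integrable_prism assms(3) closest_point_facet_mem) auto
qed

lemma bd_integral_nonneg:
  assumes "\<And>F x. F \<in> facets \<Longrightarrow> x \<in> F \<Longrightarrow> 0 \<le> g (nrm F) x"
  shows "0 \<le> bd_integral K g"
  unfolding bd_integral_def facet_integral_prism
  by (intro sum_nonneg set_integral_nonneg_real assms closest_point_facet_mem)

text \<open>\<open>directional_divergence\<close> in each coordinate direction; after exchanging the
  sums, the coordinates recombine on every facet to the inner product with its constant
  normal.\<close>

lemma divergence:
  assumes G: "continuous_on K G" and der: "\<And>x. x \<in> interior K \<Longrightarrow> (G has_derivative G' x) (at x)"
    and b: "\<And>b. b \<in> Basis \<Longrightarrow> bcont (interior K) (\<lambda>x. G' x b \<bullet> b)"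
  shows "(LINT x:interior K|lebesgue. \<Sum>b\<in>Basis. G' x b \<bullet> b) = bd_integral K (\<lambda>n x. G x \<bullet> n)"
proof -
  have "(LINT x:interior K|lebesgue. \<Sum>b\<in>Basis. G' x b \<bullet> b) = (\<Sum>b\<in>Basis. LINT x:interior K|lebesgue. G' x b \<bullet> b)"
  proof -
    have "integrable lebesgue (\<lambda>x. indicator (interior K) x *\<^sub>R (G' x b \<bullet> b))" if "b \<in> Basis" for b
      using integrable_interior[OF b[OF that]] unfolding set_integrable_def .
    then show ?thesis
      unfolding set_lebesgue_integral_def scaleR_sum_right by (rule Bochner_Integration.integral_sum)
  qed
  also have "\<dots> = (\<Sum>b\<in>Basis. \<Sum>F\<in>facets. (nrm F \<bullet> b) * facet_integral F (nrm F) (\<lambda>x. G x \<bullet> b))"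
  proof (rule sum.cong[OF refl])
    fix e :: 'a assume e: "e \<in> Basis"
    obtain M where M: "\<And>x. x \<in> interior K \<Longrightarrow> \<bar>G' x e \<bullet> e\<bar> \<le> M" using b[OF e] by (auto simp: bcont_def)
    show "(LINT x:interior K|lebesgue. G' x e \<bullet> e) = (\<Sum>F\<in>facets. (nrm F \<bullet> e) * facet_integral F (nrm F) (\<lambda>x. G x \<bullet> e))"
    proof (rule directional_divergence[where w'="\<lambda>x v. G' x v \<bullet> e", OF _ _ _ M])
      show "continuous_on K (\<lambda>x. G x \<bullet> e)" by (intro continuous_intros G)
      show "((\<lambda>x. G x \<bullet> e) has_derivative (\<lambda>v. G' x v \<bullet> e)) (at x)" if "x \<in> interior K" for x
        by (intro has_derivative_inner_left der that)
      show "continuous_on (interior K) (\<lambda>x. G' x e \<bullet> e)" using b[OF e] by (simp add: bcont_def)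
    qed
  qed
  also have "\<dots> = (\<Sum>F\<in>facets. \<Sum>b\<in>Basis. (nrm F \<bullet> b) * facet_integral F (nrm F) (\<lambda>x. G x \<bullet> b))"
    by (rule sum.swap)
  also have "\<dots> = bd_integral K (\<lambda>n x. G x \<bullet> n)"
    unfolding bd_integral_def
  proof (rule sum.cong[OF refl])
    fix F assume F: "F \<in> facets"
    have GF: "continuous_on F G" using G facet_subset[OF F] by (rule continuous_on_subset)
    have "facet_integral F (nrm F) (\<lambda>x. G x \<bullet> nrm F) =
      (LINT x:facet_prism F (nrm F)|lebesgue. \<Sum>b\<in>Basis. (nrm F \<bullet> b) * (G (closest_point F x) \<bullet> b))"
      unfolding facet_integral_prism
      by (intro set_integral_cong_on) (subst euclidean_inner, simp add: mult.commute)
    also have "\<dots> = (\<Sum>b\<in>Basis. LINT x:facet_prism F (nrm F)|lebesgue. (nrm F \<bullet> b) * (G (closest_point F x) \<bullet> b))"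
    proof -
      have "integrable lebesgue (\<lambda>x. indicator (facet_prism F (nrm F)) x *\<^sub>R ((nrm F \<bullet> b) * (G (closest_point F x) \<bullet> b)))" for b
      proof -
        have "continuous_on F (\<lambda>x. (nrm F \<bullet> b) * (G x \<bullet> b))" by (intro continuous_intros GF)
        from integrable_prism[OF F this, of "nrm F"] show ?thesis unfolding set_integrable_def .
      qed
      then show ?thesis
        unfolding set_lebesgue_integral_def scaleR_sum_right by (rule Bochner_Integration.integral_sum)
    qed
    finally show "(\<Sum>b\<in>Basis. (nrm F \<bullet> b) * facet_integral F (nrm F) (\<lambda>x. G x \<bullet> b)) =
       facet_integral F (nrm F) (\<lambda>x. G x \<bullet> nrm F)"
      by (simp add: facet_integral_prism)
  qed
  finally show ?thesis .
qed

text \<open>Every point of \<open>K\<close> is a limit of interior points, so the limit defining the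
  trace is unique and equals the value of the continuous extension.\<close>

lemma trace_from_eq:
  assumes q: "continuous_on K q" and eq: "\<And>y. y \<in> interior K \<Longrightarrow> f y = q y" and x: "x \<in> K"
  shows "trace_from K f x = q x"
  unfolding trace_from_def
proof (rule tendsto_Lim)
  have "x \<in> closure (interior K)"
    using convex_closure_interior[OF convex interior_nonempty] x closed by simp
  moreover have "x islimpt interior K" if "x \<in> interior K"
    using that interior_limit_point by (metis interior_interior islimpt_subset subset_refl)
  ultimately have "x islimpt interior K"
    unfolding closure_def by blast
  then show "at x within interior K \<noteq> bot" by (simp add: trivial_limit_within)
  have "(q \<longlongrightarrow> q x) (at x within K)" using q x by (simp add: continuous_on_def)
  then have "(q \<longlongrightarrow> q x) (at x within interior K)"
    by (rule tendsto_within_subset[OF _ interior_subset])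
  moreover have "\<forall>\<^sub>F y in at x within interior K. q y = f y"
    using eq by (simp add: eventually_at_filter)
  ultimately show "(f \<longlongrightarrow> q x) (at x within interior K)"
    by (rule Lim_transform_eventually)
qed

end

text \<open>Regularity shared by the three fields to which the divergence theorem is applied: the
  velocity, gradients of polynomials (Green's formula) and the identity (definiteness). The map
  \<open>a'\<close> is the derivative inside, continued to the closure.\<close>

definition C1_closure :: "'a::euclidean_space set \<Rightarrow> ('a \<Rightarrow> 'a) \<Rightarrow> ('a \<Rightarrow> 'a \<Rightarrow> 'a) \<Rightarrow> bool" where
  "C1_closure S a a' \<longleftrightarrow> continuous_on (closure S) a \<and> (\<forall>x\<in>S. (a has_derivative a' x) (at x)) \<and>
     (\<forall>v. continuous_on (closure S) (\<lambda>x. a' x v))"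

lemma C1_closure_subset: "C1_closure T a a' \<Longrightarrow> S \<subseteq> T \<Longrightarrow> C1_closure S a a'"
  unfolding C1_closure_def using closure_mono[of S T] by (blast intro: continuous_on_subset)

lemma C1_closure_smooth:
  assumes "smooth_up_to_boundary \<Omega> a"
  obtains a' where "C1_closure \<Omega> a a'"
proof -
  obtain D where D: "D [] = a"
    "\<And>bs. bs \<in> lists Basis \<Longrightarrow> continuous_on (closure \<Omega>) (D bs)"
    "\<And>bs x. bs \<in> lists Basis \<Longrightarrow> x \<in> \<Omega> \<Longrightarrow>
       (D bs has_derivative (\<lambda>v. \<Sum>b\<in>Basis. (v \<bullet> b) *\<^sub>R D (b # bs) x)) (at x)"
    using assms unfolding smooth_up_to_boundary_def by blast
  have "C1_closure \<Omega> a (\<lambda>x v. \<Sum>b\<in>Basis. (v \<bullet> b) *\<^sub>R D [b] x)"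
    unfolding C1_closure_def using D(2)[of "[]"] D(3)[of "[]"] D(1) D(2)[of "[_]"]
    by (auto intro!: continuous_intros)
  then show ?thesis by (rule that)
qed

lemma C1_closure_id: "C1_closure S (\<lambda>x. x) (\<lambda>x v. v)"
  unfolding C1_closure_def by (auto intro!: continuous_intros)

lemma C1_closure_grad:
  assumes "real_polynomial_function q"
  shows "C1_closure S (grad q)
    (\<lambda>x v. \<Sum>b\<in>Basis. frechet_derivative (\<lambda>y. frechet_derivative q (at y) b) (at x) v *\<^sub>R b)"
  unfolding C1_closure_def
  by (intro conjI ballI allI continuous_on_grad_polynomial grad_polynomial_has_derivative assms
      continuous_intros continuous_on_polynomial polynomial_frechet_derivative)

context solid_polytope
begin

lemma closure_interior_K: "closure (interior K) = K"
  using convex_closure_interior[OF convex interior_nonempty] closed by simp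

text \<open>Common source of both integrations by parts: a product of two polynomials with the
  velocity gives the advective one, a polynomial with a gradient gives Green's formula.\<close>

lemma divergence_product:
  assumes a: "C1_closure (interior K) a a'" and u: "real_polynomial_function u"
  shows "(LINT x:interior K|lebesgue. grad u x \<bullet> a x + u x * (\<Sum>b\<in>Basis. a' x b \<bullet> b))
    = bd_integral K (\<lambda>n x. u x * (a x \<bullet> n))"
proof -
  define G' where "G' x v = u x *\<^sub>R a' x v + frechet_derivative u (at x) v *\<^sub>R a x" for x v
  have ac: "continuous_on K a" "\<And>v. continuous_on K (\<lambda>x. a' x v)"
    "\<And>x. x \<in> interior K \<Longrightarrow> (a has_derivative a' x) (at x)"
    using a unfolding C1_closure_def closure_interior_K by blast+
  note uc = continuous_on_polynomial[OF u] continuous_on_polynomial[OF polynomial_frechet_derivative[OF u]]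
  have "(LINT x:interior K|lebesgue. \<Sum>b\<in>Basis. G' x b \<bullet> b) = bd_integral K (\<lambda>n x. (u x *\<^sub>R a x) \<bullet> n)"
  proof (rule divergence)
    show "continuous_on K (\<lambda>x. u x *\<^sub>R a x)" by (intro continuous_intros uc ac)
    show "((\<lambda>x. u x *\<^sub>R a x) has_derivative G' x) (at x)" if "x \<in> interior K" for x
      unfolding G'_def[abs_def] by (intro has_derivative_scaleR polynomial_has_frechet_derivative u ac that)
    show "bcont (interior K) (\<lambda>x. G' x b \<bullet> b)" for b
      unfolding G'_def by (intro bcont_interior continuous_intros uc ac)
  qed
  moreover have "(\<Sum>b\<in>Basis. G' x b \<bullet> b) = grad u x \<bullet> a x + u x * (\<Sum>b\<in>Basis. a' x b \<bullet> b)" for x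
  proof -
    have "(\<Sum>b\<in>Basis. G' x b \<bullet> b) =
      u x * (\<Sum>b\<in>Basis. a' x b \<bullet> b) + (\<Sum>b\<in>Basis. frechet_derivative u (at x) b * (a x \<bullet> b))"
      by (simp add: G'_def inner_add_left sum.distrib sum_distrib_left)
    also have "(\<Sum>b\<in>Basis. frechet_derivative u (at x) b * (a x \<bullet> b)) = grad u x \<bullet> a x"
      unfolding grad_def inner_sum_left inner_scaleR_left by (simp only: inner_commute)
    finally show ?thesis by simp
  qed
  ultimately show ?thesis by simp
qed

lemma grad_mult:
  assumes "real_polynomial_function u" "real_polynomial_function v"
  shows "grad (\<lambda>x. u x * v x) x = u x *\<^sub>R grad v x + v x *\<^sub>R grad u x"
proof -
  have "frechet_derivative (\<lambda>x. u x * v x) (at x) b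
      = u x * frechet_derivative v (at x) b + frechet_derivative u (at x) b * v x" for b
    using frechet_derivative_at[OF has_derivative_mult[OF polynomial_has_frechet_derivative[OF assms(1)]
        polynomial_has_frechet_derivative[OF assms(2)], of x]] by metis
  then show ?thesis
    by (simp add: grad_def scaleR_sum_right sum.distrib[symmetric] scaleR_add_left mult.commute)
qed

lemma advection_by_parts:
  assumes a: "C1_closure (interior K) a a'" and u: "real_polynomial_function u" and v: "real_polynomial_function v"
  shows "(LINT x:interior K|lebesgue. u x * (a x \<bullet> grad v x) + v x * (a x \<bullet> grad u x) + u x * v x * (\<Sum>b\<in>Basis. a' x b \<bullet> b))
    = bd_integral K (\<lambda>n x. u x * v x * (a x \<bullet> n))"
  using divergence_product[OF a real_polynomial_function.intros(4)[OF u v]]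
  by (simp add: grad_mult[OF u v] inner_add_right inner_commute[of _ "a _"])

lemma green_identity:
  assumes u: "real_polynomial_function u" and v: "real_polynomial_function v"
  shows "(LINT x:interior K|lebesgue. v x * laplacian u x + grad v x \<bullet> grad u x)
    = bd_integral K (\<lambda>n x. v x * (grad u x \<bullet> n))"
  using divergence_product[OF C1_closure_grad[OF u] v]
  by (simp add: laplacian_polynomial[OF u] inner_sum_left inner_Basis if_distrib add.commute cong: if_cong)

end

section \<open>Integration over the mesh\<close>

locale mesh =
  fixes s :: cell_shape and \<Omega> :: "'a::euclidean_space set" and \<M> :: "'a set set"
  assumes dom: "polyhedral_domain \<Omega>" and mesh: "conforming_mesh s \<Omega> \<M>"
begin

lemma finite_mesh: "finite \<M>"
  using mesh by (simp add: conforming_mesh_def)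

lemma is_cell: "K \<in> \<M> \<Longrightarrow> is_cell s K"
  using mesh by (simp add: conforming_mesh_def)

lemma solid: "K \<in> \<M> \<Longrightarrow> solid_polytope K"
  using is_cell solid_polytope_cell by blast

lemma Union_mesh: "\<Union>\<M> = closure \<Omega>"
  using mesh by (simp add: conforming_mesh_def)

lemma interior_disjoint: "K \<in> \<M> \<Longrightarrow> L \<in> \<M> \<Longrightarrow> K \<noteq> L \<Longrightarrow> interior K \<inter> interior L = {}"
  using mesh by (simp add: conforming_mesh_def)

lemma open_domain: "open \<Omega>" and bounded_domain: "bounded \<Omega>"
  using dom by (simp_all add: polyhedral_domain_def)

lemma compact_closure_domain: "compact (closure \<Omega>)"
  using bounded_domain by (simp add: compact_closure)

lemma cell_subset: "K \<in> \<M> \<Longrightarrow> K \<subseteq> closure \<Omega>"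
  using Union_mesh by blast

text \<open>Here slit domains have to be excluded: a cell lies in the closure, and only
  \<open>interior (closure \<Omega>) = \<Omega>\<close> keeps its interior inside the
  domain.\<close>

lemma interior_cell_subset:
  assumes "K \<in> \<M>"
  shows "interior K \<subseteq> \<Omega>"
proof -
  have "interior K \<subseteq> interior (closure \<Omega>)"
    using cell_subset[OF assms] by (rule interior_mono)
  then show ?thesis using dom by (simp add: polyhedral_domain_def)
qed

text \<open>A closed negligible superset of the mesh skeleton, in the form expected by
  \<open>integral_directional_derivative_eq_0\<close>.\<close>

definition planes :: "('a \<times> real) set" where
  "planes = (\<Union>K\<in>\<M>. (\<lambda>F. (outward_normal K F, facet_offset K F)) ` {F. F facet_of K})"

lemma finite_planes: "finite planes"
  unfolding planes_def using finite_mesh solid by (auto intro: solid_polytope.finite_facets)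

lemma off_planes:
  assumes x: "x \<notin> hyperplanes planes" and cl: "x \<in> closure \<Omega>"
  shows "\<exists>K\<in>\<M>. x \<in> interior K"
proof -
  obtain K where K: "K \<in> \<M>" "x \<in> K" using cl Union_mesh by blast
  interpret solid_polytope K using K(1) by (rule solid)
  have "x \<in> interior K"
  proof (rule ccontr)
    assume "x \<notin> interior K"
    then obtain F where F: "F \<in> facets" "nrm F \<bullet> x = off F"
      using not_in_facet_offset[OF K(2)] by blast
    have "(nrm F, off F) \<in> planes" unfolding planes_def using K(1) F(1) by blast
    moreover have "nrm F \<noteq> 0" using norm_normal[OF F(1)] by auto
    ultimately show False using x F(2) unfolding hyperplanes_def by blast
  qed
  then show ?thesis using K(1) by blast
qed

text \<open>Off \<open>planes\<close> each point of the domain lies in exactly one open cell, so the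
  indicators of the cells add up to that of the domain almost everywhere.\<close>

lemma integral_split:
  fixes f :: "'a \<Rightarrow> real"
  assumes f: "\<And>K. K \<in> \<M> \<Longrightarrow> set_integrable lebesgue (interior K) f"
  shows "set_integrable lebesgue \<Omega> f"
    "(LINT x:\<Omega>|lebesgue. f x) = (\<Sum>K\<in>\<M>. LINT x:interior K|lebesgue. f x)"
proof -
  define g where "g x = (\<Sum>K\<in>\<M>. indicator (interior K) x *\<^sub>R f x)" for x
  have gi: "integrable lebesgue g"
    unfolding g_def using f unfolding set_integrable_def by (rule Bochner_Integration.integrable_sum)
  have "g x = indicator \<Omega> x *\<^sub>R f x" if x: "x \<notin> hyperplanes planes" for x
  proof (cases "x \<in> \<Omega>")
    case True
    then obtain K where K: "K \<in> \<M>" "x \<in> interior K"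
      using off_planes[OF x] closure_subset by blast
    have "g x = (\<Sum>L\<in>{K}. indicator (interior L) x *\<^sub>R f x)"
      unfolding g_def
    proof (rule sum.mono_neutral_right)
      show "\<forall>i\<in>\<M> - {K}. indicator (interior i) x *\<^sub>R f x = 0"
      proof
        fix L assume "L \<in> \<M> - {K}"
        then have "x \<notin> interior L" using interior_disjoint[OF K(1), of L] K(2) by blast
        then show "indicator (interior L) x *\<^sub>R f x = 0" by simp
      qed
    qed (use finite_mesh K in auto)
    then show ?thesis using K True by simp
  next
    case False
    have "x \<notin> interior K" if "K \<in> \<M>" for K using False interior_cell_subset[OF that] by blast
    then show ?thesis using False by (simp add: g_def)
  qed
  then have ae: "AE x in lebesgue. g x = indicator \<Omega> x *\<^sub>R f x"
    using AE_not_hyperplanes[OF finite_planes] by (auto elim: AE_mp)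
  have gm: "g \<in> borel_measurable lebesgue" using gi by (rule borel_measurable_integrable)
  have m: "(\<lambda>x. indicator \<Omega> x *\<^sub>R f x) \<in> borel_measurable lebesgue"
    by (rule borel_measurable_lebesgue_AE[OF gm ae])
  show "set_integrable lebesgue \<Omega> f"
    unfolding set_integrable_def using integrable_cong_AE[OF gm m ae] gi by simp
  have "(LINT x:\<Omega>|lebesgue. f x) = integral\<^sup>L lebesgue g"
    unfolding set_lebesgue_integral_def using integral_cong_AE[OF gm m ae] by simp
  also have "\<dots> = (\<Sum>K\<in>\<M>. LINT x:interior K|lebesgue. f x)"
    unfolding g_def set_lebesgue_integral_def using f unfolding set_integrable_def
    by (rule Bochner_Integration.integral_sum)
  finally show "(LINT x:\<Omega>|lebesgue. f x) = (\<Sum>K\<in>\<M>. LINT x:interior K|lebesgue. f x)" .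
qed

lemma V_disc_polynomial:
  assumes "v \<in> V_disc s p \<M>" "K \<in> \<M>"
  obtains q where "real_polynomial_function q" "\<forall>x\<in>interior K. v x = q x"
proof -
  obtain q where q: "q \<in> local_space s p K" "\<forall>x\<in>interior K. v x = q x"
    using assms unfolding V_disc_def by blast
  show ?thesis by (rule that[OF polynomial_local_space[OF is_cell[OF assms(2)] q(1)] q(2)])
qed

lemma V_bar_V_disc: "v \<in> V_bar s p \<Omega> \<M> \<Longrightarrow> v \<in> V_disc s p \<M>"
  by (simp add: V_bar_def)

text \<open>\<open>u\<^sup>2 a\<close> extended by zero is continuous and compactly supported, hence its divergence integrates
  to zero without any cancellation of fluxes between neighbouring cells.\<close>

lemma divergence_V_bar:
  assumes u: "u \<in> V_bar s p \<Omega> \<M>" and a: "C1_closure \<Omega> a a'"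
  defines "h \<equiv> (\<lambda>x. 2 * (u x * (a x \<bullet> grad u x)) + (u x)\<^sup>2 * (\<Sum>b\<in>Basis. a' x b \<bullet> b))"
  shows "set_integrable lebesgue \<Omega> h" "(LINT x:\<Omega>|lebesgue. h x) = 0"
proof -
  have uc: "continuous_on (closure \<Omega>) u" and u0: "\<And>x. x \<in> frontier \<Omega> \<Longrightarrow> u x = 0"
    using u by (auto simp: V_bar_def)
  have ac: "continuous_on (closure \<Omega>) a" "\<And>v. continuous_on (closure \<Omega>) (\<lambda>x. a' x v)"
    "\<And>x. x \<in> \<Omega> \<Longrightarrow> (a has_derivative a' x) (at x)"
    using a unfolding C1_closure_def by blast+
  have ud: "(u has_derivative (\<lambda>v. grad u x \<bullet> v)) (at x)" if K: "K \<in> \<M>" and x: "x \<in> interior K" for x K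
  proof -
    obtain q where q: "real_polynomial_function q" "\<forall>x\<in>interior K. u x = q x"
      using V_disc_polynomial[OF V_bar_V_disc[OF u] K] by blast
    have "(q has_derivative frechet_derivative q (at x)) (at x)"
      by (rule polynomial_has_frechet_derivative[OF q(1)])
    then have d: "(u has_derivative frechet_derivative q (at x)) (at x)"
      by (rule has_derivative_transform_within_open[of _ _ _ _ "interior K"]) (use q(2) x in auto)
    then have "frechet_derivative q (at x) = frechet_derivative u (at x)" by (rule frechet_derivative_at)
    moreover have "u differentiable at x" using d differentiable_def by blast
    ultimately show ?thesis using d by (simp add: inner_grad)
  qed
  \<comment> \<open>The derivative in direction \<open>b\<close> of component \<open>b\<close> of
    the field u^2 a; summed over the basis these give \<open>h\<close>.\<close>
  define hb where "hb b x = 2 * (u x * (grad u x \<bullet> b) * (a x \<bullet> b)) + (u x)\<^sup>2 * (a' x b \<bullet> b)" for b x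
  have main: "integrable lebesgue (\<lambda>x. indicator \<Omega> x *\<^sub>R hb b x)" "integral\<^sup>L lebesgue (\<lambda>x. indicator \<Omega> x *\<^sub>R hb b x) = 0" for b
  proof -
    define g where "g x = (if x \<in> closure \<Omega> then (u x)\<^sup>2 * (a x \<bullet> b) else 0)" for x
    define g' where "g' x v = (if x \<in> \<Omega> then (u x)\<^sup>2 * (a' x v \<bullet> b) + (2 * u x * (grad u x \<bullet> v)) * (a x \<bullet> b) else 0)" for x v
    have gc: "continuous_on UNIV g"
    proof -
      have "continuous_on (closure \<Omega> \<union> - \<Omega>) g" unfolding g_def
      proof (rule continuous_on_cases)
        show "\<forall>x. x \<in> closure \<Omega> \<and> x \<notin> closure \<Omega> \<or> x \<in> - \<Omega> \<and> x \<in> closure \<Omega> \<longrightarrow> (u x)\<^sup>2 * (a x \<bullet> b) = 0"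
          using u0 open_domain by (auto simp: frontier_def interior_open)
      qed (use open_domain in \<open>auto intro!: continuous_intros uc ac\<close>)
      moreover have "closure \<Omega> \<union> - \<Omega> = UNIV" using closure_subset by blast
      ultimately show ?thesis by simp
    qed
    obtain R where R: "\<And>x. x \<in> closure \<Omega> \<Longrightarrow> norm x \<le> R"
      using compact_imp_bounded[OF compact_closure_domain] by (auto simp: bounded_iff)
    have supp: "g x = 0" if "R < norm x" for x
      using R[of x] that by (auto simp: g_def)
    have der: "(g has_derivative g' x) (at x)" if x: "x \<notin> hyperplanes planes" for x
    proof (cases "x \<in> closure \<Omega>")
      case True
      then obtain K where K: "K \<in> \<M>" "x \<in> interior K" using off_planes[OF x] by blast
      have x\<Omega>: "x \<in> \<Omega>" using K interior_cell_subset by blast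
      have "((\<lambda>x. (u x)\<^sup>2 * (a x \<bullet> b)) has_derivative g' x) (at x)"
        unfolding g'_def using x\<Omega>
        by (auto intro!: derivative_eq_intros ud[OF K] ac(3) simp: power2_eq_square algebra_simps)
      then show ?thesis
        by (rule has_derivative_transform_within_open[of _ _ _ _ "\<Omega>"])
          (use x\<Omega> open_domain closure_subset[of \<Omega>] in \<open>auto simp: g_def\<close>)
    next
      case False
      then have "x \<notin> \<Omega>" using closure_subset by blast
      then have "((\<lambda>x. 0) has_derivative g' x) (at x)" by (simp add: g'_def[abs_def])
      then show ?thesis
        by (rule has_derivative_transform_within_open[of _ _ _ _ "- closure \<Omega>"])
          (use False in \<open>auto simp: g_def\<close>)
    qed
    have "\<exists>N. \<forall>x\<in>interior K. \<bar>g' x b\<bar> \<le> N" if K: "K \<in> \<M>" for K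
    proof -
      interpret solid_polytope K using K by (rule solid)
      obtain q where q: "real_polynomial_function q" "\<forall>x\<in>interior K. u x = q x"
        using V_disc_polynomial[OF V_bar_V_disc[OF u] K] by blast
      have "bcont (interior K) (\<lambda>x. (q x)\<^sup>2 * (a' x b \<bullet> b) + (2 * q x * (grad q x \<bullet> b)) * (a x \<bullet> b))"
        by (intro bcont_interior continuous_intros continuous_on_polynomial continuous_on_grad_polynomial q
            continuous_on_subset[OF ac(1) cell_subset[OF K]] continuous_on_subset[OF ac(2) cell_subset[OF K]])
      then obtain N where N: "\<forall>x\<in>interior K. \<bar>(q x)\<^sup>2 * (a' x b \<bullet> b) + (2 * q x * (grad q x \<bullet> b)) * (a x \<bullet> b)\<bar> \<le> N"
        unfolding bcont_def by blast
      have "\<bar>g' x b\<bar> \<le> N" if "x \<in> interior K" for x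
      proof -
        have "grad u x = grad q x" by (rule grad_cong_open[of "interior K"]) (use that q in auto)
        then have "g' x b = (q x)\<^sup>2 * (a' x b \<bullet> b) + (2 * q x * (grad q x \<bullet> b)) * (a x \<bullet> b)"
          using that interior_cell_subset[OF K] q(2) by (auto simp: g'_def)
        then show ?thesis using N that by simp
      qed
      then show ?thesis by blast
    qed
    \<comment> \<open>Each cell has its own bound, from the polynomial there; summing over the
      finitely many cells gives a global Lipschitz bound.\<close>
    then obtain N where N: "\<And>K x. K \<in> \<M> \<Longrightarrow> x \<in> interior K \<Longrightarrow> \<bar>g' x b\<bar> \<le> N K" by metis
    have bd: "\<bar>g' x b\<bar> \<le> (\<Sum>K\<in>\<M>. \<bar>N K\<bar>)" if x: "x \<notin> hyperplanes planes" for x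
    proof (cases "x \<in> closure \<Omega>")
      case True
      then obtain K where K: "K \<in> \<M>" "x \<in> interior K" using off_planes[OF x] by blast
      have "\<bar>g' x b\<bar> \<le> \<bar>N K\<bar>" using N[OF K] by simp
      also have "\<dots> \<le> (\<Sum>K\<in>\<M>. \<bar>N K\<bar>)" using K finite_mesh by (intro member_le_sum) auto
      finally show ?thesis .
    next
      case False
      then have "x \<notin> \<Omega>" using closure_subset by blast
      then show ?thesis by (simp add: g'_def sum_nonneg)
    qed
    have h: "indicator \<Omega> x *\<^sub>R hb b x = g' x b" for x
      by (simp add: hb_def g'_def algebra_simps)
    show "integrable lebesgue (\<lambda>x. indicator \<Omega> x *\<^sub>R hb b x)" "integral\<^sup>L lebesgue (\<lambda>x. indicator \<Omega> x *\<^sub>R hb b x) = 0"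
      by (rule integral_directional_derivative_eq_0[OF gc finite_planes supp der bd h]; assumption)+
  qed
  have sumh: "indicator \<Omega> x *\<^sub>R h x = (\<Sum>b\<in>Basis. indicator \<Omega> x *\<^sub>R hb b x)" for x
  proof -
    have "a x \<bullet> grad u x = (\<Sum>b\<in>Basis. (grad u x \<bullet> b) * (a x \<bullet> b))"
      by (subst euclidean_inner) (simp add: mult.commute)
    then have "h x = (\<Sum>b\<in>Basis. hb b x)"
      by (simp add: h_def hb_def sum.distrib sum_distrib_left mult.assoc)
    then show ?thesis by (simp add: sum_distrib_left)
  qed
  show "set_integrable lebesgue \<Omega> h"
    unfolding set_integrable_def sumh using main(1) by (intro Bochner_Integration.integrable_sum)
  show "(LINT x:\<Omega>|lebesgue. h x) = 0"
    unfolding set_lebesgue_integral_def sumh Bochner_Integration.integral_sum[OF main(1)] main(2) by simp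
qed

end

section \<open>Estimates on one cell\<close>

lemma young:
  fixes x y t :: real
  assumes "0 < t"
  shows "\<bar>x * y\<bar> \<le> t * x\<^sup>2 + 1 / (4 * t) * y\<^sup>2"
proof -
  have "0 \<le> (2 * t * \<bar>x\<bar> - \<bar>y\<bar>)\<^sup>2 / (4 * t)" using assms by simp
  also have "\<dots> = t * x\<^sup>2 + 1 / (4 * t) * y\<^sup>2 - \<bar>x * y\<bar>"
    using assms by (simp add: power2_diff abs_mult power_mult_distrib field_simps power2_eq_square)
  finally show ?thesis by simp
qed

context solid_polytope
begin

lemma set_integral_young:
  assumes f: "bcont (interior K) f" "bcont (interior K) g" "bcont (interior K) h"
    and le: "\<And>x. x \<in> interior K \<Longrightarrow> \<bar>h x\<bar> \<le> t * f x + c * g x"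
  shows "\<bar>LINT x:interior K|lebesgue. h x\<bar> \<le> t * (LINT x:interior K|lebesgue. f x) + c * (LINT x:interior K|lebesgue. g x)"
proof -
  have i: "set_integrable lebesgue (interior K) h" "set_integrable lebesgue (interior K) (\<lambda>x. - h x)"
    "set_integrable lebesgue (interior K) (\<lambda>x. t * f x)" "set_integrable lebesgue (interior K) (\<lambda>x. c * g x)"
    "set_integrable lebesgue (interior K) (\<lambda>x. t * f x + c * g x)"
    by (intro integrable_interior bcont_add bcont_mult bcont_const bcont_uminus f)+
  have "(LINT x:interior K|lebesgue. h x) \<le> (LINT x:interior K|lebesgue. t * f x + c * g x)"
    using le by (intro set_integral_mono i) (meson abs_le_D1)
  moreover have "(LINT x:interior K|lebesgue. - h x) \<le> (LINT x:interior K|lebesgue. t * f x + c * g x)"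
    using le by (intro set_integral_mono i) (meson abs_le_D2)
  moreover have "(LINT x:interior K|lebesgue. t * f x + c * g x) =
      t * (LINT x:interior K|lebesgue. f x) + c * (LINT x:interior K|lebesgue. g x)"
    using set_integral_add(2)[OF i(3,4)] by simp
  moreover have "(LINT x:interior K|lebesgue. - h x) = - (LINT x:interior K|lebesgue. h x)"
    using i(1) by (rule set_integral_uminus)
  ultimately show ?thesis by linarith
qed

lemma bdcontI: "(\<And>n. continuous_on K (g n)) \<Longrightarrow> bdcont g"
  unfolding bdcont_def using facet_subset continuous_on_subset by blast

lemma bd_integral_young:
  assumes f: "bdcont f" "bdcont g" "bdcont h"
    and le: "\<And>n x. x \<in> K \<Longrightarrow> norm n = 1 \<Longrightarrow> \<bar>h n x\<bar> \<le> t * f n x + c * g n x"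
  shows "\<bar>bd_integral K h\<bar> \<le> t * bd_integral K f + c * bd_integral K g"
proof -
  have b: "bdcont (\<lambda>n x. t * f n x)" "bdcont (\<lambda>n x. c * g n x)" "bdcont (\<lambda>n x. t * f n x + c * g n x)"
    using f unfolding bdcont_def by (auto intro!: continuous_intros)
  have "bd_integral K h \<le> bd_integral K (\<lambda>n x. t * f n x + c * g n x)"
    using le norm_normal facet_subset by (intro bd_integral_mono f b) (meson abs_le_D1 subsetD)
  moreover have "bd_integral K (\<lambda>n x. - h n x) \<le> bd_integral K (\<lambda>n x. t * f n x + c * g n x)"
    using le norm_normal facet_subset by (intro bd_integral_mono bdcont_uminus f b) (meson abs_le_D2 subsetD)
  moreover have "bd_integral K (\<lambda>n x. t * f n x + c * g n x) = t * bd_integral K f + c * bd_integral K g"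
    using bd_integral_add[OF b(1,2)] by (simp add: bd_integral_cmult)
  ultimately show ?thesis by (simp add: bd_integral_uminus)
qed

end

text \<open>One cell with the data reduced to scalars: \<open>h\<close> will be its diameter,
  \<open>L\<close> the essential supremum of the velocity, \<open>\<kappa>a\<close> the artificial
  diffusivity. The estimates speak of polynomials only; discrete functions are replaced by their
  polynomials later.\<close>

locale cell_estimate = solid_polytope K for K :: "'a::euclidean_space set" +
  fixes a a' and \<kappa> \<kappa>a h L Ct Cp :: real
  assumes field: "C1_closure (interior K) a a'"
    and div0: "\<And>x. x \<in> interior K \<Longrightarrow> (\<Sum>b\<in>Basis. a' x b \<bullet> b) = 0"
    and a_le: "\<And>x. x \<in> K \<Longrightarrow> norm (a x) \<le> L"
    and pos: "0 < \<kappa>" "0 \<le> \<kappa>a" "0 < h" "0 < Ct" "8 * Ct \<le> Cp"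
begin

lemma a_cont: "continuous_on K a"
  using field unfolding C1_closure_def closure_interior_K by blast

lemmas poly_cont = continuous_on_polynomial continuous_on_grad_polynomial continuous_on_laplacian_polynomial

lemma Cp_pos: "0 < Cp" using pos by linarith

abbreviation "I f \<equiv> (LINT x:interior K|lebesgue. f x)"
abbreviation "energy w \<equiv> I (\<lambda>x. (norm (grad w x))\<^sup>2)"
abbreviation "bnd g \<equiv> bd_integral K g"

lemma energy_nonneg: "0 \<le> energy w"
  by (rule set_integral_nonneg_real) simp

lemma advection_parts:
  assumes q: "real_polynomial_function q" and v: "real_polynomial_function v"
  shows "I (\<lambda>x. q x * (a x \<bullet> grad v x)) + I (\<lambda>x. v x * (a x \<bullet> grad q x)) = bnd (\<lambda>n x. q x * v x * (a x \<bullet> n))"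
proof -
  have "I (\<lambda>x. q x * (a x \<bullet> grad v x)) + I (\<lambda>x. v x * (a x \<bullet> grad q x))
      = I (\<lambda>x. q x * (a x \<bullet> grad v x) + v x * (a x \<bullet> grad q x))"
    by (intro set_integral_add(2)[symmetric] integrable_interior bcont_interior continuous_intros
        poly_cont a_cont q v)
  also have "\<dots> = I (\<lambda>x. q x * (a x \<bullet> grad v x) + v x * (a x \<bullet> grad q x) + q x * v x * (\<Sum>b\<in>Basis. a' x b \<bullet> b))"
    by (intro set_integral_cong_on) (simp add: div0)
  also have "\<dots> = bnd (\<lambda>n x. q x * v x * (a x \<bullet> n))"
    by (rule advection_by_parts[OF field q v])
  finally show ?thesis .
qed

lemma green_parts:
  assumes w: "real_polynomial_function w" and q: "real_polynomial_function q"
  shows "I (\<lambda>x. q x * laplacian w x) + I (\<lambda>x. grad q x \<bullet> grad w x) = bnd (\<lambda>n x. q x * (grad w x \<bullet> n))"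
proof -
  have "I (\<lambda>x. q x * laplacian w x) + I (\<lambda>x. grad q x \<bullet> grad w x)
      = I (\<lambda>x. q x * laplacian w x + grad q x \<bullet> grad w x)"
    by (intro set_integral_add(2)[symmetric] integrable_interior bcont_interior continuous_intros
        poly_cont q w)
  also have "\<dots> = bnd (\<lambda>n x. q x * (grad w x \<bullet> n))"
    by (rule green_identity[OF w q])
  finally show ?thesis .
qed

lemma grad_young:
  assumes w: "real_polynomial_function w" and q: "real_polynomial_function q" and t: "0 < t"
  shows "\<bar>I (\<lambda>x. grad q x \<bullet> grad w x)\<bar> \<le> t * energy q + 1 / (4 * t) * energy w"
proof (rule set_integral_young)
  show "\<bar>grad q x \<bullet> grad w x\<bar> \<le> t * (norm (grad q x))\<^sup>2 + 1 / (4 * t) * (norm (grad w x))\<^sup>2" for x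
    using Cauchy_Schwarz_ineq2[of "grad q x" "grad w x"] young[OF t, of "norm (grad q x)" "norm (grad w x)"]
    by (simp add: abs_mult)
qed (intro bcont_interior continuous_intros poly_cont q w)+

lemma bd_young:
  assumes f: "bdcont f" and g: "bdcont g" and t: "0 < t"
  shows "\<bar>bnd (\<lambda>n x. f n x * g n x)\<bar> \<le> t * bnd (\<lambda>n x. (f n x)\<^sup>2) + 1 / (4 * t) * bnd (\<lambda>n x. (g n x)\<^sup>2)"
  by (rule bd_integral_young) (use f g young[OF t] in \<open>auto simp: bdcont_def intro!: continuous_intros\<close>)

definition norm2 :: "('a \<Rightarrow> real) \<Rightarrow> real" where
  "norm2 q = (\<kappa> + \<kappa>a) * energy q + Cp * \<kappa> / h * bnd (\<lambda>n x. (q x)\<^sup>2) + bnd (\<lambda>n x. \<bar>a x \<bullet> n\<bar> * (q x)\<^sup>2)"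

lemma bdcont_poly:
  assumes "real_polynomial_function q"
  shows "bdcont (\<lambda>n. q)" "bdcont (\<lambda>n x. grad q x \<bullet> n)"
  by (intro bdcontI continuous_intros poly_cont assms)+

text \<open>Green's formula turns the Laplacian term into a product of gradients and a boundary
  term. Young's inequality and \<open>Ct / Cp <= 1/8\<close> then leave at least 1/4 of each energy
  and 3/8 of the penalty. Writing max(t, 0) as half of |t| + t, the part from t cancels the volume
  advection, and half of the absolute flux remains.\<close>

lemma coercive:
  assumes w: "real_polynomial_function w" and q: "real_polynomial_function q"
    and tw: "bnd (\<lambda>n x. (grad w x \<bullet> n)\<^sup>2) \<le> Ct / h * energy w"
    and tq: "bnd (\<lambda>n x. (grad q x \<bullet> n)\<^sup>2) \<le> Ct / h * energy q"
  shows "(\<kappa> * energy w + norm2 q) / 4 \<le> \<kappa> * energy w - \<kappa> * I (\<lambda>x. q x * laplacian w x)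
     - I (\<lambda>x. q x * (a x \<bullet> grad q x)) + (\<kappa> + \<kappa>a) * energy q
     + bnd (\<lambda>n x. q x * q x * max (a x \<bullet> n) 0) - 2 * (\<kappa> * bnd (\<lambda>n x. q x * (grad q x \<bullet> n)))
     + Cp * \<kappa> / h * bnd (\<lambda>n x. (q x)\<^sup>2)"
proof -
  define Z where "Z = Cp / h * bnd (\<lambda>n x. (q x)\<^sup>2)"
  have bq: "0 \<le> bnd (\<lambda>n x. (q x)\<^sup>2)" by (intro bd_integral_nonneg) simp
  have Z0: "0 \<le> Z" unfolding Z_def using bq Cp_pos pos by simp
  have an: "0 \<le> bnd (\<lambda>n x. \<bar>a x \<bullet> n\<bar> * (q x)\<^sup>2)" by (intro bd_integral_nonneg) simp
  have CC: "Ct / Cp \<le> 1 / 8" using pos Cp_pos by (simp add: divide_le_eq)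
  \<comment> \<open>The weight makes the trace inequality cost \<open>2 * (Ct / Cp)\<close> of the
    energy of \<open>w\<close>, which is at most 1/4.\<close>
  have B1: "\<bar>bnd (\<lambda>n x. q x * (grad w x \<bullet> n))\<bar> \<le> Z / 8 + energy w / 4"
  proof -
    have "\<bar>bnd (\<lambda>n x. q x * (grad w x \<bullet> n))\<bar> \<le>
        (Cp / (8 * h)) * bnd (\<lambda>n x. (q x)\<^sup>2) + 1 / (4 * (Cp / (8 * h))) * bnd (\<lambda>n x. (grad w x \<bullet> n)\<^sup>2)"
      by (rule bd_young[OF bdcont_poly(1)[OF q] bdcont_poly(2)[OF w]]) (use Cp_pos pos in simp)
    also have "1 / (4 * (Cp / (8 * h))) * bnd (\<lambda>n x. (grad w x \<bullet> n)\<^sup>2) \<le> 1 / (4 * (Cp / (8 * h))) * (Ct / h * energy w)"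
      using tw Cp_pos pos by (intro mult_left_mono) auto
    also have "\<dots> = 2 * (Ct / Cp) * energy w" using pos Cp_pos by (simp add: field_simps)
    also have "\<dots> \<le> 2 * (1 / 8) * energy w"
      unfolding mult.assoc by (intro mult_left_mono mult_right_mono CC energy_nonneg) simp
    finally show ?thesis by (simp add: Z_def)
  qed
  \<comment> \<open>The symmetric form contains this term twice, so its total cost is
    \<open>Z / 2\<close> and a quarter of the energy of \<open>q\<close>.\<close>
  have B2: "\<bar>bnd (\<lambda>n x. q x * (grad q x \<bullet> n))\<bar> \<le> Z / 4 + energy q / 8"
  proof -
    have "\<bar>bnd (\<lambda>n x. q x * (grad q x \<bullet> n))\<bar> \<le>
        (Cp / (4 * h)) * bnd (\<lambda>n x. (q x)\<^sup>2) + 1 / (4 * (Cp / (4 * h))) * bnd (\<lambda>n x. (grad q x \<bullet> n)\<^sup>2)"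
      by (rule bd_young[OF bdcont_poly(1)[OF q] bdcont_poly(2)[OF q]]) (use Cp_pos pos in simp)
    also have "1 / (4 * (Cp / (4 * h))) * bnd (\<lambda>n x. (grad q x \<bullet> n)\<^sup>2) \<le> 1 / (4 * (Cp / (4 * h))) * (Ct / h * energy q)"
      using tq Cp_pos pos by (intro mult_left_mono) auto
    also have "\<dots> = (Ct / Cp) * energy q" using pos Cp_pos by (simp add: field_simps)
    also have "\<dots> \<le> (1 / 8) * energy q" by (intro mult_right_mono CC energy_nonneg)
    finally show ?thesis by (simp add: Z_def)
  qed
  have G: "\<bar>I (\<lambda>x. grad q x \<bullet> grad w x)\<bar> \<le> energy q / 2 + energy w / 2"
    using grad_young[OF w q, of "1/2"] by simp
  have "energy w / 4 + energy q / 4 + Z / 4 \<le> energy w - I (\<lambda>x. q x * laplacian w x) + energy q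
      - 2 * bnd (\<lambda>n x. q x * (grad q x \<bullet> n)) + Z"
    using green_parts[OF w q] B1 B2 G Z0 by linarith
  then have "\<kappa> * (energy w / 4 + energy q / 4 + Z / 4) \<le> \<kappa> * (energy w - I (\<lambda>x. q x * laplacian w x) + energy q
      - 2 * bnd (\<lambda>n x. q x * (grad q x \<bullet> n)) + Z)"
    using pos by (intro mult_left_mono) auto
  then have main: "\<kappa> * energy w / 4 + \<kappa> * energy q / 4 + \<kappa> * Z / 4 \<le>
      \<kappa> * energy w - \<kappa> * I (\<lambda>x. q x * laplacian w x) + \<kappa> * energy q
      - 2 * (\<kappa> * bnd (\<lambda>n x. q x * (grad q x \<bullet> n))) + \<kappa> * Z"
    by (simp only: distrib_left right_diff_distrib mult.left_commute times_divide_eq_right)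
  have kZ: "Cp * \<kappa> / h * bnd (\<lambda>n x. (q x)\<^sup>2) = \<kappa> * Z" by (simp add: Z_def)
  have aY: "0 \<le> \<kappa>a * energy q" using pos energy_nonneg by simp
  have "bnd (\<lambda>n x. q x * q x * max (a x \<bullet> n) 0) - I (\<lambda>x. q x * (a x \<bullet> grad q x))
      = bnd (\<lambda>n x. \<bar>a x \<bullet> n\<bar> * (q x)\<^sup>2) / 2"
  proof -
    have "bnd (\<lambda>n x. q x * q x * max (a x \<bullet> n) 0) =
      bnd (\<lambda>n x. (1/2) * (\<bar>a x \<bullet> n\<bar> * (q x)\<^sup>2) + (1/2) * (q x * q x * (a x \<bullet> n)))"
      by (intro bd_integral_cong) (auto simp: max_def abs_if power2_eq_square)
    also have "\<dots> = bnd (\<lambda>n x. (1/2) * (\<bar>a x \<bullet> n\<bar> * (q x)\<^sup>2)) + bnd (\<lambda>n x. (1/2) * (q x * q x * (a x \<bullet> n)))"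
      by (intro bd_integral_add bdcontI continuous_intros a_cont poly_cont q)
    also have "\<dots> = (1/2) * bnd (\<lambda>n x. \<bar>a x \<bullet> n\<bar> * (q x)\<^sup>2) + (1/2) * bnd (\<lambda>n x. q x * q x * (a x \<bullet> n))"
      by (simp only: bd_integral_cmult)
    finally show ?thesis
      using advection_parts[OF q q] by simp
  qed
  note flux = this
  have "(kX + (kY + aY + kZ + N)) / 4 \<le> kX - kI - A + (kY + aY) + M - 2 * kB + kZ"
    if "kX / 4 + kY / 4 + kZ / 4 \<le> kX - kI + kY - 2 * kB + kZ" "0 \<le> aY" "M - A = N / 2" "0 \<le> N"
    for kX kY kZ kI kB aY M A N :: real
    using that by (simp add: field_simps)
  from this[OF main aY flux an] show ?thesis
    unfolding norm2_def kZ distrib_right .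
qed

end

text \<open>The sum of the six weights of Young's inequality in \<open>stability\<close>: paying
  \<open>P2 / 12\<close> costs three times the constant that bounds the respective term.\<close>

definition stability_const :: "real \<Rightarrow> real \<Rightarrow> real \<Rightarrow> real \<Rightarrow> real \<Rightarrow> real" where
  "stability_const Ct Ci Cp Ca C\<tau> = 3 * C\<tau> + 3 * (Ct * C\<tau>) + 3 * (C\<tau> + Ca * C\<tau> * Ci)
     + 3 * (Ct * (Ct * C\<tau> / Ci)) + 3 * (Ct * C\<tau> / Cp) + 3 * (Cp * (Ct * C\<tau> / Ci))"

text \<open>The constant of \<open>norm2_v\<close> plus that of \<open>streamline_v\<close>: the
  squared norm of the streamline test function in terms of the streamline part of
  \<open>U\<close>.\<close>

definition test_const :: "real \<Rightarrow> real \<Rightarrow> real \<Rightarrow> real \<Rightarrow> real \<Rightarrow> real" where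
  "test_const Ct Ci Cp Ca C\<tau> = C\<tau> + Ca * C\<tau> * Ci + Cp * (Ct * C\<tau> / Ci) + Ct * C\<tau> + C\<tau>\<^sup>2 * Ci"

text \<open>The last three assumptions are scale-free consequences of the definitions of the
  stabilisation parameters. Through them the velocity, the diffusivity and the size of the cell
  disappear from all constants.\<close>

locale stabilised_cell_estimate = cell_estimate K a a' \<kappa> \<kappa>a h L Ct Cp
  for K :: "'a::euclidean_space set" and a a' and \<kappa> \<kappa>a h L Ct Cp :: real +
  fixes \<tau> Ci C\<tau> Ca :: real
  assumes pos': "0 < \<tau>" "0 < Ci" "0 < C\<tau>" "0 \<le> Ca" "0 \<le> L"
    and tau1: "\<tau> * (L / h) \<le> C\<tau>" and tau2: "\<tau> * (Ci * \<kappa> / h\<^sup>2) \<le> C\<tau>"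
    and art: "\<kappa>a * (\<tau> * Ci / h\<^sup>2) \<le> Ca * C\<tau> * Ci"
begin

context
  fixes w q g v
  assumes poly: "real_polynomial_function w" "real_polynomial_function q" "real_polynomial_function v"
  assumes orth: "I (\<lambda>x. v x * (a x \<bullet> grad w x)) + I (\<lambda>x. v x * (a x \<bullet> grad q x)) = \<tau> * I (\<lambda>x. (g x)\<^sup>2)"
    and v: "I (\<lambda>x. (v x)\<^sup>2) = \<tau> * (\<tau> * I (\<lambda>x. (g x)\<^sup>2))"
    and inv: "energy v \<le> Ci / h\<^sup>2 * I (\<lambda>x. (v x)\<^sup>2)"
      "I (\<lambda>x. (laplacian w x)\<^sup>2) \<le> Ci / h\<^sup>2 * energy w"
    and tr: "bnd (\<lambda>n x. (v x)\<^sup>2) \<le> Ct / h * I (\<lambda>x. (v x)\<^sup>2)"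
      "bnd (\<lambda>n x. (grad v x \<bullet> n)\<^sup>2) \<le> Ct / h * energy v"
      "bnd (\<lambda>n x. (grad q x \<bullet> n)\<^sup>2) \<le> Ct / h * energy q"
begin

text \<open>The streamline part of the squared norm on the cell. In this context \<open>w\<close>
  and \<open>q\<close> stand for the conforming and the discontinuous part of \<open>U\<close>,
  \<open>g\<close> for the projected streamline derivative and \<open>v\<close> for \<tau> times
  \<open>g\<close>; the latter relation enters only through integral identities.\<close>

definition "P2 = \<tau> * I (\<lambda>x. (g x)\<^sup>2)"

lemma P2_nonneg: "0 \<le> P2"
  unfolding P2_def using pos' by (intro mult_nonneg_nonneg set_integral_nonneg_real) auto

text \<open>The inverse inequality loses \<open>Ci / h\<^sup>2\<close>, and the squared
  \<open>L2\<close> norm of \<open>v\<close> still contains one factor \<open>\<tau>\<close> beyond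
  \<open>P2\<close>. That factor balances the loss, by \<open>tau2\<close> for the physical and by
  \<open>art\<close> for the artificial diffusivity.\<close>

lemma energy_v: "\<kappa> * energy v \<le> C\<tau> * P2" "\<kappa>a * energy v \<le> Ca * C\<tau> * Ci * P2"
proof -
  have le: "energy v \<le> Ci / h\<^sup>2 * (\<tau> * P2)" using inv(1) v by (simp add: P2_def)
  then have "\<kappa> * energy v \<le> \<kappa> * (Ci / h\<^sup>2 * (\<tau> * P2))" "\<kappa>a * energy v \<le> \<kappa>a * (Ci / h\<^sup>2 * (\<tau> * P2))"
    using mult_left_mono[OF le, of \<kappa>] mult_left_mono[OF le, of \<kappa>a] pos by simp_all
  moreover have "(\<tau> * (Ci * \<kappa> / h\<^sup>2)) * P2 \<le> C\<tau> * P2" "(\<kappa>a * (\<tau> * Ci / h\<^sup>2)) * P2 \<le> (Ca * C\<tau> * Ci) * P2"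
    by (rule mult_right_mono[OF tau2 P2_nonneg], rule mult_right_mono[OF art P2_nonneg])
  ultimately show "\<kappa> * energy v \<le> C\<tau> * P2" "\<kappa>a * energy v \<le> Ca * C\<tau> * Ci * P2"
    by (simp_all add: algebra_simps)
qed

text \<open>The trace inequality supplies the second power of 1/h, so \<open>tau2\<close> applies
  once more; the missing \<open>Ci\<close> is divided out.\<close>

lemma trace_v: "\<kappa> / h * bnd (\<lambda>n x. (v x)\<^sup>2) \<le> Ct * C\<tau> / Ci * P2"
proof -
  have "\<kappa> / h * bnd (\<lambda>n x. (v x)\<^sup>2) \<le> \<kappa> / h * (Ct / h * (\<tau> * P2))"
    using tr(1) v pos by (intro mult_left_mono) (auto simp: P2_def)
  also have "\<dots> = (Ct / Ci) * ((\<tau> * (Ci * \<kappa> / h\<^sup>2)) * P2)"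
    using pos' by (simp add: power2_eq_square)
  also have "\<dots> \<le> (Ct / Ci) * (C\<tau> * P2)"
    using tau2 P2_nonneg pos pos' by (intro mult_left_mono mult_right_mono) auto
  finally show ?thesis by simp
qed

text \<open>A single power of 1/h together with the bound \<open>L\<close> of the velocity: this is
  the advective balance \<open>tau1\<close>.\<close>

lemma flux_v: "bnd (\<lambda>n x. \<bar>a x \<bullet> n\<bar> * (v x)\<^sup>2) \<le> Ct * C\<tau> * P2"
proof -
  have "bnd (\<lambda>n x. \<bar>a x \<bullet> n\<bar> * (v x)\<^sup>2) \<le> bnd (\<lambda>n x. L * (v x)\<^sup>2)"
  proof (rule bd_integral_mono)
    fix F x assume F: "F \<in> facets" "x \<in> F"
    have "\<bar>a x \<bullet> nrm F\<bar> \<le> norm (a x) * norm (nrm F)" by (rule Cauchy_Schwarz_ineq2)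
    also have "\<dots> \<le> L" using norm_normal[OF F(1)] a_le[of x] facet_subset[OF F(1)] F(2) by auto
    finally show "\<bar>a x \<bullet> nrm F\<bar> * (v x)\<^sup>2 \<le> L * (v x)\<^sup>2" by (intro mult_right_mono) auto
  qed (intro bdcontI continuous_intros a_cont poly_cont poly)+
  also have "\<dots> \<le> L * (Ct / h * (\<tau> * P2))"
    unfolding bd_integral_cmult using tr(1) v pos' by (intro mult_left_mono) (auto simp: P2_def)
  also have "\<dots> = Ct * ((\<tau> * (L / h)) * P2)" by simp
  also have "\<dots> \<le> Ct * (C\<tau> * P2)"
    using tau1 P2_nonneg pos by (intro mult_left_mono mult_right_mono) auto
  finally show ?thesis by simp
qed

lemma norm2_v: "norm2 v \<le> (C\<tau> + Ca * C\<tau> * Ci + Cp * (Ct * C\<tau> / Ci) + Ct * C\<tau>) * P2"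
proof -
  have "Cp * (\<kappa> / h * bnd (\<lambda>n x. (v x)\<^sup>2)) \<le> Cp * (Ct * C\<tau> / Ci * P2)"
    using trace_v Cp_pos by (intro mult_left_mono) auto
  then show ?thesis
    using energy_v flux_v unfolding norm2_def by (simp add: algebra_simps)
qed

text \<open>The test function is itself measured in the streamline term. The inverse inequality
  leaves the square of \<open>\<tau> * (L / h)\<close>, which \<open>tau1\<close> bounds.\<close>

lemma streamline_v: "\<tau> * I (\<lambda>x. (a x \<bullet> grad v x)\<^sup>2) \<le> C\<tau>\<^sup>2 * Ci * P2"
proof -
  have "I (\<lambda>x. (a x \<bullet> grad v x)\<^sup>2) \<le> I (\<lambda>x. L\<^sup>2 * (norm (grad v x))\<^sup>2)"
  proof (rule set_integral_mono)
    fix x assume "x \<in> interior K"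
    then have "norm (a x) \<le> L" using a_le interior_subset by blast
    then have "\<bar>a x \<bullet> grad v x\<bar> \<le> L * norm (grad v x)"
      using Cauchy_Schwarz_ineq2[of "a x" "grad v x"] by (meson mult_right_mono norm_ge_zero order_trans)
    then have "(a x \<bullet> grad v x)\<^sup>2 \<le> (L * norm (grad v x))\<^sup>2"
      using pos' by (subst abs_le_square_iff[symmetric]) (simp add: abs_mult)
    then show "(a x \<bullet> grad v x)\<^sup>2 \<le> L\<^sup>2 * (norm (grad v x))\<^sup>2" by (simp add: power_mult_distrib)
  qed (intro integrable_interior bcont_interior continuous_intros a_cont poly_cont poly)+
  also have "\<dots> = L\<^sup>2 * energy v" by simp
  also have "\<dots> \<le> L\<^sup>2 * (Ci / h\<^sup>2 * (\<tau> * P2))"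
    using inv(1) v by (intro mult_left_mono) (auto simp: P2_def)
  finally have "\<tau> * I (\<lambda>x. (a x \<bullet> grad v x)\<^sup>2) \<le> \<tau> * (L\<^sup>2 * (Ci / h\<^sup>2 * (\<tau> * P2)))"
    using pos' by (intro mult_left_mono) auto
  also have "\<dots> = (\<tau> * (L / h))\<^sup>2 * (Ci * P2)" by (simp add: power_mult_distrib power_divide power2_eq_square)
  also have "\<dots> \<le> C\<tau>\<^sup>2 * (Ci * P2)"
    using tau1 pos pos' P2_nonneg by (intro mult_right_mono power_mono) auto
  finally show ?thesis by simp
qed

text \<open>Each of the six terms other than the streamline term is split by Young's inequality at the price of
  \<open>P2 / 12\<close>, which leaves half of \<open>P2\<close>.\<close>

lemma stability:
  "P2 / 2 - stability_const Ct Ci Cp Ca C\<tau> * (\<kappa> * energy w + norm2 q) \<le>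
     I (\<lambda>x. v x * (a x \<bullet> grad w x)) - \<kappa> * I (\<lambda>x. v x * laplacian w x)
     - I (\<lambda>x. q x * (a x \<bullet> grad v x)) + (\<kappa> + \<kappa>a) * I (\<lambda>x. grad q x \<bullet> grad v x)
     + bnd (\<lambda>n x. q x * v x * max (a x \<bullet> n) 0) - \<kappa> * bnd (\<lambda>n x. v x * (grad q x \<bullet> n))
     - \<kappa> * bnd (\<lambda>n x. q x * (grad v x \<bullet> n)) + Cp * \<kappa> / h * bnd (\<lambda>n x. q x * v x)"
proof -
  define X where "X = \<kappa> * energy w"
  define Y where "Y = (\<kappa> + \<kappa>a) * energy q"
  define Z where "Z = Cp * \<kappa> / h * bnd (\<lambda>n x. (q x)\<^sup>2)"
  define N where "N = bnd (\<lambda>n x. \<bar>a x \<bullet> n\<bar> * (q x)\<^sup>2)"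
  have nn: "0 \<le> X" "0 \<le> Y" "0 \<le> Z" "0 \<le> N"
    unfolding X_def Y_def Z_def N_def using pos Cp_pos energy_nonneg
    by (auto intro!: mult_nonneg_nonneg divide_nonneg_pos bd_integral_nonneg)
  have t1: "\<bar>\<kappa> * I (\<lambda>x. v x * laplacian w x)\<bar> \<le> P2 / 12 + 3 * C\<tau> * X"
  proof -
    have "\<bar>I (\<lambda>x. v x * laplacian w x)\<bar> \<le> 1 / (12 * (\<kappa> * \<tau>)) * I (\<lambda>x. (v x)\<^sup>2) + 3 * (\<kappa> * \<tau>) * I (\<lambda>x. (laplacian w x)\<^sup>2)"
    proof (rule set_integral_young)
      show "\<bar>v x * laplacian w x\<bar> \<le> 1 / (12 * (\<kappa> * \<tau>)) * (v x)\<^sup>2 + 3 * (\<kappa> * \<tau>) * (laplacian w x)\<^sup>2" for x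
        using young[of "3 * (\<kappa> * \<tau>)" "laplacian w x" "v x"] pos pos' by (simp add: mult.commute[of "v x"])
    qed (intro bcont_interior continuous_intros poly_cont poly)+
    also have "\<dots> \<le> 1 / (12 * (\<kappa> * \<tau>)) * (\<tau> * P2) + 3 * (\<kappa> * \<tau>) * (Ci / h\<^sup>2 * energy w)"
      using inv(2) v pos pos' by (intro add_mono mult_left_mono) (auto simp: P2_def)
    finally have "\<kappa> * \<bar>I (\<lambda>x. v x * laplacian w x)\<bar> \<le>
        \<kappa> * (1 / (12 * (\<kappa> * \<tau>)) * (\<tau> * P2) + 3 * (\<kappa> * \<tau>) * (Ci / h\<^sup>2 * energy w))"
      using pos by (intro mult_left_mono) auto
    also have "\<dots> = P2 / 12 + 3 * ((\<tau> * (Ci * \<kappa> / h\<^sup>2)) * X)"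
      using pos pos' by (simp add: X_def field_simps)
    also have "\<dots> \<le> P2 / 12 + 3 * (C\<tau> * X)"
      using tau2 nn by (intro add_left_mono mult_left_mono mult_right_mono) auto
    finally show ?thesis using pos by (simp add: abs_mult)
  qed
  \<comment> \<open>Integration by parts replaces minus the integral of q (a . grad v) by the
    integral of v (a . grad q) minus the full flux. Together with the \<open>w\<close> term the
    volume part is exactly \<open>P2\<close>; what stays on the boundary is max(a . n, 0) - a . n,
    of modulus at most |a . n|.\<close>
  have t2: "\<bar>bnd (\<lambda>n x. q x * v x * max (a x \<bullet> n) 0) - bnd (\<lambda>n x. q x * v x * (a x \<bullet> n))\<bar> \<le> P2 / 12 + 3 * (Ct * C\<tau>) * N"
  proof -
    have c: "0 < 3 * (Ct * C\<tau>)" using pos pos' by simp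
    have "bnd (\<lambda>n x. q x * v x * max (a x \<bullet> n) 0) - bnd (\<lambda>n x. q x * v x * (a x \<bullet> n)) =
      bnd (\<lambda>n x. q x * v x * max (a x \<bullet> n) 0 - q x * v x * (a x \<bullet> n))"
      by (intro bd_integral_diff[symmetric] bdcontI continuous_intros a_cont poly_cont poly)
    also have "\<bar>\<dots>\<bar> \<le> 3 * (Ct * C\<tau>) * N + 1 / (4 * (3 * (Ct * C\<tau>))) * bnd (\<lambda>n x. \<bar>a x \<bullet> n\<bar> * (v x)\<^sup>2)"
      unfolding N_def
    proof (rule bd_integral_young)
      fix n x
      have "\<bar>q x * v x * max (a x \<bullet> n) 0 - q x * v x * (a x \<bullet> n)\<bar> \<le> \<bar>a x \<bullet> n\<bar> * \<bar>q x * v x\<bar>"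
        by (auto simp: max_def abs_mult)
      also have "\<dots> \<le> \<bar>a x \<bullet> n\<bar> * (3 * (Ct * C\<tau>) * (q x)\<^sup>2 + 1 / (4 * (3 * (Ct * C\<tau>))) * (v x)\<^sup>2)"
        by (intro mult_left_mono young c) simp
      finally show "\<bar>q x * v x * max (a x \<bullet> n) 0 - q x * v x * (a x \<bullet> n)\<bar> \<le>
          3 * (Ct * C\<tau>) * (\<bar>a x \<bullet> n\<bar> * (q x)\<^sup>2) + 1 / (4 * (3 * (Ct * C\<tau>))) * (\<bar>a x \<bullet> n\<bar> * (v x)\<^sup>2)"
        by (simp add: algebra_simps)
    qed (intro bdcontI continuous_intros a_cont poly_cont poly)+
    also have "\<dots> \<le> 3 * (Ct * C\<tau>) * N + 1 / (4 * (3 * (Ct * C\<tau>))) * (Ct * C\<tau> * P2)"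
      using flux_v c by (intro add_left_mono mult_left_mono) auto
    also have "1 / (4 * (3 * (Ct * C\<tau>))) * (Ct * C\<tau> * P2) = P2 / 12"
      using pos pos' by (simp add: field_simps)
    finally show ?thesis by (simp only: add.commute)
  qed
  \<comment> \<open>The constant of \<open>energy_v\<close> for both diffusivities together.\<close>
  define C3 where "C3 = C\<tau> + Ca * C\<tau> * Ci"
  have C3: "0 < C3" unfolding C3_def using pos' by (intro add_pos_nonneg) auto
  have t3: "\<bar>(\<kappa> + \<kappa>a) * I (\<lambda>x. grad q x \<bullet> grad v x)\<bar> \<le> P2 / 12 + 3 * C3 * Y"
  proof -
    have "(\<kappa> + \<kappa>a) * \<bar>I (\<lambda>x. grad q x \<bullet> grad v x)\<bar> \<le> (\<kappa> + \<kappa>a) * (3 * C3 * energy q + 1 / (4 * (3 * C3)) * energy v)"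
      using grad_young[OF poly(3) poly(2), of "3 * C3"] C3 pos by (intro mult_left_mono) auto
    also have "\<dots> = 3 * C3 * Y + 1 / (12 * C3) * (\<kappa> * energy v + \<kappa>a * energy v)"
      by (simp add: Y_def algebra_simps add_divide_distrib)
    also have "\<dots> \<le> 3 * C3 * Y + 1 / (12 * C3) * (C3 * P2)"
      using energy_v C3 by (intro add_left_mono mult_left_mono) (auto simp: C3_def algebra_simps)
    finally show ?thesis using C3 pos by (simp add: abs_mult add.commute)
  qed
  \<comment> \<open>The constant of \<open>trace_v\<close>.\<close>
  define C4 where "C4 = Ct * C\<tau> / Ci"
  have C4: "0 < C4" unfolding C4_def using pos pos' by simp
  have t4: "\<bar>\<kappa> * bnd (\<lambda>n x. v x * (grad q x \<bullet> n))\<bar> \<le> P2 / 12 + 3 * (Ct * C4) * Y"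
  proof -
    have "\<bar>bnd (\<lambda>n x. (grad q x \<bullet> n) * v x)\<bar> \<le> 3 * C4 * h * bnd (\<lambda>n x. (grad q x \<bullet> n)\<^sup>2) + 1 / (4 * (3 * C4 * h)) * bnd (\<lambda>n x. (v x)\<^sup>2)"
      by (rule bd_young[OF bdcont_poly(2)[OF poly(2)] bdcont_poly(1)[OF poly(3)]]) (use C4 pos in simp)
    also have "\<dots> \<le> 3 * C4 * h * (Ct / h * energy q) + 1 / (4 * (3 * C4 * h)) * bnd (\<lambda>n x. (v x)\<^sup>2)"
      using tr(3) C4 pos by (intro add_right_mono mult_left_mono) auto
    finally have "\<kappa> * \<bar>bnd (\<lambda>n x. (grad q x \<bullet> n) * v x)\<bar> \<le>
       \<kappa> * (3 * C4 * h * (Ct / h * energy q) + 1 / (4 * (3 * C4 * h)) * bnd (\<lambda>n x. (v x)\<^sup>2))"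
      using pos by (intro mult_left_mono) auto
    also have "\<dots> = 3 * (Ct * C4) * (\<kappa> * energy q) + 1 / (12 * C4) * (\<kappa> / h * bnd (\<lambda>n x. (v x)\<^sup>2))"
      using pos C4 by (simp add: field_simps)
    also have "\<dots> \<le> 3 * (Ct * C4) * Y + 1 / (12 * C4) * (C4 * P2)"
    proof (intro add_mono mult_left_mono)
      show "\<kappa> * energy q \<le> Y" unfolding Y_def using pos by (intro mult_right_mono energy_nonneg) simp
      show "\<kappa> / h * bnd (\<lambda>n x. (v x)\<^sup>2) \<le> C4 * P2" using trace_v by (simp only: C4_def)
    qed (use C4 pos in simp_all)
    finally show ?thesis using C4 pos by (simp add: abs_mult add.commute mult.commute[of "v _"])
  qed
  have t5: "\<bar>\<kappa> * bnd (\<lambda>n x. q x * (grad v x \<bullet> n))\<bar> \<le> P2 / 12 + 3 * (Ct * C\<tau> / Cp) * Z"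
  proof -
    \<comment> \<open>Two readings of one weight: with \<open>Cp / h\<close> it produces the penalty
      \<open>Z\<close>, and without \<open>Cp\<close> it cancels the \<open>Ct / h\<close> of the
      trace inequality.\<close>
    define t where "t = 3 * (Ct * C\<tau> / Cp) * (Cp / h)"
    have t: "0 < t" "t = 3 * (Ct * C\<tau>) / h" unfolding t_def using pos pos' Cp_pos by auto
    have "\<bar>bnd (\<lambda>n x. q x * (grad v x \<bullet> n))\<bar> \<le> t * bnd (\<lambda>n x. (q x)\<^sup>2) + 1 / (4 * t) * bnd (\<lambda>n x. (grad v x \<bullet> n)\<^sup>2)"
      by (rule bd_young[OF bdcont_poly(1)[OF poly(2)] bdcont_poly(2)[OF poly(3)] t(1)])
    also have "\<dots> \<le> t * bnd (\<lambda>n x. (q x)\<^sup>2) + 1 / (4 * t) * (Ct / h * energy v)"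
      using tr(2) t(1) by (intro add_left_mono mult_left_mono) auto
    finally have "\<kappa> * \<bar>bnd (\<lambda>n x. q x * (grad v x \<bullet> n))\<bar> \<le>
       \<kappa> * (t * bnd (\<lambda>n x. (q x)\<^sup>2) + 1 / (4 * t) * (Ct / h * energy v))"
      using pos by (intro mult_left_mono) auto
    also have "\<dots> = \<kappa> * t * bnd (\<lambda>n x. (q x)\<^sup>2) + 1 / (12 * C\<tau>) * (\<kappa> * energy v)"
      unfolding t(2) using pos pos' by (simp add: field_simps)
    also have "\<kappa> * t * bnd (\<lambda>n x. (q x)\<^sup>2) = 3 * (Ct * C\<tau> / Cp) * Z"
      by (simp add: t_def Z_def)
    also have "1 / (12 * C\<tau>) * (\<kappa> * energy v) \<le> 1 / (12 * C\<tau>) * (C\<tau> * P2)"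
      using energy_v(1) pos' by (intro mult_left_mono) auto
    finally show ?thesis using pos pos' by (simp add: abs_mult add.commute)
  qed
  have t6: "\<bar>Cp * \<kappa> / h * bnd (\<lambda>n x. q x * v x)\<bar> \<le> P2 / 12 + 3 * (Cp * C4) * Z"
  proof -
    have c: "0 < Cp * C4" using Cp_pos C4 by simp
    have "\<bar>bnd (\<lambda>n x. q x * v x)\<bar> \<le> 3 * (Cp * C4) * bnd (\<lambda>n x. (q x)\<^sup>2) + 1 / (4 * (3 * (Cp * C4))) * bnd (\<lambda>n x. (v x)\<^sup>2)"
      by (rule bd_young[OF bdcont_poly(1)[OF poly(2)] bdcont_poly(1)[OF poly(3)]]) (use c in simp)
    then have "Cp * \<kappa> / h * \<bar>bnd (\<lambda>n x. q x * v x)\<bar> \<le>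
       Cp * \<kappa> / h * (3 * (Cp * C4) * bnd (\<lambda>n x. (q x)\<^sup>2) + 1 / (4 * (3 * (Cp * C4))) * bnd (\<lambda>n x. (v x)\<^sup>2))"
      using pos Cp_pos by (intro mult_left_mono) auto
    also have "\<dots> = 3 * (Cp * C4) * Z + 1 / (12 * C4) * (\<kappa> / h * bnd (\<lambda>n x. (v x)\<^sup>2))"
      using Cp_pos by (simp add: Z_def distrib_left ac_simps)
    also have "\<dots> \<le> 3 * (Cp * C4) * Z + 1 / (12 * C4) * (C4 * P2)"
      using trace_v[folded C4_def] C4 by (intro add_left_mono mult_left_mono) simp_all
    finally show ?thesis using C4 pos Cp_pos by (simp add: abs_mult add.commute)
  qed
  have orthP: "I (\<lambda>x. v x * (a x \<bullet> grad w x)) + I (\<lambda>x. v x * (a x \<bullet> grad q x)) = P2"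
    using orth by (simp add: P2_def)
  define D where "D = stability_const Ct Ci Cp Ca C\<tau>"
  have Deq: "D = 3 * C\<tau> + 3 * (Ct * C\<tau>) + 3 * C3 + 3 * (Ct * C4) + 3 * (Ct * C\<tau> / Cp) + 3 * (Cp * C4)"
    by (simp add: D_def stability_const_def C3_def C4_def)
  have nnC: "0 \<le> 3 * C\<tau>" "0 \<le> 3 * (Ct * C\<tau>)" "0 \<le> 3 * C3" "0 \<le> 3 * (Ct * C4)" "0 \<le> 3 * (Ct * C\<tau> / Cp)" "0 \<le> 3 * (Cp * C4)"
    using pos pos' Cp_pos C3 C4 by auto
  have "3 * C\<tau> * X + 3 * (Ct * C\<tau>) * N + 3 * C3 * Y + 3 * (Ct * C4) * Y + 3 * (Ct * C\<tau> / Cp) * Z + 3 * (Cp * C4) * Z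
      \<le> D * X + D * N + D * Y + D * Z"
  proof -
    have "3 * C\<tau> * X \<le> D * X" using nn nnC by (intro mult_right_mono) (simp_all add: Deq)
    moreover have "3 * (Ct * C\<tau>) * N \<le> D * N" using nn nnC by (intro mult_right_mono) (simp_all add: Deq)
    moreover have "(3 * C3 + 3 * (Ct * C4)) * Y \<le> D * Y" using nn nnC by (intro mult_right_mono) (simp_all add: Deq)
    moreover have "(3 * (Ct * C\<tau> / Cp) + 3 * (Cp * C4)) * Z \<le> D * Z" using nn nnC by (intro mult_right_mono) (simp_all add: Deq)
    ultimately show ?thesis by (simp only: distrib_right)
  qed
  moreover have "D * X + D * N + D * Y + D * Z = D * (\<kappa> * energy w + norm2 q)"
    by (simp add: X_def Y_def Z_def N_def norm2_def algebra_simps)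
  ultimately show ?thesis
    using t1 t2 t3 t4 t5 t6 orthP advection_parts[OF poly(2,3)]
    unfolding D_def[symmetric] by linarith
qed

end

end

section \<open>The discrete problem\<close>

lemma L2_norm_square: "(L2_norm D f)\<^sup>2 = (LINT x:D|lebesgue. (f x)\<^sup>2)"
  unfolding L2_norm_def by (simp add: set_integral_nonneg_real)

lemma H1_seminorm_square: "(H1_seminorm D f)\<^sup>2 = (LINT x:D|lebesgue. (norm (grad f x))\<^sup>2)"
  unfolding H1_seminorm_def L2_norm_square ..

lemma (in solid_polytope) bd_norm_square: "(bd_norm K g)\<^sup>2 = bd_integral K (\<lambda>n x. (g n x)\<^sup>2)"
  unfolding bd_norm_def by (simp add: bd_integral_nonneg)

context solid_polytope
begin

lemma diameter_pos: "0 < diameter K"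
proof -
  obtain x r where r: "0 < r" "ball x r \<subseteq> K"
    using interior_nonempty by (auto simp: mem_interior)
  obtain b :: 'a where b: "b \<in> Basis" using nonempty_Basis by blast
  have "x \<in> K" "x + (r/2) *\<^sub>R b \<in> K" using r b by (auto intro!: subsetD[OF r(2)] simp: dist_norm)
  then have "dist x (x + (r/2) *\<^sub>R b) \<le> diameter K"
    by (intro diameter_bounded_bound compact_imp_bounded[OF compact])
  then show ?thesis using r b by (simp add: dist_norm)
qed

text \<open>\<open>real_of_ereal\<close> maps infinite values to 0, so finiteness of the essential
  supremum comes first. For a continuous field the set where it is exceeded is open and negligible,
  hence empty, and the bound passes to the closed cell.\<close>

lemma Linf_norm_bound:
  assumes a: "continuous_on K a"
  shows "0 \<le> Linf_norm (interior K) a" "x \<in> K \<Longrightarrow> norm (a x) \<le> Linf_norm (interior K) a"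
proof -
  define S where "S = interior K"
  have S: "open S" "S \<noteq> {}" using interior_nonempty by (auto simp: S_def)
  have aS: "continuous_on S a" using a interior_subset unfolding S_def by (rule continuous_on_subset)
  define E where "E = esssup (lebesgue_on S) (\<lambda>x. ereal (norm (a x)))"
  have Sm: "S \<in> sets lebesgue" using S by (simp add: lmeasurable_open borel_open sets_completionI_sets)
  have m: "(\<lambda>x. ereal (norm (a x))) \<in> borel_measurable (lebesgue_on S)"
    using Sm aS by (intro borel_measurable_ereal continuous_imp_measurable_on_sets_lebesgue continuous_on_norm)
  obtain B where B: "\<And>x. x \<in> K \<Longrightarrow> norm (a x) \<le> B"
    using compact_imp_bounded[OF compact_continuous_image[OF a compact]] by (auto simp: bounded_iff)
  have "E \<le> ereal B"
    unfolding E_def using B interior_subset by (intro esssup_I m AE_I2) (auto simp: S_def)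
  \<comment> \<open>On a null space the essential supremum would be minus infinity; a nonempty open
    set has positive measure.\<close>
  moreover have "0 \<le> E"
  proof -
    have "emeasure (lebesgue_on S) (space (lebesgue_on S)) \<noteq> 0"
      using S Sm open_not_negligible[OF S] by (simp add: emeasure_restrict_space negligible_iff_emeasure0)
    then have "esssup (lebesgue_on S) (\<lambda>x. 0 :: ereal) = 0" by (rule esssup_const)
    moreover have "esssup (lebesgue_on S) (\<lambda>x. 0 :: ereal) \<le> E"
    proof -
      have nn: "(0::ereal) \<le> ereal (norm (a x))" for x by simp
      show ?thesis unfolding E_def by (rule esssup_mono[OF _ nn]) simp
    qed
    ultimately show ?thesis by simp
  qed
  ultimately obtain r where r: "E = ereal r" "0 \<le> r" by (cases E) auto
  have L: "Linf_norm (interior K) a = r" using r by (simp add: Linf_norm_def E_def S_def)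
  then show "0 \<le> Linf_norm (interior K) a" using r by simp
  have "AE x in lebesgue_on S. norm (a x) \<le> r"
    using esssup_AE[of "\<lambda>x. ereal (norm (a x))" "lebesgue_on S"] r unfolding E_def by simp
  then have ae: "AE x in lebesgue. x \<in> S \<longrightarrow> norm (a x) \<le> r"
    using Sm by (simp add: AE_restrict_space_iff)
  define O' where "O' = {x \<in> S. r < norm (a x)}"
  have "open O'"
  proof -
    have "open (S \<inter> (\<lambda>x. norm (a x)) -` {r<..})"
      using aS S by (intro continuous_open_preimage continuous_on_norm) auto
    moreover have "O' = S \<inter> (\<lambda>x. norm (a x)) -` {r<..}" by (auto simp: O'_def)
    ultimately show ?thesis by simp
  qed
  moreover have "negligible O'"
  proof -
    have "{x. \<not> (x \<in> S \<longrightarrow> norm (a x) \<le> r)} \<in> null_sets lebesgue"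
      using ae unfolding completion.AE_iff_null_sets by simp
    moreover have "O' = {x. \<not> (x \<in> S \<longrightarrow> norm (a x) \<le> r)}" by (auto simp: O'_def)
    ultimately show ?thesis by (simp add: negligible_iff_null_sets)
  qed
  ultimately have "O' = {}" using open_not_negligible by blast
  then have le: "norm (a y) \<le> r" if "y \<in> S" for y using that by (force simp: O'_def)
  show "norm (a x) \<le> Linf_norm (interior K) a" if "x \<in> K"
    unfolding L
  proof (rule continuous_le_on_closure[where f="\<lambda>x. norm (a x)" and S=S])
    show "continuous_on (closure S) (\<lambda>x. norm (a x))"
      using a by (simp add: S_def closure_interior_K continuous_on_norm)
    show "x \<in> closure S" using that by (simp add: S_def closure_interior_K)
  qed (use le in auto)
qed

lemma gradient_term_0:
  assumes q: "real_polynomial_function q" and 0: "(LINT x:interior K|lebesgue. (norm (grad q x))\<^sup>2) = 0"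
  shows "(LINT x:interior K|lebesgue. f x * (g x \<bullet> grad q x)) = 0"
proof -
  have "bcont (interior K) (\<lambda>x. norm (grad q x))"
    by (intro bcont_interior continuous_intros continuous_on_grad_polynomial q)
  from square_integral_0_AE[OF open_bounded_interior this 0]
  have "AE x in lebesgue. indicator (interior K) x *\<^sub>R (f x * (g x \<bullet> grad q x)) = 0"
    by eventually_elim (auto simp: indicator_def)
  then show ?thesis unfolding set_lebesgue_integral_def by (rule integral_eq_zero_AE)
qed

text \<open>Testing the divergence theorem with \<open>q\<^sup>2 x\<close>.\<close>

lemma zero_of_zero_energy:
  assumes q: "real_polynomial_function q" and e: "(LINT x:interior K|lebesgue. (norm (grad q x))\<^sup>2) = 0"
    and b: "bd_integral K (\<lambda>n x. (q x)\<^sup>2) = 0"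
  shows "(LINT x:interior K|lebesgue. (q x)\<^sup>2) = 0"
proof -
  obtain R where R: "\<And>x. x \<in> K \<Longrightarrow> norm x \<le> R"
    using compact_imp_bounded[OF compact] by (auto simp: bounded_iff)
  note qc = continuous_on_polynomial[OF q] continuous_on_grad_polynomial[OF q]
  have d: "(\<Sum>b\<in>Basis. (b::'a) \<bullet> b) = real DIM('a)" by simp
  have eq: "q x * (x \<bullet> grad q x) + q x * (x \<bullet> grad q x) + q x * q x * (\<Sum>b\<in>Basis. (b::'a) \<bullet> b) =
    (2 * q x) * (x \<bullet> grad q x) + DIM('a) * (q x)\<^sup>2" for x
    unfolding d power2_eq_square by (simp add: algebra_simps)
  have "bd_integral K (\<lambda>n x. q x * q x * (x \<bullet> n)) =
      (LINT x:interior K|lebesgue. (2 * q x) * (x \<bullet> grad q x) + DIM('a) * (q x)\<^sup>2)"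
    unfolding advection_by_parts[OF C1_closure_id q q, symmetric] eq ..
  also have "\<dots> = (LINT x:interior K|lebesgue. (2 * q x) * (x \<bullet> grad q x)) + (LINT x:interior K|lebesgue. DIM('a) * (q x)\<^sup>2)"
    by (intro set_integral_add(2) integrable_interior bcont_interior continuous_intros qc)
  also have "(LINT x:interior K|lebesgue. (2 * q x) * (x \<bullet> grad q x)) = 0"
    by (rule gradient_term_0[OF q e])
  finally have main: "bd_integral K (\<lambda>n x. q x * q x * (x \<bullet> n)) = DIM('a) * (LINT x:interior K|lebesgue. (q x)\<^sup>2)"
    by simp
  have "\<bar>bd_integral K (\<lambda>n x. q x * q x * (x \<bullet> n))\<bar> \<le> R * bd_integral K (\<lambda>n x. (q x)\<^sup>2) + 0 * bd_integral K (\<lambda>n x. (q x)\<^sup>2)"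
  proof (rule bd_integral_young)
    fix n x :: 'a assume x: "x \<in> K" "norm n = 1"
    have "\<bar>x \<bullet> n\<bar> \<le> R" using Cauchy_Schwarz_ineq2[of x n] R[OF x(1)] x(2) by simp
    then have "(q x)\<^sup>2 * \<bar>x \<bullet> n\<bar> \<le> (q x)\<^sup>2 * R" by (intro mult_left_mono) auto
    then show "\<bar>q x * q x * (x \<bullet> n)\<bar> \<le> R * (q x)\<^sup>2 + 0 * (q x)\<^sup>2"
      by (simp add: abs_mult power2_eq_square mult.commute)
  qed (intro bdcontI continuous_intros qc)+
  then show ?thesis unfolding main b by simp
qed

end

locale discretisation = mesh s \<Omega> \<M> for s and \<Omega> :: "'a::euclidean_space set" and \<M> +
  fixes p pf :: nat and a :: "'a \<Rightarrow> 'a" and a' and \<kappa> :: real and \<kappa>a :: "'a set \<Rightarrow> real"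
    and Ct Ci Cp Ca C\<tau> :: real
  assumes field: "C1_closure \<Omega> a a'"
    and div0: "\<And>x. x \<in> \<Omega> \<Longrightarrow> (\<Sum>b\<in>Basis. a' x b \<bullet> b) = 0"
    and pos: "0 < \<kappa>" "0 < Ct" "8 * Ct \<le> Cp" "0 < Ci" "0 \<le> Ca" "0 < C\<tau>"
    and trace: "trace_inequalities Ct \<M> (V_bar s p \<Omega> \<M> \<union> V_disc s pf \<M>)"
    and inverse: "inverse_inequalities Ci \<M> (V_bar s p \<Omega> \<M> \<union> V_disc s pf \<M>)"
    and art: "\<And>K. K \<in> \<M> \<Longrightarrow> \<kappa>a K = Ca * Fields.inverse (rate Ci \<kappa> a K) * (Linf_norm (interior K) a)\<^sup>2"
begin

abbreviation "\<tau> \<equiv> tau C\<tau> Ci \<kappa> a"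

lemma a_cont: "continuous_on (closure \<Omega>) a"
  using field by (simp add: C1_closure_def)

lemma a_cont_cell: "K \<in> \<M> \<Longrightarrow> continuous_on K a"
  by (rule continuous_on_subset[OF a_cont cell_subset])

text \<open>The rate is positive because its diffusive entry is, so the inverses in both parameters
  are genuine. Being a maximum it dominates either entry, which gives the two bounds on
  \<open>\<tau> K\<close>.\<close>

lemma stabilised_cell:
  assumes K: "K \<in> \<M>"
  shows "stabilised_cell_estimate K a a' \<kappa> (\<kappa>a K) (diameter K) (Linf_norm (interior K) a) Ct Cp (\<tau> K) Ci C\<tau> Ca"
proof -
  interpret solid_polytope K using K by (rule solid)
  define L where "L = Linf_norm (interior K) a"
  define h where "h = diameter K"
  define r where "r = rate Ci \<kappa> a K"
  have h: "0 < h" unfolding h_def by (rule diameter_pos)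
  have L: "0 \<le> L" "\<And>x. x \<in> K \<Longrightarrow> norm (a x) \<le> L"
    unfolding L_def using Linf_norm_bound[OF a_cont_cell[OF K]] by auto
  have rL: "L / h \<le> r" "Ci * \<kappa> / h\<^sup>2 \<le> r" by (simp_all add: r_def rate_def L_def h_def)
  have "0 < Ci * \<kappa> / h\<^sup>2" using pos h by simp
  then have r: "0 < r" using rL by linarith
  have \<tau>: "\<tau> K = C\<tau> / r" by (simp add: tau_def r_def divide_inverse)
  have \<kappa>a: "\<kappa>a K = Ca / r * L\<^sup>2" using art[OF K] by (simp add: r_def L_def divide_inverse)
  have scale: "C\<tau> / r * y \<le> C\<tau>" if "y \<le> r" for y
    using that r pos by (simp add: divide_le_eq mult_le_cancel_left)
  \<comment> \<open>The powers of \<open>L\<close>, \<open>h\<close> and the rate \<open>r\<close>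
    combine into the square of \<open>L / h / r\<close>, which is at most 1.\<close>
  have "Ca / r * L\<^sup>2 * (C\<tau> / r * Ci / h\<^sup>2) = Ca * C\<tau> * Ci * (L / h / r)\<^sup>2"
    by (simp add: power2_eq_square ac_simps)
  also have "\<dots> \<le> Ca * C\<tau> * Ci * 1"
  proof (rule mult_left_mono)
    have "0 \<le> L / h / r" "L / h / r \<le> 1" using L h r rL by (simp_all add: divide_le_eq mult.commute)
    then show "(L / h / r)\<^sup>2 \<le> 1" by (rule power_le_one)
  qed (use pos in simp)
  finally have art': "Ca / r * L\<^sup>2 * (C\<tau> / r * Ci / h\<^sup>2) \<le> Ca * C\<tau> * Ci" by simp
  show ?thesis
    unfolding L_def[symmetric] h_def[symmetric] \<tau> \<kappa>a
  proof unfold_locales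
    show "C1_closure (interior K) a a'" by (rule C1_closure_subset[OF field interior_cell_subset[OF K]])
    show "(\<Sum>b\<in>Basis. a' x b \<bullet> b) = 0" if "x \<in> interior K" for x
      using div0 interior_cell_subset[OF K] that by blast
    show "C\<tau> / r * (L / h) \<le> C\<tau>" "C\<tau> / r * (Ci * \<kappa> / h\<^sup>2) \<le> C\<tau>"
      by (rule scale[OF rL(1)], rule scale[OF rL(2)])
    show "Ca / r * L\<^sup>2 * (C\<tau> / r * Ci / h\<^sup>2) \<le> Ca * C\<tau> * Ci" by (rule art')
  qed (use pos h r L in simp_all)
qed

section \<open>From discrete functions to their polynomials on a cell\<close>

lemma integral_grad_cell:
  assumes K: "K \<in> \<M>" and eq: "\<forall>x\<in>interior K. u x = q x"
  shows "x \<in> interior K \<Longrightarrow> grad u x = grad q x" "x \<in> interior K \<Longrightarrow> laplacian u x = laplacian q x"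
  using eq by (auto intro!: grad_cong_open[of "interior K"] laplacian_cong_open[of "interior K"])

definition cell_norm2 :: "'a set \<Rightarrow> ('a \<Rightarrow> real) \<Rightarrow> real" where
  "cell_norm2 K v = (\<kappa> + \<kappa>a K) * (H1_seminorm (interior K) v)\<^sup>2
     + Cp * \<kappa> / diameter K * (bd_norm K (\<lambda>n. trace_from K v))\<^sup>2
     + (bd_norm K (\<lambda>n x. sqrt \<bar>a x \<bullet> n\<bar> * trace_from K v x))\<^sup>2"

definition cell_form :: "'a set \<Rightarrow> ('a \<Rightarrow> real) \<Rightarrow> ('a \<Rightarrow> real) \<Rightarrow> real" where
  "cell_form K u' v' =
     - (LINT x : interior K | lebesgue. u' x * (a x \<bullet> grad v' x))
     + (LINT x : interior K | lebesgue. (\<kappa> + \<kappa>a K) * (grad u' x \<bullet> grad v' x))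
     + bd_integral K (\<lambda>n x. trace_from K u' x * trace_from K v' x * max (a x \<bullet> n) 0)
     - bd_integral K (\<lambda>n x. \<kappa> * (trace_from K (grad u') x \<bullet> n) * trace_from K v' x)
     - bd_integral K (\<lambda>n x. trace_from K u' x * (\<kappa> * (trace_from K (grad v') x \<bullet> n)))
     + bd_integral K (\<lambda>n x. Cp * \<kappa> / diameter K * (trace_from K u' x * trace_from K v' x))"

text \<open>All quantities in the form and the norm are integrals over open cells or limits from
  inside, so a discrete function may be replaced by the polynomial that it equals there, whatever
  its values on the skeleton.\<close>

lemma cell_transfer:
  assumes K: "K \<in> \<M>" and u: "real_polynomial_function q" "\<forall>x\<in>interior K. u x = q x"
  shows "(L2_norm (interior K) u)\<^sup>2 = (LINT x:interior K|lebesgue. (q x)\<^sup>2)"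
    "(H1_seminorm (interior K) u)\<^sup>2 = (LINT x:interior K|lebesgue. (norm (grad q x))\<^sup>2)"
    "(L2_norm (interior K) (laplacian u))\<^sup>2 = (LINT x:interior K|lebesgue. (laplacian q x)\<^sup>2)"
    "(bd_norm K (\<lambda>n. trace_from K u))\<^sup>2 = bd_integral K (\<lambda>n x. (q x)\<^sup>2)"
    "(bd_norm K (\<lambda>n x. trace_from K (grad u) x \<bullet> n))\<^sup>2 = bd_integral K (\<lambda>n x. (grad q x \<bullet> n)\<^sup>2)"
    "(bd_norm K (\<lambda>n x. sqrt \<bar>a x \<bullet> n\<bar> * trace_from K u x))\<^sup>2 = bd_integral K (\<lambda>n x. \<bar>a x \<bullet> n\<bar> * (q x)\<^sup>2)"
    "\<And>x. x \<in> K \<Longrightarrow> trace_from K u x = q x" "\<And>x. x \<in> K \<Longrightarrow> trace_from K (grad u) x = grad q x"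
proof -
  interpret solid_polytope K using K by (rule solid)
  note g = integral_grad_cell[OF K u(2)]
  show t: "trace_from K u x = q x" "trace_from K (grad u) x = grad q x" if "x \<in> K" for x
    using trace_from_eq[OF continuous_on_polynomial[OF u(1)] bspec[OF u(2)] that]
      trace_from_eq[OF continuous_on_grad_polynomial[OF u(1)] g(1) that] by auto
  have F: "x \<in> K" if "F \<in> facets" "x \<in> F" for F x using that facet_subset by blast
  show "(L2_norm (interior K) u)\<^sup>2 = (LINT x:interior K|lebesgue. (q x)\<^sup>2)"
    unfolding L2_norm_square by (rule set_integral_cong_on) (simp add: u)
  show "(H1_seminorm (interior K) u)\<^sup>2 = (LINT x:interior K|lebesgue. (norm (grad q x))\<^sup>2)"
    unfolding H1_seminorm_square by (rule set_integral_cong_on) (simp add: g)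
  show "(L2_norm (interior K) (laplacian u))\<^sup>2 = (LINT x:interior K|lebesgue. (laplacian q x)\<^sup>2)"
    unfolding L2_norm_square by (rule set_integral_cong_on) (simp add: g)
  show "(bd_norm K (\<lambda>n. trace_from K u))\<^sup>2 = bd_integral K (\<lambda>n x. (q x)\<^sup>2)"
    "(bd_norm K (\<lambda>n x. trace_from K (grad u) x \<bullet> n))\<^sup>2 = bd_integral K (\<lambda>n x. (grad q x \<bullet> n)\<^sup>2)"
    "(bd_norm K (\<lambda>n x. sqrt \<bar>a x \<bullet> n\<bar> * trace_from K u x))\<^sup>2 = bd_integral K (\<lambda>n x. \<bar>a x \<bullet> n\<bar> * (q x)\<^sup>2)"
    unfolding bd_norm_square by (rule bd_integral_cong, simp add: t F power_mult_distrib)+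
qed

lemma cell_form_transfer:
  assumes K: "K \<in> \<M>" and q: "real_polynomial_function q" "\<forall>x\<in>interior K. u x = q x"
    and r: "real_polynomial_function r" "\<forall>x\<in>interior K. v x = r x"
  shows "cell_form K u v =
     - (LINT x:interior K|lebesgue. q x * (a x \<bullet> grad r x)) + (\<kappa> + \<kappa>a K) * (LINT x:interior K|lebesgue. grad q x \<bullet> grad r x)
     + bd_integral K (\<lambda>n x. q x * r x * max (a x \<bullet> n) 0) - \<kappa> * bd_integral K (\<lambda>n x. r x * (grad q x \<bullet> n))
     - \<kappa> * bd_integral K (\<lambda>n x. q x * (grad r x \<bullet> n)) + Cp * \<kappa> / diameter K * bd_integral K (\<lambda>n x. q x * r x)"
proof -
  interpret solid_polytope K using K by (rule solid)
  note gq = integral_grad_cell[OF K q(2)] and gr = integral_grad_cell[OF K r(2)]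
  note tq = cell_transfer(7,8)[OF K q] and tr = cell_transfer(7,8)[OF K r]
  have F: "x \<in> K" if "F \<in> facets" "x \<in> F" for F x using that facet_subset by blast
  have "(LINT x : interior K | lebesgue. u x * (a x \<bullet> grad v x)) = (LINT x:interior K|lebesgue. q x * (a x \<bullet> grad r x))"
    by (rule set_integral_cong_on) (simp add: q(2) gr)
  moreover have "(LINT x : interior K | lebesgue. (\<kappa> + \<kappa>a K) * (grad u x \<bullet> grad v x)) =
     (LINT x:interior K|lebesgue. (\<kappa> + \<kappa>a K) * (grad q x \<bullet> grad r x))"
    by (rule set_integral_cong_on) (simp add: gq gr)
  moreover have "bd_integral K (\<lambda>n x. trace_from K u x * trace_from K v x * max (a x \<bullet> n) 0) =
     bd_integral K (\<lambda>n x. q x * r x * max (a x \<bullet> n) 0)"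
    by (rule bd_integral_cong) (simp add: tq tr F)
  moreover have "bd_integral K (\<lambda>n x. \<kappa> * (trace_from K (grad u) x \<bullet> n) * trace_from K v x) =
     bd_integral K (\<lambda>n x. \<kappa> * (r x * (grad q x \<bullet> n)))"
    by (rule bd_integral_cong) (simp add: tq tr F)
  moreover have "bd_integral K (\<lambda>n x. trace_from K u x * (\<kappa> * (trace_from K (grad v) x \<bullet> n))) =
     bd_integral K (\<lambda>n x. \<kappa> * (q x * (grad r x \<bullet> n)))"
    by (rule bd_integral_cong) (simp add: tq tr F)
  moreover have "bd_integral K (\<lambda>n x. Cp * \<kappa> / diameter K * (trace_from K u x * trace_from K v x)) =
     bd_integral K (\<lambda>n x. Cp * \<kappa> / diameter K * (q x * r x))"
    by (rule bd_integral_cong) (simp add: tq tr F)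
  ultimately show ?thesis
    unfolding cell_form_def by (simp only: bd_integral_cmult set_integral_mult_right)
qed

lemma cell_inequalities:
  assumes K: "K \<in> \<M>" and u: "u \<in> V_bar s p \<Omega> \<M> \<union> V_disc s pf \<M>"
    and q: "real_polynomial_function q" "\<forall>x\<in>interior K. u x = q x"
  shows "bd_integral K (\<lambda>n x. (q x)\<^sup>2) \<le> Ct / diameter K * (LINT x:interior K|lebesgue. (q x)\<^sup>2)"
    "bd_integral K (\<lambda>n x. (grad q x \<bullet> n)\<^sup>2) \<le> Ct / diameter K * (LINT x:interior K|lebesgue. (norm (grad q x))\<^sup>2)"
    "(LINT x:interior K|lebesgue. (norm (grad q x))\<^sup>2) \<le> Ci / (diameter K)\<^sup>2 * (LINT x:interior K|lebesgue. (q x)\<^sup>2)"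
    "(LINT x:interior K|lebesgue. (laplacian q x)\<^sup>2) \<le> Ci / (diameter K)\<^sup>2 * (LINT x:interior K|lebesgue. (norm (grad q x))\<^sup>2)"
proof -
  have t1: "(bd_norm K (\<lambda>n. trace_from K u))\<^sup>2 \<le> Ct / diameter K * (L2_norm (interior K) u)\<^sup>2 \<and>
     (bd_norm K (\<lambda>n x. trace_from K (grad u) x \<bullet> n))\<^sup>2 \<le> Ct / diameter K * (H1_seminorm (interior K) u)\<^sup>2"
    using trace u K unfolding trace_inequalities_def by blast
  have t2: "(H1_seminorm (interior K) u)\<^sup>2 \<le> Ci / (diameter K)\<^sup>2 * (L2_norm (interior K) u)\<^sup>2 \<and>
     (L2_norm (interior K) (laplacian u))\<^sup>2 \<le> Ci / (diameter K)\<^sup>2 * (H1_seminorm (interior K) u)\<^sup>2"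
    using inverse u K unfolding inverse_inequalities_def by blast
  show "bd_integral K (\<lambda>n x. (q x)\<^sup>2) \<le> Ct / diameter K * (LINT x:interior K|lebesgue. (q x)\<^sup>2)"
    using t1 by (simp only: cell_transfer(1-5)[OF K q])
  show "bd_integral K (\<lambda>n x. (grad q x \<bullet> n)\<^sup>2) \<le> Ct / diameter K * (LINT x:interior K|lebesgue. (norm (grad q x))\<^sup>2)"
    using t1 by (simp only: cell_transfer(1-5)[OF K q])
  show "(LINT x:interior K|lebesgue. (norm (grad q x))\<^sup>2) \<le> Ci / (diameter K)\<^sup>2 * (LINT x:interior K|lebesgue. (q x)\<^sup>2)"
    using t2 by (simp only: cell_transfer(1-5)[OF K q])
  show "(LINT x:interior K|lebesgue. (laplacian q x)\<^sup>2) \<le> Ci / (diameter K)\<^sup>2 * (LINT x:interior K|lebesgue. (norm (grad q x))\<^sup>2)"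
    using t2 by (simp only: cell_transfer(1-5)[OF K q])
qed

end

context discretisation
begin

lemma tau_pos: "K \<in> \<M> \<Longrightarrow> 0 < \<tau> K"
  using stabilised_cell_estimate.pos'(1)[OF stabilised_cell] .

definition cell_coupling :: "'a set \<Rightarrow> ('a \<Rightarrow> real) \<Rightarrow> ('a \<Rightarrow> real) \<Rightarrow> real" where
  "cell_coupling K u v' =
     (LINT x : interior K | lebesgue. v' x * (a x \<bullet> grad u x - divg (\<lambda>y. \<kappa> *\<^sub>R grad u y) x))"

lemma cell_coupling_transfer:
  assumes K: "K \<in> \<M>" and w: "real_polynomial_function w" "\<forall>x\<in>interior K. u x = w x"
    and r: "real_polynomial_function r" "\<forall>x\<in>interior K. v x = r x"
  shows "cell_coupling K u v = (LINT x:interior K|lebesgue. r x * (a x \<bullet> grad w x))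
     - \<kappa> * (LINT x:interior K|lebesgue. r x * laplacian w x)"
proof -
  interpret solid_polytope K using K by (rule solid)
  note g = integral_grad_cell(1)[OF K w(2)]
  have "divg (\<lambda>y. \<kappa> *\<^sub>R grad u y) x = \<kappa> * laplacian w x" if x: "x \<in> interior K" for x
  proof -
    have "frechet_derivative (\<lambda>y. \<kappa> *\<^sub>R grad u y) (at x) = frechet_derivative (\<lambda>y. \<kappa> *\<^sub>R grad w y) (at x)"
      by (rule frechet_derivative_cong_open[of "interior K"]) (use x g in auto)
    then have "divg (\<lambda>y. \<kappa> *\<^sub>R grad u y) x = divg (\<lambda>y. \<kappa> *\<^sub>R grad w y) x" by (simp add: divg_def)
    also have "\<dots> = \<kappa> * divg (grad w) x"
      unfolding divg_eq[OF has_derivative_scaleR_right[OF grad_polynomial_has_derivative[OF w(1)]]]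
        divg_eq[OF grad_polynomial_has_derivative[OF w(1)]]
      by (simp add: sum_distrib_left)
    finally show ?thesis by (simp add: laplacian_def)
  qed
  then have "cell_coupling K u v =
      (LINT x:interior K|lebesgue. r x * (a x \<bullet> grad w x) - \<kappa> * (r x * laplacian w x))"
    unfolding cell_coupling_def using g r(2) by (intro set_integral_cong_on) (simp add: right_diff_distrib)
  also have "\<dots> = (LINT x:interior K|lebesgue. r x * (a x \<bullet> grad w x))
     - (LINT x:interior K|lebesgue. \<kappa> * (r x * laplacian w x))"
    by (intro set_integral_diff(2) integrable_interior bcont_interior continuous_intros a_cont_cell K
        continuous_on_polynomial continuous_on_grad_polynomial continuous_on_laplacian_polynomial w r)
  finally show ?thesis by simp
qed

text \<open>The subtracted integral is the cell's share of \<open>Cbar\<close>; it cancels the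
  advective part of the coupling, so only the Laplacian part of the coupling reaches
  \<open>coercive\<close>.\<close>

lemma cell_coercive:
  assumes K: "K \<in> \<M>" and u: "u \<in> V_bar s p \<Omega> \<M>" and u': "u' \<in> V_disc s pf \<M>"
  shows "(\<kappa> * (H1_seminorm (interior K) u)\<^sup>2 + cell_norm2 K u') / 4 \<le>
    \<kappa> * (H1_seminorm (interior K) u)\<^sup>2 - (LINT x:interior K|lebesgue. u' x * (a x \<bullet> grad u x))
      + cell_coupling K u u' + cell_form K u' u'"
proof -
  interpret stabilised_cell_estimate K a a' \<kappa> "\<kappa>a K" "diameter K" "Linf_norm (interior K) a" Ct Cp "\<tau> K" Ci C\<tau> Ca
    using K by (rule stabilised_cell)
  obtain w where w: "real_polynomial_function w" "\<forall>x\<in>interior K. u x = w x"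
    using V_disc_polynomial[OF V_bar_V_disc[OF u] K] by blast
  obtain q where q: "real_polynomial_function q" "\<forall>x\<in>interior K. u' x = q x"
    using V_disc_polynomial[OF u' K] by blast
  have "(LINT x:interior K|lebesgue. u' x * (a x \<bullet> grad u x)) = (LINT x:interior K|lebesgue. q x * (a x \<bullet> grad w x))"
    by (rule set_integral_cong_on) (simp add: integral_grad_cell[OF K w(2)] q(2))
  moreover have "norm2 q = cell_norm2 K u'"
    unfolding norm2_def cell_norm2_def by (simp only: cell_transfer(2,4,6)[OF K q])
  moreover have "energy w = (H1_seminorm (interior K) u)\<^sup>2"
    by (simp only: cell_transfer(2)[OF K w])
  moreover have "(energy :: ('a \<Rightarrow> real) \<Rightarrow> real) q = I (\<lambda>x. grad q x \<bullet> grad q x)"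
    by (simp add: power2_norm_eq_inner)
  moreover have "bnd (\<lambda>n x. (q x)\<^sup>2) = bnd (\<lambda>n x. q x * q x)"
    by (simp add: power2_eq_square)
  ultimately show ?thesis
    using coercive[OF w(1) q(1) cell_inequalities(2)[OF K UnI1[OF u] w] cell_inequalities(2)[OF K UnI2[OF u'] q]]
    unfolding cell_coupling_transfer[OF K w q] cell_form_transfer[OF K q q] by simp
qed

end

context discretisation
begin

section \<open>The projected streamline derivative\<close>

definition resid :: "'a set \<Rightarrow> ('a \<Rightarrow> real) \<Rightarrow> ('a \<Rightarrow> real) \<Rightarrow> 'a \<Rightarrow> real" where
  "resid K u u' = L2_proj s pf K (\<lambda>y. a y \<bullet> grad (\<lambda>z. u z + u' z) y)"

definition stream :: "'a set \<Rightarrow> ('a \<Rightarrow> real) \<Rightarrow> ('a \<Rightarrow> real) \<Rightarrow> real" where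
  "stream K u u' = (L2_norm (interior K) (\<lambda>x. sqrt (\<tau> K) * resid K u u' x))\<^sup>2"

lemma stream_eq:
  assumes K: "K \<in> \<M>"
  shows "stream K u u' = \<tau> K * (LINT x:interior K|lebesgue. (resid K u u' x)\<^sup>2)"
  unfolding stream_def L2_norm_square using tau_pos[OF K] by (simp add: power_mult_distrib)

lemma stream_nonneg: "0 \<le> stream K u u'"
  by (simp add: stream_def)

lemma advected_gradient:
  assumes K: "K \<in> \<M>" and w: "real_polynomial_function w" "\<forall>x\<in>interior K. u x = w x"
    and q: "real_polynomial_function q" "\<forall>x\<in>interior K. u' x = q x"
  shows "x \<in> interior K \<Longrightarrow> a x \<bullet> grad (\<lambda>z. u z + u' z) x = a x \<bullet> grad w x + a x \<bullet> grad q x"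
    "bcont (interior K) (\<lambda>y. a y \<bullet> grad (\<lambda>z. u z + u' z) y)"
proof -
  interpret solid_polytope K using K by (rule solid)
  show eq: "a x \<bullet> grad (\<lambda>z. u z + u' z) x = a x \<bullet> grad w x + a x \<bullet> grad q x" if x: "x \<in> interior K" for x
  proof -
    have "grad (\<lambda>z. u z + u' z) x = grad (\<lambda>z. w z + q z) x"
      by (rule grad_cong_open[of "interior K"]) (use x w q in auto)
    also have "\<dots> = grad w x + grad q x"
    proof -
      have "frechet_derivative (\<lambda>z. w z + q z) (at x) =
          (\<lambda>v. frechet_derivative w (at x) v + frechet_derivative q (at x) v)"
        by (rule frechet_derivative_at[symmetric])
          (intro has_derivative_add polynomial_has_frechet_derivative w q)
      then show ?thesis by (simp add: grad_def scaleR_add_left sum.distrib)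
    qed
    finally show ?thesis by (simp add: inner_add_right)
  qed
  have "bcont (interior K) (\<lambda>x. a x \<bullet> grad w x + a x \<bullet> grad q x)"
    by (intro bcont_interior continuous_intros a_cont_cell K continuous_on_grad_polynomial w q)
  then show "bcont (interior K) (\<lambda>y. a y \<bullet> grad (\<lambda>z. u z + u' z) y)"
    using eq by (subst bcont_cong) auto
qed

text \<open>The projection is a member of the local space and may be tested with itself, which gives
  the middle identity. Young's inequality applied to that identity shows that the projection does
  not increase the \<open>L2\<close> norm.\<close>

lemma resid_orthogonal:
  assumes K: "K \<in> \<M>" and w: "real_polynomial_function w" "\<forall>x\<in>interior K. u x = w x"
    and q: "real_polynomial_function q" "\<forall>x\<in>interior K. u' x = q x"
  shows "resid K u u' \<in> local_space s pf K"
    "(LINT x:interior K|lebesgue. resid K u u' x * (a x \<bullet> grad w x)) + (LINT x:interior K|lebesgue. resid K u u' x * (a x \<bullet> grad q x))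
      = (LINT x:interior K|lebesgue. (resid K u u' x)\<^sup>2)"
    "(LINT x:interior K|lebesgue. (resid K u u' x)\<^sup>2) \<le> (LINT x:interior K|lebesgue. (a x \<bullet> grad w x + a x \<bullet> grad q x)\<^sup>2)"
proof -
  interpret solid_polytope K using K by (rule solid)
  note ag = advected_gradient[OF K w q]
  note proj = L2_proj_props[OF is_cell[OF K] ag(2), where p=pf, folded resid_def]
  define g where "g = resid K u u'"
  define f where "f x = a x \<bullet> grad w x + a x \<bullet> grad q x" for x
  show mem: "resid K u u' \<in> local_space s pf K" by (rule proj(1))
  have g: "real_polynomial_function g"
    unfolding g_def by (rule polynomial_local_space[OF is_cell[OF K] mem])
  note c = continuous_on_polynomial[OF g] continuous_on_grad_polynomial[OF w(1)] continuous_on_grad_polynomial[OF q(1)] a_cont_cell[OF K]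
  have fc: "continuous_on K f" unfolding f_def by (intro continuous_intros c)
  have "0 = (LINT x:interior K|lebesgue. (a x \<bullet> grad (\<lambda>z. u z + u' z) x - g x) * g x)"
    using proj(2)[OF mem] by (simp add: g_def)
  also have "\<dots> = (LINT x:interior K|lebesgue. (g x * (a x \<bullet> grad w x) + g x * (a x \<bullet> grad q x)) - (g x)\<^sup>2)"
    by (rule set_integral_cong_on) (simp add: ag(1) algebra_simps power2_eq_square)
  also have "\<dots> = (LINT x:interior K|lebesgue. g x * (a x \<bullet> grad w x) + g x * (a x \<bullet> grad q x)) - (LINT x:interior K|lebesgue. (g x)\<^sup>2)"
    by (intro set_integral_diff(2) integrable_interior bcont_interior continuous_intros c)
  also have "(LINT x:interior K|lebesgue. g x * (a x \<bullet> grad w x) + g x * (a x \<bullet> grad q x)) =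
     (LINT x:interior K|lebesgue. g x * (a x \<bullet> grad w x)) + (LINT x:interior K|lebesgue. g x * (a x \<bullet> grad q x))"
    by (intro set_integral_add(2) integrable_interior bcont_interior continuous_intros c)
  finally have eq: "(LINT x:interior K|lebesgue. g x * (a x \<bullet> grad w x)) + (LINT x:interior K|lebesgue. g x * (a x \<bullet> grad q x))
      = (LINT x:interior K|lebesgue. (g x)\<^sup>2)" by simp
  then show "(LINT x:interior K|lebesgue. resid K u u' x * (a x \<bullet> grad w x)) + (LINT x:interior K|lebesgue. resid K u u' x * (a x \<bullet> grad q x))
      = (LINT x:interior K|lebesgue. (resid K u u' x)\<^sup>2)" by (simp add: g_def)
  have "(LINT x:interior K|lebesgue. g x * (a x \<bullet> grad w x)) + (LINT x:interior K|lebesgue. g x * (a x \<bullet> grad q x)) =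
      (LINT x:interior K|lebesgue. g x * (a x \<bullet> grad w x) + g x * (a x \<bullet> grad q x))"
    by (intro set_integral_add(2)[symmetric] integrable_interior bcont_interior continuous_intros c)
  also have "\<dots> = (LINT x:interior K|lebesgue. g x * f x)"
    by (rule set_integral_cong_on) (simp add: f_def distrib_left)
  also have "\<dots> \<le> 1/2 * (LINT x:interior K|lebesgue. (g x)\<^sup>2) + 1/2 * (LINT x:interior K|lebesgue. (f x)\<^sup>2)"
  proof -
    have "\<bar>LINT x:interior K|lebesgue. g x * f x\<bar> \<le> 1/2 * (LINT x:interior K|lebesgue. (g x)\<^sup>2) + 1/2 * (LINT x:interior K|lebesgue. (f x)\<^sup>2)"
    proof (rule set_integral_young)
      show "\<bar>g x * f x\<bar> \<le> 1/2 * (g x)\<^sup>2 + 1/2 * (f x)\<^sup>2" for x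
        using young[of "1/2" "g x" "f x"] by simp
    qed (intro bcont_interior continuous_intros c fc)+
    then show ?thesis by simp
  qed
  finally show "(LINT x:interior K|lebesgue. (resid K u u' x)\<^sup>2) \<le> (LINT x:interior K|lebesgue. (a x \<bullet> grad w x + a x \<bullet> grad q x)\<^sup>2)"
    using eq by (simp add: g_def f_def)
qed

lemma grad_const: "grad (\<lambda>x. c) x = 0"
  by (simp add: grad_def)

text \<open>With the projected residual scaled by \<open>\<tau> K\<close> as \<open>v\<close>, the
  identities required by the abstract cell estimates follow from \<open>resid_orthogonal\<close>.
  The last claim detects whether the test function vanishes.\<close>

lemma cell_stability:
  assumes K: "K \<in> \<M>" and u: "u \<in> V_bar s p \<Omega> \<M>" and u': "u' \<in> V_disc s pf \<M>"
    and v': "v' \<in> V_disc s pf \<M>" "\<forall>x\<in>interior K. v' x = \<tau> K * resid K u u' x"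
  shows "stream K u u' / 2 - stability_const Ct Ci Cp Ca C\<tau> * (\<kappa> * (H1_seminorm (interior K) u)\<^sup>2 + cell_norm2 K u')
      \<le> cell_coupling K u v' + cell_form K u' v'"
    "cell_norm2 K v' + stream K (\<lambda>x. 0) v' \<le> test_const Ct Ci Cp Ca C\<tau> * stream K u u'"
    "(LINT x:interior K|lebesgue. (v' x)\<^sup>2) = \<tau> K * stream K u u'"
proof -
  interpret stabilised_cell_estimate K a a' \<kappa> "\<kappa>a K" "diameter K" "Linf_norm (interior K) a" Ct Cp "\<tau> K" Ci C\<tau> Ca
    using K by (rule stabilised_cell)
  obtain w where w: "real_polynomial_function w" "\<forall>x\<in>interior K. u x = w x"
    using V_disc_polynomial[OF V_bar_V_disc[OF u] K] by blast
  obtain q where q: "real_polynomial_function q" "\<forall>x\<in>interior K. u' x = q x"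
    using V_disc_polynomial[OF u' K] by blast
  define g where "g = resid K u u'"
  define v where "v x = \<tau> K * g x" for x
  note res = resid_orthogonal[OF K w q, folded g_def]
  have vq: "real_polynomial_function v" "\<forall>x\<in>interior K. v' x = v x"
    using polynomial_local_space[OF is_cell[OF K] local_space_scale[OF is_cell[OF K] res(1)]] v'(2)
    by (auto simp: v_def[abs_def] g_def)
  have orth: "I (\<lambda>x. v x * (a x \<bullet> grad w x)) + I (\<lambda>x. v x * (a x \<bullet> grad q x)) = \<tau> K * I (\<lambda>x. (g x)\<^sup>2)"
    unfolding res(2)[symmetric] v_def mult.assoc set_integral_mult_right by (simp only: distrib_left)
  have v2: "I (\<lambda>x. (v x)\<^sup>2) = \<tau> K * (\<tau> K * I (\<lambda>x. (g x)\<^sup>2))"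
    unfolding v_def power_mult_distrib set_integral_mult_right by (simp add: power2_eq_square)
  have st: "stream K u u' = \<tau> K * I (\<lambda>x. (g x)\<^sup>2)" using stream_eq[OF K] by (simp add: g_def)
  note ineq_v = cell_inequalities[OF K UnI2[OF v'(1)] vq]
  note ineq_q = cell_inequalities[OF K UnI2[OF u'] q]
  note ineq_w = cell_inequalities[OF K UnI1[OF u] w]
  note prems = w(1) q(1) vq(1) orth v2 ineq_v(3) ineq_w(4) ineq_v(1) ineq_v(2) ineq_q(2)
  have P2: "P2 g = stream K u u'" unfolding P2_def[OF prems] st ..
  have "I (\<lambda>x. (v' x)\<^sup>2) = I (\<lambda>x. (v x)\<^sup>2)" by (rule set_integral_cong_on) (simp add: vq(2))
  then show "I (\<lambda>x. (v' x)\<^sup>2) = \<tau> K * stream K u u'" using v2 st by simp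
  have nw: "energy w = (H1_seminorm (interior K) u)\<^sup>2" by (simp only: cell_transfer(2)[OF K w])
  have nq: "norm2 q = cell_norm2 K u'"
    unfolding norm2_def cell_norm2_def by (simp only: cell_transfer(2,4,6)[OF K q])
  have nv: "norm2 v = cell_norm2 K v'"
    unfolding norm2_def cell_norm2_def by (simp only: cell_transfer(2,4,6)[OF K vq])
  show "stream K u u' / 2 - stability_const Ct Ci Cp Ca C\<tau> * (\<kappa> * (H1_seminorm (interior K) u)\<^sup>2 + cell_norm2 K u')
      \<le> cell_coupling K u v' + cell_form K u' v'"
    using stability[OF prems]
    unfolding P2 nw nq cell_coupling_transfer[OF K w vq] cell_form_transfer[OF K q vq] by linarith
  \<comment> \<open>Contractivity of the projector removes it from the streamline norm of the test
    function, and \<open>streamline_v\<close> bounds the rest.\<close>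
  have "\<tau> K * I (\<lambda>x. (resid K (\<lambda>x. 0) v' x)\<^sup>2) \<le> \<tau> K * I (\<lambda>x. (a x \<bullet> grad (\<lambda>x. 0) x + a x \<bullet> grad v x)\<^sup>2)"
    using resid_orthogonal(3)[OF K real_polynomial_function.intros(2) _ vq, of "\<lambda>x. 0" 0] tau_pos[OF K]
    by (intro mult_left_mono) simp_all
  also have "\<dots> \<le> C\<tau>\<^sup>2 * Ci * stream K u u'"
    using streamline_v[OF prems] by (simp add: grad_const P2)
  finally have "stream K (\<lambda>x. 0) v' \<le> C\<tau>\<^sup>2 * Ci * stream K u u'"
    by (simp only: stream_eq[OF K])
  moreover have "cell_norm2 K v' \<le> (C\<tau> + Ca * C\<tau> * Ci + Cp * (Ct * C\<tau> / Ci) + Ct * C\<tau>) * stream K u u'"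
    using norm2_v[OF prems] unfolding P2 nv .
  ultimately show "cell_norm2 K v' + stream K (\<lambda>x. 0) v' \<le> test_const Ct Ci Cp Ca C\<tau> * stream K u u'"
    unfolding test_const_def by (simp only: distrib_right)
qed

section \<open>Global coercivity and streamline control\<close>

definition energy2 :: "('a \<Rightarrow> real) \<Rightarrow> ('a \<Rightarrow> real) \<Rightarrow> real" where
  "energy2 u u' = (\<Sum>K\<in>\<M>. \<kappa> * (H1_seminorm (interior K) u)\<^sup>2 + cell_norm2 K u')"

definition stream2 :: "('a \<Rightarrow> real) \<Rightarrow> ('a \<Rightarrow> real) \<Rightarrow> real" where
  "stream2 u u' = (\<Sum>K\<in>\<M>. stream K u u')"

lemma H1_seminorm_split:
  assumes u: "u \<in> V_disc s k \<M>"
  shows "(H1_seminorm \<Omega> u)\<^sup>2 = (\<Sum>K\<in>\<M>. (H1_seminorm (interior K) u)\<^sup>2)"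
  unfolding H1_seminorm_square
proof (rule integral_split(2))
  fix K assume K: "K \<in> \<M>"
  interpret solid_polytope K using K by (rule solid)
  obtain q where q: "real_polynomial_function q" "\<forall>x\<in>interior K. u x = q x"
    using V_disc_polynomial[OF u K] by blast
  have "bcont (interior K) (\<lambda>x. (norm (grad q x))\<^sup>2)"
    by (intro bcont_interior continuous_intros continuous_on_grad_polynomial q)
  moreover have "bcont (interior K) (\<lambda>x. (norm (grad q x))\<^sup>2) \<longleftrightarrow> bcont (interior K) (\<lambda>x. (norm (grad u x))\<^sup>2)"
    by (rule bcont_cong) (simp add: integral_grad_cell[OF K q(2)])
  ultimately show "set_integrable lebesgue (interior K) (\<lambda>x. (norm (grad u x))\<^sup>2)"
    using integrable_interior by blast
qed

lemma S_norm_eq: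
  assumes u: "u \<in> V_disc s k \<M>"
  shows "S_norm s pf \<Omega> \<M> a \<kappa> \<kappa>a Cp Ci C\<tau> (u, u') = sqrt (energy2 u u' + stream2 u u')"
  unfolding S_norm_def energy2_def stream2_def stream_def resid_def cell_norm2_def
  by (simp add: H1_seminorm_split[OF u] sum.distrib sum_distrib_left)

lemma Bform_eq:
  "Bform \<Omega> \<M> a \<kappa> \<kappa>a Cp (u, u') (v, v') =
     - (LINT x:\<Omega>|lebesgue. u x * (a x \<bullet> grad v x)) + (LINT x:\<Omega>|lebesgue. \<kappa> * (grad u x \<bullet> grad v x))
     - (\<Sum>K\<in>\<M>. LINT x:interior K|lebesgue. u' x * (a x \<bullet> grad v x))
     + (\<Sum>K\<in>\<M>. cell_coupling K u v') + (\<Sum>K\<in>\<M>. cell_form K u' v')"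
  unfolding Bform_def Bbar_def Cbar_def Cprime_def Bprime_def cell_coupling_def cell_form_def by simp

lemma coercivity:
  assumes u: "u \<in> V_bar s p \<Omega> \<M>" and u': "u' \<in> V_disc s pf \<M>"
  shows "energy2 u u' / 4 \<le> Bform \<Omega> \<M> a \<kappa> \<kappa>a Cp (u, u') (u, u')"
proof -
  \<comment> \<open>The divergence of u^2 a integrates to 0; as the field is divergence free, this
    divergence is twice the advective integrand of \<open>Bbar\<close> on the diagonal.\<close>
  have "0 = (LINT x:\<Omega>|lebesgue. 2 * (u x * (a x \<bullet> grad u x)) + (u x)\<^sup>2 * (\<Sum>b\<in>Basis. a' x b \<bullet> b))"
    using divergence_V_bar(2)[OF u field] by simp
  also have "\<dots> = (LINT x:\<Omega>|lebesgue. 2 * (u x * (a x \<bullet> grad u x)))"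
    by (rule set_integral_cong_on) (simp add: div0)
  finally have adv: "(LINT x:\<Omega>|lebesgue. u x * (a x \<bullet> grad u x)) = 0" by simp
  have diff: "(LINT x:\<Omega>|lebesgue. \<kappa> * (grad u x \<bullet> grad u x)) = (\<Sum>K\<in>\<M>. \<kappa> * (H1_seminorm (interior K) u)\<^sup>2)"
    using H1_seminorm_split[OF V_bar_V_disc[OF u]]
    by (simp add: H1_seminorm_square power2_norm_eq_inner sum_distrib_left)
  have "energy2 u u' / 4 = (\<Sum>K\<in>\<M>. (\<kappa> * (H1_seminorm (interior K) u)\<^sup>2 + cell_norm2 K u') / 4)"
    by (simp add: energy2_def sum_divide_distrib)
  also have "\<dots> \<le> (\<Sum>K\<in>\<M>. \<kappa> * (H1_seminorm (interior K) u)\<^sup>2 - (LINT x:interior K|lebesgue. u' x * (a x \<bullet> grad u x))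
      + cell_coupling K u u' + cell_form K u' u')"
    by (intro sum_mono cell_coercive u u')
  also have "\<dots> = Bform \<Omega> \<M> a \<kappa> \<kappa>a Cp (u, u') (u, u')"
    unfolding Bform_eq adv diff by (simp add: sum.distrib sum_subtractf)
  finally show ?thesis .
qed

lemma zero_V_bar: "(\<lambda>x. 0) \<in> V_bar s p \<Omega> \<M>"
  unfolding V_bar_def V_disc_def using zero_local_space[OF is_cell] by fastforce

text \<open>The test function \<open>v' = \<tau>\<^sub>K \<P>'\<^sub>K(a \<cdot> \<nabla>(u + u'))\<close> that controls the streamline term.\<close>

definition supremizer :: "('a \<Rightarrow> real) \<Rightarrow> ('a \<Rightarrow> real) \<Rightarrow> 'a \<Rightarrow> real" where
  "supremizer u u' x = (\<Sum>K\<in>\<M>. indicator (interior K) x * (\<tau> K * resid K u u' x))"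

lemma supremizer_cell:
  assumes K: "K \<in> \<M>"
  shows "\<forall>x\<in>interior K. supremizer u u' x = \<tau> K * resid K u u' x"
proof
  fix x assume x: "x \<in> interior K"
  have "supremizer u u' x = (\<Sum>L\<in>{K}. indicator (interior L) x * (\<tau> L * resid L u u' x))"
    unfolding supremizer_def
  proof (rule sum.mono_neutral_right)
    show "\<forall>L\<in>\<M> - {K}. indicator (interior L) x * (\<tau> L * resid L u u' x) = 0"
    proof
      fix L assume "L \<in> \<M> - {K}"
      then have "x \<notin> interior L" using interior_disjoint[OF K, of L] x by blast
      then show "indicator (interior L) x * (\<tau> L * resid L u u' x) = 0" by simp
    qed
  qed (use finite_mesh K in auto)
  then show "supremizer u u' x = \<tau> K * resid K u u' x" using x by simp
qed

lemma supremizer_V_disc: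
  assumes u: "u \<in> V_bar s p \<Omega> \<M>" and u': "u' \<in> V_disc s pf \<M>"
  shows "supremizer u u' \<in> V_disc s pf \<M>"
  unfolding V_disc_def mem_Collect_eq
proof
  fix K assume K: "K \<in> \<M>"
  obtain w where w: "real_polynomial_function w" "\<forall>x\<in>interior K. u x = w x"
    using V_disc_polynomial[OF V_bar_V_disc[OF u] K] by blast
  obtain q where q: "real_polynomial_function q" "\<forall>x\<in>interior K. u' x = q x"
    using V_disc_polynomial[OF u' K] by blast
  show "\<exists>q\<in>local_space s pf K. \<forall>x\<in>interior K. supremizer u u' x = q x"
    by (intro bexI[of _ "\<lambda>x. \<tau> K * resid K u u' x"] supremizer_cell K
        local_space_scale is_cell resid_orthogonal(1)[OF K w q])
qed

text \<open>With zero conforming test component \<open>Bbar\<close> and \<open>Cbar\<close> drop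
  out, so the estimates of the single cells simply add up.\<close>

lemma supremizer_stability:
  assumes u: "u \<in> V_bar s p \<Omega> \<M>" and u': "u' \<in> V_disc s pf \<M>"
  shows "stream2 u u' / 2 - stability_const Ct Ci Cp Ca C\<tau> * energy2 u u'
      \<le> Bform \<Omega> \<M> a \<kappa> \<kappa>a Cp (u, u') (\<lambda>x. 0, supremizer u u')"
    "energy2 (\<lambda>x. 0) (supremizer u u') + stream2 (\<lambda>x. 0) (supremizer u u') \<le> test_const Ct Ci Cp Ca C\<tau> * stream2 u u'"
proof -
  note cs = cell_stability[OF _ u u' supremizer_V_disc[OF u u'] supremizer_cell]
  have "stream2 u u' / 2 - stability_const Ct Ci Cp Ca C\<tau> * energy2 u u' =
    (\<Sum>K\<in>\<M>. stream K u u' / 2 - stability_const Ct Ci Cp Ca C\<tau> * (\<kappa> * (H1_seminorm (interior K) u)\<^sup>2 + cell_norm2 K u'))"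
    by (simp add: stream2_def energy2_def sum_subtractf sum_divide_distrib sum_distrib_left)
  also have "\<dots> \<le> (\<Sum>K\<in>\<M>. cell_coupling K u (supremizer u u') + cell_form K u' (supremizer u u'))"
    by (intro sum_mono cs(1))
  also have "\<dots> = Bform \<Omega> \<M> a \<kappa> \<kappa>a Cp (u, u') (\<lambda>x. 0, supremizer u u')"
    unfolding Bform_eq by (simp add: grad_const sum.distrib)
  finally show "stream2 u u' / 2 - stability_const Ct Ci Cp Ca C\<tau> * energy2 u u'
      \<le> Bform \<Omega> \<M> a \<kappa> \<kappa>a Cp (u, u') (\<lambda>x. 0, supremizer u u')" .
  have "energy2 (\<lambda>x. 0) (supremizer u u') + stream2 (\<lambda>x. 0) (supremizer u u') =
    (\<Sum>K\<in>\<M>. cell_norm2 K (supremizer u u') + stream K (\<lambda>x. 0) (supremizer u u'))"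
    by (simp add: energy2_def stream2_def sum.distrib H1_seminorm_square grad_const)
  also have "\<dots> \<le> (\<Sum>K\<in>\<M>. test_const Ct Ci Cp Ca C\<tau> * stream K u u')"
    by (intro sum_mono cs(2))
  finally show "energy2 (\<lambda>x. 0) (supremizer u u') + stream2 (\<lambda>x. 0) (supremizer u u') \<le> test_const Ct Ci Cp Ca C\<tau> * stream2 u u'"
    by (simp add: stream2_def sum_distrib_left)
qed

end

context discretisation
begin

section \<open>Definiteness of the norm on discrete pairs\<close>

lemma AE_domainI:
  assumes "\<And>K. K \<in> \<M> \<Longrightarrow> AE x in lebesgue. x \<in> interior K \<longrightarrow> P x"
  shows "AE x in lebesgue_on \<Omega>. P x"
proof -
  have "AE x in lebesgue. \<forall>K\<in>\<M>. x \<in> interior K \<longrightarrow> P x"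
    using finite_mesh assms by (rule AE_finite_allI)
  then have "AE x in lebesgue. x \<in> \<Omega> \<longrightarrow> P x"
    using AE_not_hyperplanes[OF finite_planes]
  proof eventually_elim
    case (elim x)
    then show ?case using off_planes[of x] closure_subset by blast
  qed
  then show ?thesis
    using open_domain by (subst AE_restrict_space_iff) auto
qed

lemma square_integral_0_cell:
  assumes K: "K \<in> \<M>" and q: "real_polynomial_function q" "\<forall>x\<in>interior K. u x = q x"
    and 0: "(LINT x:interior K|lebesgue. (q x)\<^sup>2) = 0"
  shows "AE x in lebesgue. x \<in> interior K \<longrightarrow> u x = 0"
proof -
  interpret solid_polytope K using K by (rule solid)
  have "AE x in lebesgue. x \<in> interior K \<longrightarrow> q x = 0"
    by (rule square_integral_0_AE[OF open_bounded_interior bcont_interior[OF continuous_on_polynomial[OF q(1)]] 0])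
  then show ?thesis by eventually_elim (use q(2) in simp)
qed

lemma cell_norm2_terms:
  assumes K: "K \<in> \<M>"
  shows "0 \<le> cell_norm2 K v"
    "cell_norm2 K v = 0 \<Longrightarrow> (H1_seminorm (interior K) v)\<^sup>2 = 0 \<and> (bd_norm K (\<lambda>n. trace_from K v))\<^sup>2 = 0"
proof -
  interpret stabilised_cell_estimate K a a' \<kappa> "\<kappa>a K" "diameter K" "Linf_norm (interior K) a" Ct Cp "\<tau> K" Ci C\<tau> Ca
    using K by (rule stabilised_cell)
  have c: "0 < \<kappa> + \<kappa>a K" "0 < Cp * \<kappa> / diameter K" using pos Cp_pos diameter_pos by auto
  have t: "0 \<le> (\<kappa> + \<kappa>a K) * (H1_seminorm (interior K) v)\<^sup>2"
    "0 \<le> Cp * \<kappa> / diameter K * (bd_norm K (\<lambda>n. trace_from K v))\<^sup>2"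
    "0 \<le> (bd_norm K (\<lambda>n x. sqrt \<bar>a x \<bullet> n\<bar> * trace_from K v x))\<^sup>2"
    by (rule mult_nonneg_nonneg[OF less_imp_le[OF c(1)] zero_le_power2],
        rule mult_nonneg_nonneg[OF less_imp_le[OF c(2)] zero_le_power2], rule zero_le_power2)
  show "0 \<le> cell_norm2 K v" using t unfolding cell_norm2_def by linarith
  show "(H1_seminorm (interior K) v)\<^sup>2 = 0 \<and> (bd_norm K (\<lambda>n. trace_from K v))\<^sup>2 = 0" if "cell_norm2 K v = 0"
  proof -
    have "(\<kappa> + \<kappa>a K) * (H1_seminorm (interior K) v)\<^sup>2 = 0"
      "Cp * \<kappa> / diameter K * (bd_norm K (\<lambda>n. trace_from K v))\<^sup>2 = 0"
      using t that unfolding cell_norm2_def by linarith+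
    then show ?thesis using c by (metis less_irrefl mult_eq_0_iff)
  qed
qed

lemma energy2_nonneg: "0 \<le> energy2 u u'"
  unfolding energy2_def using pos cell_norm2_terms(1) by (intro sum_nonneg add_nonneg_nonneg) auto

lemma stream2_nonneg: "0 \<le> stream2 u u'"
  unfolding stream2_def by (intro sum_nonneg stream_nonneg)

text \<open>The conforming part vanishes by testing the divergence theorem with \<open>u\<^sup>2 x\<close>.\<close>

lemma energy2_definite:
  assumes u: "u \<in> V_bar s p \<Omega> \<M>" and u': "u' \<in> V_disc s pf \<M>" and 0: "energy2 u u' = 0"
  shows "AE x in lebesgue_on \<Omega>. u x = 0 \<and> u' x = 0"
proof -
  have "\<forall>K\<in>\<M>. \<kappa> * (H1_seminorm (interior K) u)\<^sup>2 + cell_norm2 K u' = 0"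
    using 0 finite_mesh pos cell_norm2_terms(1) unfolding energy2_def
    by (subst (asm) sum_nonneg_eq_0_iff) auto
  then have "\<kappa> * (H1_seminorm (interior K) u)\<^sup>2 = 0 \<and> cell_norm2 K u' = 0" if K: "K \<in> \<M>" for K
  proof -
    have "\<kappa> * (H1_seminorm (interior K) u)\<^sup>2 + cell_norm2 K u' = 0"
      using \<open>\<forall>K\<in>\<M>. _\<close> K by blast
    moreover have "0 \<le> \<kappa> * (H1_seminorm (interior K) u)\<^sup>2"
      by (rule mult_nonneg_nonneg[OF less_imp_le[OF pos(1)] zero_le_power2])
    ultimately show ?thesis using cell_norm2_terms(1)[OF K, of u'] by linarith
  qed
  then have H: "(H1_seminorm (interior K) u)\<^sup>2 = 0" "(H1_seminorm (interior K) u')\<^sup>2 = 0"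
    "(bd_norm K (\<lambda>n. trace_from K u'))\<^sup>2 = 0" if "K \<in> \<M>" for K
    using that cell_norm2_terms(2)[OF that, of u'] pos by auto
  define h where "h x = 2 * (u x * (x \<bullet> grad u x)) + (u x)\<^sup>2 * (\<Sum>b\<in>Basis. (b::'a) \<bullet> b)" for x
  have cell: "set_integrable lebesgue (interior K) h \<and> (LINT x:interior K|lebesgue. h x) = DIM('a) * (L2_norm (interior K) u)\<^sup>2"
    if K: "K \<in> \<M>" for K
  proof -
    interpret solid_polytope K using K by (rule solid)
    obtain w where w: "real_polynomial_function w" "\<forall>x\<in>interior K. u x = w x"
      using V_disc_polynomial[OF V_bar_V_disc[OF u] K] by blast
    note c = continuous_on_polynomial[OF w(1)] continuous_on_grad_polynomial[OF w(1)]
    have e: "(LINT x:interior K|lebesgue. (norm (grad w x))\<^sup>2) = 0"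
      using H(1)[OF K] by (simp only: cell_transfer(2)[OF K w])
    have hw: "h x = (2 * w x) * (x \<bullet> grad w x) + DIM('a) * (w x)\<^sup>2" if "x \<in> interior K" for x
      using that w(2) by (simp add: h_def integral_grad_cell[OF K w(2)])
    have "bcont (interior K) (\<lambda>x. (2 * w x) * (x \<bullet> grad w x) + DIM('a) * (w x)\<^sup>2)"
      by (intro bcont_interior continuous_intros c)
    then have "bcont (interior K) h" using hw by (subst bcont_cong) auto
    moreover have "(LINT x:interior K|lebesgue. h x) = DIM('a) * (L2_norm (interior K) u)\<^sup>2"
    proof -
      have "(LINT x:interior K|lebesgue. h x) = (LINT x:interior K|lebesgue. (2 * w x) * (x \<bullet> grad w x) + DIM('a) * (w x)\<^sup>2)"
        by (rule set_integral_cong_on) (rule hw)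
      also have "\<dots> = (LINT x:interior K|lebesgue. (2 * w x) * (x \<bullet> grad w x)) + (LINT x:interior K|lebesgue. DIM('a) * (w x)\<^sup>2)"
        by (intro set_integral_add(2) integrable_interior bcont_interior continuous_intros c)
      also have "(LINT x:interior K|lebesgue. (2 * w x) * (x \<bullet> grad w x)) = 0"
        by (rule gradient_term_0[OF w(1) e])
      finally show ?thesis by (simp add: cell_transfer(1)[OF K w])
    qed
    ultimately show ?thesis using integrable_interior by blast
  qed
  \<comment> \<open>The identity field has divergence d and the gradient of \<open>u\<close>
    vanishes, so each cell contributes d times its squared \<open>L2\<close> norm; by the boundary
    condition the total is 0.\<close>
  have "(LINT x:\<Omega>|lebesgue. h x) = 0"
    unfolding h_def by (rule divergence_V_bar(2)[OF u C1_closure_id])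
  then have "(\<Sum>K\<in>\<M>. DIM('a) * (L2_norm (interior K) u)\<^sup>2) = 0"
    using integral_split(2)[of h] cell by simp
  then have "\<forall>K\<in>\<M>. DIM('a) * (L2_norm (interior K) u)\<^sup>2 = 0"
    using finite_mesh by (subst (asm) sum_nonneg_eq_0_iff) auto
  then have L2: "(L2_norm (interior K) u)\<^sup>2 = 0" if "K \<in> \<M>" for K using that by simp
  show ?thesis
  proof (rule AE_domainI)
    fix K assume K: "K \<in> \<M>"
    obtain w where w: "real_polynomial_function w" "\<forall>x\<in>interior K. u x = w x"
      using V_disc_polynomial[OF V_bar_V_disc[OF u] K] by blast
    obtain q where q: "real_polynomial_function q" "\<forall>x\<in>interior K. u' x = q x"
      using V_disc_polynomial[OF u' K] by blast
    \<comment> \<open>For the discontinuous part the penalty supplies the zero trace on each single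
      cell.\<close>
    have "(LINT x:interior K|lebesgue. (q x)\<^sup>2) = 0"
    proof (rule solid_polytope.zero_of_zero_energy[OF solid[OF K] q(1)])
      show "(LINT x:interior K|lebesgue. (norm (grad q x))\<^sup>2) = 0"
        using H(2)[OF K] by (simp only: cell_transfer(2)[OF K q])
      show "bd_integral K (\<lambda>n x. (q x)\<^sup>2) = 0"
        using H(3)[OF K] by (simp only: cell_transfer(4)[OF K q])
    qed
    then have "AE x in lebesgue. x \<in> interior K \<longrightarrow> u' x = 0" by (rule square_integral_0_cell[OF K q])
    moreover have "(LINT x:interior K|lebesgue. (w x)\<^sup>2) = 0"
      using L2[OF K] by (simp only: cell_transfer(1)[OF K w])
    then have "AE x in lebesgue. x \<in> interior K \<longrightarrow> u x = 0" by (rule square_integral_0_cell[OF K w])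
    ultimately show "AE x in lebesgue. x \<in> interior K \<longrightarrow> u x = 0 \<and> u' x = 0"
      by eventually_elim simp
  qed
qed

lemma supremizer_nonzero:
  assumes u: "u \<in> V_bar s p \<Omega> \<M>" and u': "u' \<in> V_disc s pf \<M>" and pos: "0 < stream2 u u'"
  shows "\<not> (AE x in lebesgue_on \<Omega>. supremizer u u' x = 0)"
proof
  assume "AE x in lebesgue_on \<Omega>. supremizer u u' x = 0"
  then have ae: "AE x in lebesgue. x \<in> \<Omega> \<longrightarrow> supremizer u u' x = 0"
    using open_domain by (subst (asm) AE_restrict_space_iff) auto
  have "stream K u u' = 0" if K: "K \<in> \<M>" for K
  proof -
    have "AE x in lebesgue. indicator (interior K) x *\<^sub>R (supremizer u u' x)\<^sup>2 = 0"
      using ae by eventually_elim (use interior_cell_subset[OF K] in \<open>auto simp: indicator_def\<close>)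
    then have "(LINT x:interior K|lebesgue. (supremizer u u' x)\<^sup>2) = 0"
      unfolding set_lebesgue_integral_def by (rule integral_eq_zero_AE)
    then show ?thesis
      using cell_stability(3)[OF K u u' supremizer_V_disc[OF u u'] supremizer_cell[OF K]] tau_pos[OF K] by simp
  qed
  then have "stream2 u u' = 0" by (simp add: stream2_def)
  then show False using pos by simp
qed

lemma stability_const_pos: "0 < stability_const Ct Ci Cp Ca C\<tau>"
proof -
  have Cp: "0 < Cp" using pos by linarith
  have "0 < 3 * C\<tau>" "0 \<le> 3 * (Ct * C\<tau>)" "0 \<le> 3 * (C\<tau> + Ca * C\<tau> * Ci)" "0 \<le> 3 * (Ct * (Ct * C\<tau> / Ci))"
    "0 \<le> 3 * (Ct * C\<tau> / Cp)" "0 \<le> 3 * (Cp * (Ct * C\<tau> / Ci))"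
    using pos Cp by auto
  then show ?thesis unfolding stability_const_def by linarith
qed

lemma test_const_pos: "0 < test_const Ct Ci Cp Ca C\<tau>"
proof -
  have Cp: "0 < Cp" using pos by linarith
  have "0 < C\<tau>" "0 \<le> Ca * C\<tau> * Ci" "0 \<le> Cp * (Ct * C\<tau> / Ci)" "0 \<le> Ct * C\<tau>" "0 \<le> C\<tau>\<^sup>2 * Ci"
    using pos Cp by auto
  then show ?thesis unfolding test_const_def by linarith
qed

text \<open>The threshold \<open>4 * D\<close> serves both cases: below it the streamline part is a
  multiple of the energy, so coercivity suffices; above it the loss \<open>D * A\<close> of the
  second test is less than \<open>P / 4\<close>, half of its gain.\<close>

lemma discrete_inf_sup:
  assumes U: "U \<in> nonzero_pairs s p pf \<Omega> \<M>"
  defines "D \<equiv> stability_const Ct Ci Cp Ca C\<tau>" and "T \<equiv> test_const Ct Ci Cp Ca C\<tau>"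
  shows "\<exists>V\<in>nonzero_pairs s p pf \<Omega> \<M>.
    min (1 / (4 * (1 + 4 * D))) (1 / (4 * sqrt ((1 + 1 / (4 * D)) * T))) \<le>
      Bform \<Omega> \<M> a \<kappa> \<kappa>a Cp U V / (S_norm s pf \<Omega> \<M> a \<kappa> \<kappa>a Cp Ci C\<tau> U * S_norm s pf \<Omega> \<M> a \<kappa> \<kappa>a Cp Ci C\<tau> V)"
proof -
  obtain u u' where Ueq: "U = (u, u')" by (cases U)
  have u: "u \<in> V_bar s p \<Omega> \<M>" and u': "u' \<in> V_disc s pf \<M>"
    and nz: "\<not> (AE x in lebesgue_on \<Omega>. u x = 0 \<and> u' x = 0)"
    using U unfolding nonzero_pairs_def Ueq by auto
  define A where "A = energy2 u u'"
  define P where "P = stream2 u u'"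
  \<comment> \<open>Definiteness makes the norm in the denominator positive.\<close>
  have A: "0 < A" using energy2_definite[OF u u'] nz energy2_nonneg[of u u'] by (force simp: A_def)
  have P: "0 \<le> P" unfolding P_def by (rule stream2_nonneg)
  have D: "0 < D" and T: "0 < T" unfolding D_def T_def by (rule stability_const_pos, rule test_const_pos)
  note SU = S_norm_eq[OF V_bar_V_disc[OF u], of u', folded A_def P_def]
  show ?thesis
  proof (cases "P \<le> 4 * D * A")
    case True
    have "1 / (4 * (1 + 4 * D)) = (A / 4) / ((1 + 4 * D) * A)" using A by simp
    also have "\<dots> \<le> (A / 4) / (A + P)"
      using True A P D by (intro divide_left_mono mult_pos_pos) (auto simp: algebra_simps)
    also have "\<dots> \<le> Bform \<Omega> \<M> a \<kappa> \<kappa>a Cp U U / (A + P)"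
      using coercivity[OF u u'] A P by (intro divide_right_mono) (auto simp: A_def Ueq)
    also have "A + P = S_norm s pf \<Omega> \<M> a \<kappa> \<kappa>a Cp Ci C\<tau> U * S_norm s pf \<Omega> \<M> a \<kappa> \<kappa>a Cp Ci C\<tau> U"
      using A P by (simp add: Ueq SU)
    finally show ?thesis using U by (intro bexI[of _ U]) auto
  next
    case False
    define v' where "v' = supremizer u u'"
    define V where "V = (\<lambda>x::'a. 0::real, v')"
    have v': "v' \<in> V_disc s pf \<M>" unfolding v'_def by (rule supremizer_V_disc[OF u u'])
    have "0 < 4 * D * A" using D A by simp
    then have P: "0 < P" using False by linarith
    have V: "V \<in> nonzero_pairs s p pf \<Omega> \<M>"
      using zero_V_bar v' supremizer_nonzero[OF u u'] P unfolding nonzero_pairs_def V_def v'_def P_def by simp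
    define R where "R = energy2 (\<lambda>x. 0) v' + stream2 (\<lambda>x. 0) v'"
    have "energy2 (\<lambda>x. 0) v' \<noteq> 0"
      using energy2_definite[OF zero_V_bar v'] supremizer_nonzero[OF u u'] P by (auto simp: v'_def P_def)
    then have R: "0 < R" using energy2_nonneg[of "\<lambda>x. 0" v'] stream2_nonneg[of "\<lambda>x. 0" v'] unfolding R_def by linarith
    have RT: "R \<le> T * P" using supremizer_stability(2)[OF u u'] by (simp add: R_def T_def P_def v'_def)
    have SV: "S_norm s pf \<Omega> \<M> a \<kappa> \<kappa>a Cp Ci C\<tau> V = sqrt R"
      unfolding V_def R_def by (rule S_norm_eq[OF V_bar_V_disc[OF zero_V_bar]])
    have B: "P / 4 \<le> Bform \<Omega> \<M> a \<kappa> \<kappa>a Cp U V"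
      using supremizer_stability(1)[OF u u'] False by (simp add: Ueq V_def v'_def A_def P_def D_def)
    \<comment> \<open>Above the threshold \<open>A\<close> is less than \<open>P / (4 * D)\<close>,
      so the norm of \<open>U\<close> is comparable to its streamline part alone.\<close>
    have AP: "A + P \<le> (1 + 1 / (4 * D)) * P"
      using False D by (simp add: field_simps)
    have c: "0 < (1 + 1 / (4 * D)) * T" using D T by (intro mult_pos_pos add_pos_pos) auto
    have "sqrt (A + P) * sqrt R \<le> sqrt ((1 + 1 / (4 * D)) * T) * P"
    proof -
      have "sqrt (A + P) * sqrt R = sqrt ((A + P) * R)" by (simp add: real_sqrt_mult)
      also have "\<dots> \<le> sqrt (((1 + 1 / (4 * D)) * P) * (T * P))"
        using AP RT A P R D by (intro real_sqrt_le_mono mult_mono) auto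
      also have "((1 + 1 / (4 * D)) * P) * (T * P) = ((1 + 1 / (4 * D)) * T) * P\<^sup>2"
        by (simp add: power2_eq_square)
      also have "sqrt \<dots> = sqrt ((1 + 1 / (4 * D)) * T) * P"
        using P by (simp only: real_sqrt_mult real_sqrt_abs abs_of_pos)
      finally show ?thesis .
    qed
    then have "(P / 4) / (sqrt ((1 + 1 / (4 * D)) * T) * P) \<le> (P / 4) / (sqrt (A + P) * sqrt R)"
      using A P R c by (intro divide_left_mono mult_pos_pos) auto
    also have "\<dots> \<le> Bform \<Omega> \<M> a \<kappa> \<kappa>a Cp U V / (sqrt (A + P) * sqrt R)"
      using B A P R by (intro divide_right_mono) auto
    also have "sqrt (A + P) * sqrt R =
        S_norm s pf \<Omega> \<M> a \<kappa> \<kappa>a Cp Ci C\<tau> U * S_norm s pf \<Omega> \<M> a \<kappa> \<kappa>a Cp Ci C\<tau> V"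
      by (simp add: Ueq SU SV)
    also have "(P / 4) / (sqrt ((1 + 1 / (4 * D)) * T) * P) = 1 / (4 * sqrt ((1 + 1 / (4 * D)) * T))"
      using P by simp
    finally show ?thesis using V by (intro bexI[of _ V]) auto
  qed
qed

end

theorem theorem4p2:
  fixes \<Omega> :: "'a::euclidean_space set"
    and p p\<^sub>f :: nat
    and \<sigma> C_trace C_inv C_pen C_art C_\<tau> :: real
  assumes "DIM('a) \<in> {2, 3}"
    and "polyhedral_domain \<Omega>"
    and "p \<ge> 1"
    and "C_trace > 0" and "C_pen > 0" and "C_pen \<ge> 8 * C_trace"
    and "C_inv > 0" and "C_art \<ge> 0" and "C_\<tau> > 0"
  shows "\<exists>\<beta> > 0. \<forall>s \<M> (a :: 'a \<Rightarrow> 'a) (\<kappa> :: real) (\<kappa>_art :: 'a set \<Rightarrow> real).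
    conforming_mesh s \<Omega> \<M> \<longrightarrow> shape_regular \<sigma> \<M> \<longrightarrow>
    smooth_up_to_boundary \<Omega> a \<longrightarrow> (\<forall>x\<in>\<Omega>. divg a x = 0) \<longrightarrow> \<kappa> > 0 \<longrightarrow>
    trace_inequalities C_trace \<M> (V_bar s p \<Omega> \<M> \<union> V_disc s p\<^sub>f \<M>) \<longrightarrow>
    inverse_inequalities C_inv \<M> (V_bar s p \<Omega> \<M> \<union> V_disc s p\<^sub>f \<M>) \<longrightarrow>
    (\<forall>K\<in>\<M>. \<kappa>_art K = C_art * inverse (rate C_inv \<kappa> a K) * (Linf_norm (interior K) a)\<^sup>2) \<longrightarrow>
    (INF U \<in> nonzero_pairs s p p\<^sub>f \<Omega> \<M>. SUP V \<in> nonzero_pairs s p p\<^sub>f \<Omega> \<M>.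
       ereal (Bform \<Omega> \<M> a \<kappa> \<kappa>_art C_pen U V /
         (S_norm s p\<^sub>f \<Omega> \<M> a \<kappa> \<kappa>_art C_pen C_inv C_\<tau> U *
          S_norm s p\<^sub>f \<Omega> \<M> a \<kappa> \<kappa>_art C_pen C_inv C_\<tau> V))) \<ge> ereal \<beta>"
proof -
  define D where "D = stability_const C_trace C_inv C_pen C_art C_\<tau>"
  define T where "T = test_const C_trace C_inv C_pen C_art C_\<tau>"
  \<comment> \<open>Formed from the fixed constants before mesh, velocity and diffusivity are
    introduced, which is the claimed uniformity.\<close>
  define \<beta> where "\<beta> = min (1 / (4 * (1 + 4 * D))) (1 / (4 * sqrt ((1 + 1 / (4 * D)) * T)))"
  have D: "0 < D" unfolding D_def stability_const_def
    using assms by (intro add_pos_nonneg mult_pos_pos mult_nonneg_nonneg divide_nonneg_nonneg) auto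
  have T: "0 < T" unfolding T_def test_const_def
    using assms by (intro add_pos_nonneg mult_pos_pos mult_nonneg_nonneg divide_nonneg_nonneg) auto
  have "0 < (1 + 1 / (4 * D)) * T" using D T by (intro mult_pos_pos add_pos_pos) auto
  then have "0 < \<beta>" using D by (simp add: \<beta>_def)
  moreover have "ereal \<beta> \<le> (INF U \<in> nonzero_pairs s p p\<^sub>f \<Omega> \<M>. SUP V \<in> nonzero_pairs s p p\<^sub>f \<Omega> \<M>.
       ereal (Bform \<Omega> \<M> a \<kappa> \<kappa>_art C_pen U V /
         (S_norm s p\<^sub>f \<Omega> \<M> a \<kappa> \<kappa>_art C_pen C_inv C_\<tau> U *
          S_norm s p\<^sub>f \<Omega> \<M> a \<kappa> \<kappa>_art C_pen C_inv C_\<tau> V)))"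
    if mesh: "conforming_mesh s \<Omega> \<M>" and smooth: "smooth_up_to_boundary \<Omega> a"
      and div0: "\<forall>x\<in>\<Omega>. divg a x = 0" and \<kappa>: "\<kappa> > 0"
      and trace: "trace_inequalities C_trace \<M> (V_bar s p \<Omega> \<M> \<union> V_disc s p\<^sub>f \<M>)"
      and inverse: "inverse_inequalities C_inv \<M> (V_bar s p \<Omega> \<M> \<union> V_disc s p\<^sub>f \<M>)"
      and art: "\<forall>K\<in>\<M>. \<kappa>_art K = C_art * inverse (rate C_inv \<kappa> a K) * (Linf_norm (interior K) a)\<^sup>2"
    for s \<M> and a :: "'a \<Rightarrow> 'a" and \<kappa> :: real and \<kappa>_art :: "'a set \<Rightarrow> real"
  proof -
    obtain a' where a': "C1_closure \<Omega> a a'" using C1_closure_smooth[OF smooth] by blast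
    interpret discretisation s \<Omega> \<M> p p\<^sub>f a a' \<kappa> \<kappa>_art C_trace C_inv C_pen C_art C_\<tau>
    proof unfold_locales
      \<comment> \<open>\<open>divg\<close> is expressed by \<open>frechet_derivative\<close>, which
        inside the domain is the derivative \<open>a'\<close> continued to the closure.\<close>
      show "(\<Sum>b\<in>Basis. a' x b \<bullet> b) = 0" if "x \<in> \<Omega>" for x
        using a' div0 that divg_eq[of a "a' x" x] unfolding C1_closure_def by simp
    qed (use assms mesh a' \<kappa> trace inverse art in simp_all)
    show ?thesis
    proof (rule INF_greatest)
      fix U assume "U \<in> nonzero_pairs s p p\<^sub>f \<Omega> \<M>"
      then obtain V where "V \<in> nonzero_pairs s p p\<^sub>f \<Omega> \<M>"
        "\<beta> \<le> Bform \<Omega> \<M> a \<kappa> \<kappa>_art C_pen U V /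
          (S_norm s p\<^sub>f \<Omega> \<M> a \<kappa> \<kappa>_art C_pen C_inv C_\<tau> U * S_norm s p\<^sub>f \<Omega> \<M> a \<kappa> \<kappa>_art C_pen C_inv C_\<tau> V)"
        using discrete_inf_sup unfolding \<beta>_def D_def T_def by blast
      then show "ereal \<beta> \<le> (SUP V \<in> nonzero_pairs s p p\<^sub>f \<Omega> \<M>.
         ereal (Bform \<Omega> \<M> a \<kappa> \<kappa>_art C_pen U V /
           (S_norm s p\<^sub>f \<Omega> \<M> a \<kappa> \<kappa>_art C_pen C_inv C_\<tau> U *
            S_norm s p\<^sub>f \<Omega> \<M> a \<kappa> \<kappa>_art C_pen C_inv C_\<tau> V)))"
        by (intro SUP_upper2) auto
    qed
  qed
  ultimately show ?thesis by blast
qed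

end
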